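(* Let $\nu>0$, $w\in\mathbb{C}$ and $\alpha,\beta>0$. The operator $\mathcal{R}_w^\nu: L^2_\nu(\mathbb{C})\to B^2_{\alpha,\beta}(D^2)$ is compact and its singular values (the eigenvalues of $((\mathcal{R}_w^\nu)^*\mathcal{R}_w^\nu)^{1/2}$) are given, for $m,n=0,1,2,\dots$, by $$s^{\nu,\alpha,\beta}_{m,n}(w)=\left(\frac{\nu\pi\,\Gamma(\alpha+1)\Gamma(\beta+1)}{\nu^{m+n}\,\Gamma(\alpha+m+2)\Gamma(\beta+n+2)}\right)^{1/2}|H^\nu_{m,n}(w,\overline{w})|.$$ Moreover, $\mathcal{R}_w^\nu$ belongs to the $p$-Schatten class for every $p>\max\left(\frac{2}{\alpha+1},\frac{2}{\beta+1}\right)$.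
   Context: Let $D=\{z\in\mathbb{C}: |z|<1\}$, $D^2=D\times D$, and let $d\lambda$ denote Lebesgue measure (on $\mathbb{C}$ or $\mathbb{C}^2$). $L^2_\nu(\mathbb{C})=L^2(\mathbb{C};e^{-\nu|z|^2}d\lambda)$. For real $\alpha,\beta>-1$, $B^2_{\alpha,\beta}(D^2)$ is the Hilbert space of all analytic functions on $D^2$ that are square integrable with respect to $d\mu_{\alpha,\beta}(z,w)=(1-|z|^2)^\alpha(1-|w|^2)^\beta\,d\lambda(z,w)$, with the inner product of $L^2(D^2;d\mu_{\alpha,\beta})$. The It\^o--Hermite polynomials are $$H^\nu_{m,n}(z,\overline{z})=(-1)^{m+n}e^{\nu|z|^2}\frac{\partial^{m+n}}{\partial\overline{z}^m\,\partial z^n}\left(e^{-\nu|z|^2}\right),\qquad m,n=0,1,2,\dots$$ For $u,v\in D$ and $\zeta,\xi\in\mathbb{C}$ put $$K^\nu_{u,v}(\zeta;\xi)=\frac{\nu}{\pi(1-uv)}\exp\left(\frac{\nu}{1-uv}\left\{-uv(|\zeta|^2+|\xi|^2)+u\overline{\zeta}\xi+v\zeta\overline{\xi}\right\}\right).$$ For fixed $w\in\mathbb{C}$, the transform $\mathcal{R}_w^\nu$ is defined by $$\mathcal{R}_w^\nu f(u,v)=\int_{\mathbb{C}}f(z)\,K^\nu_{u,v}(z;w)\,e^{-\nu|z|^2}\,d\lambda(z),\qquad (u,v)\in D^2.$$ Singular values are listed with multiplicity, indexed by pairs $(m,n)$ (not in decreasing order), and the value $0$ is allowed. An operator is in the $p$-Schatten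 class if its singular values are $p$-summable. *)

theory Defs
  imports "HOL-Analysis.Analysis"
begin

section \<open>Hilbert spaces of square integrable functions\<close>

text \<open>
  A Hilbert space is given by a measure \<open>M\<close> and a set of representatives, square integrable
  with respect to \<open>M\<close>. Vectors are functions, not classes: equality of vectors is always
  equality almost everywhere with respect to \<open>M\<close>, and all notions below respect it.
\<close>

record 'a fun_space =
  meas :: "'a measure"
  funs :: "('a \<Rightarrow> complex) set"

definition square_integrable :: "'a measure \<Rightarrow> ('a \<Rightarrow> complex) set" where
  "square_integrable M =
     {f \<in> borel_measurable M. integrable M (\<lambda>x. (cmod (f x))\<^sup>2)}"

definition inner_prod :: "'a fun_space \<Rightarrow> ('a \<Rightarrow> complex) \<Rightarrow> ('a \<Rightarrow> complex) \<Rightarrow> complex" where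
  "inner_prod X f g = (LINT x|meas X. f x * cnj (g x))"

definition norm_in :: "'a fun_space \<Rightarrow> ('a \<Rightarrow> complex) \<Rightarrow> real" where
  "norm_in X f = sqrt (LINT x|meas X. (cmod (f x))\<^sup>2)"

definition eq_in :: "'a fun_space \<Rightarrow> ('a \<Rightarrow> complex) \<Rightarrow> ('a \<Rightarrow> complex) \<Rightarrow> bool" where
  "eq_in X f g \<longleftrightarrow> (AE x in meas X. f x = g x)"


section \<open>Operators and singular values\<close>

text \<open>Linearity and boundedness imply that an operator respects equality almost everywhere.\<close>

definition bounded_op ::
  "'a fun_space \<Rightarrow> 'b fun_space \<Rightarrow> (('a \<Rightarrow> complex) \<Rightarrow> 'b \<Rightarrow> complex) \<Rightarrow> bool" where
  "bounded_op X Y T \<longleftrightarrow>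
     (\<forall>f\<in>funs X. T f \<in> funs Y) \<and>
     (\<forall>f\<in>funs X. \<forall>g\<in>funs X. \<forall>a b.
        eq_in Y (T (\<lambda>x. a * f x + b * g x)) (\<lambda>y. a * T f y + b * T g y)) \<and>
     (\<exists>C. \<forall>f\<in>funs X. norm_in Y (T f) \<le> C * norm_in X f)"

definition compact_op ::
  "'a fun_space \<Rightarrow> 'b fun_space \<Rightarrow> (('a \<Rightarrow> complex) \<Rightarrow> 'b \<Rightarrow> complex) \<Rightarrow> bool" where
  "compact_op X Y T \<longleftrightarrow>
     bounded_op X Y T \<and>
     (\<forall>f. (\<forall>k::nat. f k \<in> funs X \<and> norm_in X (f k) \<le> 1) \<longrightarrow>
        (\<exists>g\<in>funs Y. \<exists>r::nat \<Rightarrow> nat. strict_mono r \<and>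
           (\<lambda>k. norm_in Y (\<lambda>y. T (f (r k)) y - g y)) \<longlonglongrightarrow> 0))"

definition is_adjoint ::
  "'a fun_space \<Rightarrow> 'b fun_space \<Rightarrow> (('a \<Rightarrow> complex) \<Rightarrow> 'b \<Rightarrow> complex) \<Rightarrow>
   (('b \<Rightarrow> complex) \<Rightarrow> 'a \<Rightarrow> complex) \<Rightarrow> bool" where
  "is_adjoint X Y T S \<longleftrightarrow>
     bounded_op Y X S \<and>
     (\<forall>f\<in>funs X. \<forall>g\<in>funs Y. inner_prod Y (T f) g = inner_prod X f (S g))"

definition positive_op ::
  "'a fun_space \<Rightarrow> (('a \<Rightarrow> complex) \<Rightarrow> 'a \<Rightarrow> complex) \<Rightarrow> bool" where
  "positive_op X P \<longleftrightarrow>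
     bounded_op X X P \<and>
     (\<forall>f\<in>funs X. inner_prod X (P f) f \<in> \<real> \<and> 0 \<le> Re (inner_prod X (P f) f))"

definition is_positive_sqrt ::
  "'a fun_space \<Rightarrow> (('a \<Rightarrow> complex) \<Rightarrow> 'a \<Rightarrow> complex) \<Rightarrow>
   (('a \<Rightarrow> complex) \<Rightarrow> 'a \<Rightarrow> complex) \<Rightarrow> bool" where
  "is_positive_sqrt X A P \<longleftrightarrow> positive_op X P \<and> (\<forall>f\<in>funs X. eq_in X (P (P f)) (A f))"

definition eigenspace ::
  "'a fun_space \<Rightarrow> (('a \<Rightarrow> complex) \<Rightarrow> 'a \<Rightarrow> complex) \<Rightarrow> complex \<Rightarrow> ('a \<Rightarrow> complex) set" where
  "eigenspace X P c = {f \<in> funs X. eq_in X (P f) (\<lambda>x. c * f x)}"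

text \<open>For a closed subspace \<open>E\<close>, a maximal orthonormal family indexed by \<open>I\<close>.\<close>

definition orthonormal_basis ::
  "'a fun_space \<Rightarrow> ('a \<Rightarrow> complex) set \<Rightarrow> 'i set \<Rightarrow> ('i \<Rightarrow> 'a \<Rightarrow> complex) \<Rightarrow> bool" where
  "orthonormal_basis X E I e \<longleftrightarrow>
     (\<forall>i\<in>I. e i \<in> E) \<and>
     (\<forall>i\<in>I. \<forall>j\<in>I. inner_prod X (e i) (e j) = (if i = j then 1 else 0)) \<and>
     (\<forall>f\<in>E. (\<forall>i\<in>I. inner_prod X f (e i) = 0) \<longrightarrow> eq_in X f (\<lambda>_. 0))"

text \<open>
  The family \<open>s\<close> on \<open>I\<close> lists the eigenvalues of \<open>P\<close> with multiplicity: every complex number \<open>c\<close>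
  occurs in it exactly as often as the (Hilbert) dimension of its eigenspace. In particular a
  number outside the list is no eigenvalue, and \<open>0\<close> is listed as often as the dimension of the kernel.
\<close>

definition lists_eigenvalues ::
  "'a fun_space \<Rightarrow> (('a \<Rightarrow> complex) \<Rightarrow> 'a \<Rightarrow> complex) \<Rightarrow> 'i set \<Rightarrow> ('i \<Rightarrow> real) \<Rightarrow> bool" where
  "lists_eigenvalues X P I s \<longleftrightarrow>
     (\<forall>c::complex. \<exists>e. orthonormal_basis X (eigenspace X P c) {i\<in>I. complex_of_real (s i) = c} e)"

text \<open>
  The adjoint and the positive square root are unique up to equality almost everywhere, so the
  existential quantifiers only name \<open>T\<^sup>*\<close> and \<open>(T\<^sup>* T)\<^sup>1\<^sup>/\<^sup>2\<close>.
\<close>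

definition singular_values ::
  "'a fun_space \<Rightarrow> 'b fun_space \<Rightarrow> (('a \<Rightarrow> complex) \<Rightarrow> 'b \<Rightarrow> complex) \<Rightarrow>
   'i set \<Rightarrow> ('i \<Rightarrow> real) \<Rightarrow> bool" where
  "singular_values X Y T I s \<longleftrightarrow>
     (\<exists>S P. is_adjoint X Y T S \<and> is_positive_sqrt X (\<lambda>f. S (T f)) P \<and> lists_eigenvalues X P I s)"

text \<open>
  Pairs serve as indices; any countable family can be indexed by a set \<open>I\<close> of pairs, so
  this covers every operator on a separable space. For \<open>p > 0\<close> zero entries
  contribute nothing, as \<open>0 powr p = 0\<close>.
\<close>

definition schatten_class ::
  "real \<Rightarrow> 'a fun_space \<Rightarrow> 'b fun_space \<Rightarrow> (('a \<Rightarrow> complex) \<Rightarrow> 'b \<Rightarrow> complex) \<Rightarrow> bool" where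
  "schatten_class p X Y T \<longleftrightarrow>
     compact_op X Y T \<and>
     (\<exists>(I :: (nat \<times> nat) set) s. singular_values X Y T I s \<and> (\<lambda>i. s i powr p) summable_on I)"


section \<open>The spaces\<close>

definition L2_gauss :: "real \<Rightarrow> complex fun_space" where
  "L2_gauss \<nu> =
     (let M = density lborel (\<lambda>z. ennreal (exp (- \<nu> * (cmod z)\<^sup>2)))
      in \<lparr>meas = M, funs = square_integrable M\<rparr>)"

definition bidisc :: "(complex \<times> complex) set" where
  "bidisc = ball 0 1 \<times> ball 0 1"

definition mu_weight :: "real \<Rightarrow> real \<Rightarrow> (complex \<times> complex) measure" where
  "mu_weight \<alpha> \<beta> =
     density (restrict_space lborel bidisc)
       (\<lambda>(z, w). ennreal ((1 - (cmod z)\<^sup>2) powr \<alpha> * (1 - (cmod w)\<^sup>2) powr \<beta>))"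

text \<open>Analyticity in two variables: complex differentiability, i.e. the existence of a
  complex linear total derivative.\<close>

definition analytic2_on :: "(complex \<times> complex \<Rightarrow> complex) \<Rightarrow> (complex \<times> complex) set \<Rightarrow> bool" where
  "analytic2_on f U \<longleftrightarrow>
     open U \<and> (\<forall>p\<in>U. \<exists>a b. (f has_derivative (\<lambda>(h, k). a * h + b * k)) (at p))"

text \<open>The values of a function outside the bidisc are irrelevant, since the measure lives on
  the bidisc.\<close>

definition bergman2 :: "real \<Rightarrow> real \<Rightarrow> (complex \<times> complex) fun_space" where
  "bergman2 \<alpha> \<beta> =
     \<lparr>meas = mu_weight \<alpha> \<beta>,
      funs = {f \<in> square_integrable (mu_weight \<alpha> \<beta>). analytic2_on f bidisc}\<rparr>"


section \<open>Ito--Hermite polynomials and the transform\<close>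

text \<open>Wirtinger derivatives; the derivative at \<open>z\<close> is the real one, so its values at \<open>1\<close> and
  \<open>\<i>\<close> are the partial derivatives in the real and the imaginary direction.\<close>

definition wirtinger :: "(complex \<Rightarrow> complex) \<Rightarrow> complex \<Rightarrow> complex" where
  "wirtinger f z =
     (frechet_derivative f (at z) 1 - \<i> * frechet_derivative f (at z) \<i>) / 2"

definition wirtinger_bar :: "(complex \<Rightarrow> complex) \<Rightarrow> complex \<Rightarrow> complex" where
  "wirtinger_bar f z =
     (frechet_derivative f (at z) 1 + \<i> * frechet_derivative f (at z) \<i>) / 2"

definition ito_hermite :: "real \<Rightarrow> nat \<Rightarrow> nat \<Rightarrow> complex \<Rightarrow> complex" where
  "ito_hermite \<nu> m n z =
     (-1) ^ (m + n) * of_real (exp (\<nu> * (cmod z)\<^sup>2)) *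
     (wirtinger_bar ^^ m) ((wirtinger ^^ n) (\<lambda>z. of_real (exp (- \<nu> * (cmod z)\<^sup>2)))) z"

definition kernel_K :: "real \<Rightarrow> complex \<Rightarrow> complex \<Rightarrow> complex \<Rightarrow> complex \<Rightarrow> complex" where
  "kernel_K \<nu> u v \<zeta> \<xi> =
     of_real \<nu> / (of_real pi * (1 - u * v)) *
     exp (of_real \<nu> / (1 - u * v) *
       (- (u * v) * of_real ((cmod \<zeta>)\<^sup>2 + (cmod \<xi>)\<^sup>2) + u * cnj \<zeta> * \<xi> + v * \<zeta> * cnj \<xi>))"

definition transform_R ::
  "real \<Rightarrow> complex \<Rightarrow> (complex \<Rightarrow> complex) \<Rightarrow> complex \<times> complex \<Rightarrow> complex" where
  "transform_R \<nu> w f =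
     (\<lambda>(u, v). LINT z|lborel. f z * kernel_K \<nu> u v z w * of_real (exp (- \<nu> * (cmod z)\<^sup>2)))"

end

theory Submission
  imports Defs "HOL-Complex_Analysis.Great_Picard"
begin

text \<open>The transform is diagonal. The Ito--Hermite polynomials, normalized, form an orthonormal basis
  \<open>e\<^bsub>m,n\<^esub>\<close> of the Gaussian space, and the transform sends \<open>e\<^bsub>m,n\<^esub>\<close> to \<open>e\<^bsub>m,n\<^esub>(w) u\<^sup>m v\<^sup>n\<close>.
  The monomials \<open>u\<^sup>m v\<^sup>n\<close> are orthogonal in the Bergman space, with norms given by Beta integrals. So
  the singular values are the numbers \<open>\<bar>e\<^bsub>m,n\<^esub>(w)\<bar>\<close> times the norm of \<open>u\<^sup>m v\<^sup>n\<close>, and they are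
  listed with the right multiplicities because the \<open>e\<^bsub>m,n\<^esub>\<close> are complete.

  Four facts carry this. The action on the basis (\<open>inner_prod_hermite_kernel\<close>), like orthogonality
  (\<open>gauss_int_hermite_hermite\<close>), comes from integration by parts against a Gaussian, which turns
  the recursion of the Hermite polynomials into a recursion for their integrals. Completeness
  (\<open>hermite_basis_complete\<close>) comes from Stone--Weierstrass, after multiplying polynomials by Gaussians
  to make them bounded. The values \<open>e\<^bsub>m,n\<^esub>(w)\<close> are bounded uniformly in \<open>m\<close>, \<open>n\<close>
  (\<open>hermite_basis_bound\<close>), since they are coefficients of a function whose norm is explicit. And the Beta
  integrals decay like \<open>m powr - (\<alpha> + 1)\<close> (\<open>Beta_le_powr\<close>).

  The last two facts bound the square of the \<open>(m,n)\<close>-th singular value by a constant multiple of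
  \<open>m powr - (\<alpha> + 1) * n powr - (\<beta> + 1)\<close> for \<open>m, n \<ge> 1\<close>. Its power \<open>p/2\<close> is summable if \<open>p (\<alpha> + 1) / 2\<close> and
  \<open>p (\<beta> + 1) / 2\<close> exceed \<open>1\<close>, which is the stated range of Schatten exponents. For \<open>p = 2\<close> this
  uses \<open>\<alpha>, \<beta> > 0\<close> and says that the transform is a Hilbert--Schmidt operator. Square summable singular
  values make it possible to define the adjoint and the modulus by series that converge at every
  point, and compactness follows too; this part is carried out for abstract diagonal operators
  (\<open>singular_values_T\<close>, \<open>compact_T\<close>).

  Below, a prime attached to a complex number denotes its conjugate.\<close>

section \<open>Square integrable functions\<close>

lemma borel_measurable_cnj [measurable (raw)]:
  "f \<in> borel_measurable M \<Longrightarrow> (\<lambda>x. cnj (f x)) \<in> borel_measurable M"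
  by (rule borel_measurable_continuous_on[where f = cnj]) (auto intro: continuous_intros)

lemma square_integrable_measurable [measurable_dest]:
  "f \<in> square_integrable M \<Longrightarrow> f \<in> borel_measurable M"
  by (simp add: square_integrable_def)

lemma square_integrable_integrable_square:
  "f \<in> square_integrable M \<Longrightarrow> integrable M (\<lambda>x. (cmod (f x))\<^sup>2)"
  by (simp add: square_integrable_def)

lemma integrable_mult_cnj:
  assumes f: "f \<in> square_integrable M" and g: "g \<in> square_integrable M"
  shows "integrable M (\<lambda>x. f x * cnj (g x))"
proof (rule Bochner_Integration.integrable_bound)
  note [measurable] = square_integrable_measurable[OF f] square_integrable_measurable[OF g]
  show "integrable M (\<lambda>x. (cmod (f x))\<^sup>2 + (cmod (g x))\<^sup>2)"
    using f g by (intro Bochner_Integration.integrable_add square_integrable_integrable_square)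
  show "(\<lambda>x. f x * cnj (g x)) \<in> borel_measurable M" by measurable
  have "cmod a * cmod b \<le> (cmod a)\<^sup>2 + (cmod b)\<^sup>2" for a b :: complex
    using sum_squares_bound[of "cmod a" "cmod b"] mult_nonneg_nonneg[OF norm_ge_zero[of a] norm_ge_zero[of b]]
    by linarith
  then show "AE x in M. norm (f x * cnj (g x)) \<le> norm ((cmod (f x))\<^sup>2 + (cmod (g x))\<^sup>2)"
    by (auto simp: norm_mult)
qed

lemma square_integrable_scale:
  assumes "f \<in> square_integrable M"
  shows "(\<lambda>x. a * f x) \<in> square_integrable M"
  using assms unfolding square_integrable_def by (auto simp: norm_mult power_mult_distrib)

lemma square_integrable_add:
  assumes f: "f \<in> square_integrable M" and g: "g \<in> square_integrable M"
  shows "(\<lambda>x. f x + g x) \<in> square_integrable M"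
  unfolding square_integrable_def
proof (intro CollectI conjI)
  note [measurable] = square_integrable_measurable[OF f] square_integrable_measurable[OF g]
  show "(\<lambda>x. f x + g x) \<in> borel_measurable M" by measurable
  show "integrable M (\<lambda>x. (cmod (f x + g x))\<^sup>2)"
  proof (rule Bochner_Integration.integrable_bound)
    show "integrable M (\<lambda>x. 2 * (cmod (f x))\<^sup>2 + 2 * (cmod (g x))\<^sup>2)"
      using f g by (intro Bochner_Integration.integrable_add integrable_mult_right square_integrable_integrable_square)
    have "(cmod (a + b))\<^sup>2 \<le> 2 * (cmod a)\<^sup>2 + 2 * (cmod b)\<^sup>2" for a b
    proof -
      have "(cmod (a + b))\<^sup>2 \<le> (cmod a + cmod b)\<^sup>2"
        by (intro power_mono norm_triangle_ineq) simp
      also have "\<dots> \<le> 2 * (cmod a)\<^sup>2 + 2 * (cmod b)\<^sup>2"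
        using sum_squares_bound[of "cmod a" "cmod b"] by (simp add: power2_sum)
      finally show ?thesis .
    qed
    then show "AE x in M. norm ((cmod (f x + g x))\<^sup>2) \<le> norm (2 * (cmod (f x))\<^sup>2 + 2 * (cmod (g x))\<^sup>2)"
      by auto
  qed measurable
qed

lemma square_integrable_diff:
  assumes f: "f \<in> square_integrable M" and g: "g \<in> square_integrable M"
  shows "(\<lambda>x. f x - g x) \<in> square_integrable M"
  using square_integrable_add[OF f square_integrable_scale[OF g, of "-1"]] by simp

lemma square_integrable_lincomb:
  assumes "f \<in> square_integrable M" "g \<in> square_integrable M"
  shows "(\<lambda>x. a * f x + b * g x) \<in> square_integrable M"
  by (intro square_integrable_add square_integrable_scale assms)

lemma square_integrable_zero: "(\<lambda>_. 0) \<in> square_integrable M"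
  by (simp add: square_integrable_def)

lemma square_integrable_sum:
  assumes "\<And>i. i \<in> F \<Longrightarrow> f i \<in> square_integrable M"
  shows "(\<lambda>x. \<Sum>i\<in>F. a i * f i x) \<in> square_integrable M"
  using assms
  by (induction F rule: infinite_finite_induct)
     (auto intro!: square_integrable_add square_integrable_scale square_integrable_zero)

subsection \<open>The inner product\<close>

lemma inner_prod_add_left:
  assumes "f \<in> square_integrable (meas X)" "g \<in> square_integrable (meas X)" "h \<in> square_integrable (meas X)"
  shows "inner_prod X (\<lambda>x. f x + g x) h = inner_prod X f h + inner_prod X g h"
  unfolding inner_prod_def distrib_right
  by (intro Bochner_Integration.integral_add integrable_mult_cnj assms)

lemma inner_prod_scale_left:
  "inner_prod X (\<lambda>x. a * f x) h = a * inner_prod X f h"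
  unfolding inner_prod_def mult.assoc by simp

lemma inner_prod_lincomb_left:
  assumes "f \<in> square_integrable (meas X)" "g \<in> square_integrable (meas X)" "h \<in> square_integrable (meas X)"
  shows "inner_prod X (\<lambda>x. a * f x + b * g x) h = a * inner_prod X f h + b * inner_prod X g h"
  using assms by (simp add: inner_prod_add_left inner_prod_scale_left square_integrable_scale)

lemma inner_prod_diff_left:
  assumes "f \<in> square_integrable (meas X)" "g \<in> square_integrable (meas X)" "h \<in> square_integrable (meas X)"
  shows "inner_prod X (\<lambda>x. f x - g x) h = inner_prod X f h - inner_prod X g h"
  using inner_prod_lincomb_left[OF assms, of 1 "-1"] by simp

lemma inner_prod_commute: "inner_prod X g f = cnj (inner_prod X f g)"
proof -
  have "cnj (inner_prod X f g) = (LINT x|meas X. cnj (f x * cnj (g x)))"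
    unfolding inner_prod_def by (rule Bochner_Integration.integral_cnj[symmetric])
  then show ?thesis unfolding inner_prod_def by (simp add: mult.commute)
qed

lemma cmod_inner_prod_commute: "cmod (inner_prod X f g) = cmod (inner_prod X g f)"
  by (subst inner_prod_commute) (rule complex_mod_cnj)

lemma inner_prod_cong_AE:
  assumes "f \<in> borel_measurable (meas X)" "g \<in> borel_measurable (meas X)"
    "h \<in> borel_measurable (meas X)" "eq_in X f g"
  shows "inner_prod X f h = inner_prod X g h"
  unfolding inner_prod_def
  by (rule integral_cong_AE) (use assms in \<open>auto simp: eq_in_def\<close>)

lemma inner_prod_cong:
  assumes "\<And>x. x \<in> space (meas X) \<Longrightarrow> f x = g x"
  shows "inner_prod X f h = inner_prod X g h"
  unfolding inner_prod_def by (rule Bochner_Integration.integral_cong) (use assms in auto)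

lemma norm_in_cong:
  assumes "\<And>x. x \<in> space (meas X) \<Longrightarrow> f x = g x"
  shows "norm_in X f = norm_in X g"
proof -
  have "(LINT x|meas X. (cmod (f x))\<^sup>2) = (LINT x|meas X. (cmod (g x))\<^sup>2)"
    by (rule Bochner_Integration.integral_cong) (use assms in auto)
  then show ?thesis by (simp add: norm_in_def)
qed

lemma norm_in_nonneg [simp]: "0 \<le> norm_in X f"
  by (simp add: norm_in_def)

lemma norm_in_power2: "(norm_in X f)\<^sup>2 = (LINT x|meas X. (cmod (f x))\<^sup>2)"
  by (simp add: norm_in_def)

lemma inner_prod_self: "inner_prod X f f = of_real ((norm_in X f)\<^sup>2)"
  unfolding inner_prod_def norm_in_power2
  by (simp add: complex_norm_square[symmetric] del: of_real_power)

lemma inner_prod_sum_left: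
  assumes "\<And>i. i \<in> F \<Longrightarrow> f i \<in> square_integrable (meas X)" "h \<in> square_integrable (meas X)"
  shows "inner_prod X (\<lambda>x. \<Sum>i\<in>F. a i * f i x) h = (\<Sum>i\<in>F. a i * inner_prod X (f i) h)"
  using assms
proof (induction F rule: infinite_finite_induct)
  case (insert i F)
  then show ?case
    by (simp add: inner_prod_add_left inner_prod_scale_left square_integrable_scale square_integrable_sum)
qed (auto simp: inner_prod_def)

lemma Cauchy_Schwarz_inner_prod:
  assumes f: "f \<in> square_integrable (meas X)" and g: "g \<in> square_integrable (meas X)"
  shows "cmod (inner_prod X f g) \<le> norm_in X f * norm_in X g"
proof -
  note [measurable] = square_integrable_measurable[OF f] square_integrable_measurable[OF g]
  let ?M = "meas X"
  have I: "integrable ?M (\<lambda>x. cmod (f x) * cmod (g x))"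
    using integrable_norm[OF integrable_mult_cnj[OF f g]] by (simp add: norm_mult)
  have "cmod (inner_prod X f g) \<le> (LINT x|?M. cmod (f x) * cmod (g x))"
    unfolding inner_prod_def using integral_norm_bound[of ?M "\<lambda>x. f x * cnj (g x)"] by (simp add: norm_mult)
  moreover have "(LINT x|?M. cmod (f x) * cmod (g x))\<^sup>2 \<le> (norm_in X f)\<^sup>2 * (norm_in X g)\<^sup>2"
  proof -
    have "(\<integral>\<^sup>+x. ennreal (cmod (f x)) * ennreal (cmod (g x)) \<partial>?M)\<^sup>2 \<le>
        (\<integral>\<^sup>+x. (ennreal (cmod (f x)))\<^sup>2 \<partial>?M) * (\<integral>\<^sup>+x. (ennreal (cmod (g x)))\<^sup>2 \<partial>?M)"
      by (rule Cauchy_Schwarz_nn_integral) measurable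
    also have "(\<integral>\<^sup>+x. ennreal (cmod (f x)) * ennreal (cmod (g x)) \<partial>?M) = ennreal (LINT x|?M. cmod (f x) * cmod (g x))"
      using I by (simp add: nn_integral_eq_integral flip: ennreal_mult)
    also have "(\<integral>\<^sup>+x. (ennreal (cmod (f x)))\<^sup>2 \<partial>?M) = ennreal ((norm_in X f)\<^sup>2)"
      using square_integrable_integrable_square[OF f]
      by (simp add: nn_integral_eq_integral ennreal_power norm_in_power2)
    also have "(\<integral>\<^sup>+x. (ennreal (cmod (g x)))\<^sup>2 \<partial>?M) = ennreal ((norm_in X g)\<^sup>2)"
      using square_integrable_integrable_square[OF g]
      by (simp add: nn_integral_eq_integral ennreal_power norm_in_power2)
    finally show ?thesis
      by (simp add: ennreal_power integral_nonneg_AE flip: ennreal_mult)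
  qed
  then have "(LINT x|?M. cmod (f x) * cmod (g x)) \<le> norm_in X f * norm_in X g"
    unfolding power_mult_distrib[symmetric]
    by (rule power2_le_imp_le) (rule mult_nonneg_nonneg[OF norm_in_nonneg norm_in_nonneg])
  ultimately show ?thesis by simp
qed

section \<open>Orthonormal families\<close>

definition orthonormal :: "'a fun_space \<Rightarrow> ('i \<Rightarrow> 'a \<Rightarrow> complex) \<Rightarrow> bool" where
  "orthonormal X e \<longleftrightarrow> (\<forall>i. e i \<in> square_integrable (meas X)) \<and>
     (\<forall>i j. inner_prod X (e i) (e j) = (if i = j then 1 else 0))"

lemma orthonormal_square_integrable: "orthonormal X e \<Longrightarrow> e i \<in> square_integrable (meas X)"
  by (simp add: orthonormal_def)

lemma orthonormal_inner: "orthonormal X e \<Longrightarrow> inner_prod X (e i) (e j) = (if i = j then 1 else 0)"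
  by (simp add: orthonormal_def)

lemma inner_prod_sum_orthonormal:
  assumes e: "orthonormal X e" and F: "finite F"
  shows "inner_prod X (\<lambda>x. \<Sum>i\<in>F. a i * e i x) (e j) = (if j \<in> F then a j else 0)"
proof -
  have "inner_prod X (\<lambda>x. \<Sum>i\<in>F. a i * e i x) (e j) = (\<Sum>i\<in>F. a i * inner_prod X (e i) (e j))"
    by (rule inner_prod_sum_left) (use e in \<open>auto simp: orthonormal_square_integrable\<close>)
  also have "\<dots> = (\<Sum>i\<in>F. if i = j then a i else 0)"
    by (rule sum.cong) (use e in \<open>auto simp: orthonormal_inner\<close>)
  also have "\<dots> = (if j \<in> F then a j else 0)" using F by simp
  finally show ?thesis .
qed

lemma norm_in_sum_orthonormal:
  assumes e: "orthonormal X e" and F: "finite F"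
  shows "(norm_in X (\<lambda>x. \<Sum>i\<in>F. a i * e i x))\<^sup>2 = (\<Sum>i\<in>F. (cmod (a i))\<^sup>2)"
proof -
  let ?g = "\<lambda>x. \<Sum>i\<in>F. a i * e i x"
  have g: "?g \<in> square_integrable (meas X)"
    by (rule square_integrable_sum) (use e in \<open>auto simp: orthonormal_square_integrable\<close>)
  have "inner_prod X ?g ?g = (\<Sum>i\<in>F. a i * inner_prod X (e i) ?g)"
    by (rule inner_prod_sum_left) (use e g in \<open>auto simp: orthonormal_square_integrable\<close>)
  also have "\<dots> = (\<Sum>i\<in>F. of_real ((cmod (a i))\<^sup>2))"
  proof (rule sum.cong)
    fix i assume "i \<in> F"
    then have "inner_prod X (e i) ?g = cnj (a i)"
      by (subst inner_prod_commute) (simp add: inner_prod_sum_orthonormal[OF e F])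
    then show "a i * inner_prod X (e i) ?g = of_real ((cmod (a i))\<^sup>2)"
      by (simp add: complex_norm_square del: of_real_power)
  qed simp
  finally have "complex_of_real ((norm_in X ?g)\<^sup>2) = of_real (\<Sum>i\<in>F. (cmod (a i))\<^sup>2)"
    unfolding inner_prod_self by (simp del: of_real_power)
  then show ?thesis by (simp only: of_real_eq_iff)
qed

lemma Bessel_inequality_finite:
  assumes e: "orthonormal X e" and F: "finite F" and f: "f \<in> square_integrable (meas X)"
  shows "(\<Sum>i\<in>F. (cmod (inner_prod X f (e i)))\<^sup>2) \<le> (norm_in X f)\<^sup>2"
proof -
  let ?a = "\<lambda>i. inner_prod X f (e i)"
  let ?g = "\<lambda>x. \<Sum>i\<in>F. ?a i * e i x"
  let ?S = "\<Sum>i\<in>F. (cmod (?a i))\<^sup>2"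
  have g: "?g \<in> square_integrable (meas X)"
    by (rule square_integrable_sum) (use e in \<open>auto simp: orthonormal_square_integrable\<close>)
  have "inner_prod X ?g f = (\<Sum>i\<in>F. ?a i * inner_prod X (e i) f)"
    by (rule inner_prod_sum_left) (use e f in \<open>auto simp: orthonormal_square_integrable\<close>)
  also have "\<dots> = (\<Sum>i\<in>F. of_real ((cmod (?a i))\<^sup>2))"
    by (rule sum.cong) (auto simp: inner_prod_commute[of X _ f] complex_norm_square simp del: of_real_power)
  finally have gf: "inner_prod X ?g f = of_real ?S" by (simp del: of_real_power)
  have "?S = cmod (inner_prod X ?g f)" unfolding gf by (simp add: sum_nonneg del: of_real_power of_real_sum)
  also have "\<dots> \<le> norm_in X ?g * norm_in X f" by (rule Cauchy_Schwarz_inner_prod[OF g f])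
  also have "norm_in X ?g = sqrt ?S"
    unfolding norm_in_sum_orthonormal[OF e F, of ?a, symmetric] by simp
  finally have *: "?S \<le> sqrt ?S * norm_in X f" .
  have S: "?S \<ge> 0" by (simp add: sum_nonneg)
  show ?thesis
  proof (cases "?S = 0")
    case False
    then have "sqrt ?S > 0" using S by simp
    moreover have "sqrt ?S * sqrt ?S \<le> sqrt ?S * norm_in X f" using * S by simp
    ultimately have "sqrt ?S \<le> norm_in X f" by (simp only: mult_le_cancel_left_pos)
    then have "(sqrt ?S)\<^sup>2 \<le> (norm_in X f)\<^sup>2" using S by (intro power_mono) auto
    then show ?thesis using S by simp
  qed simp
qed

lemma nonneg_finite_sums_bounded_summable_on:
  fixes f :: "'i \<Rightarrow> real"
  assumes "\<And>i. 0 \<le> f i" "\<And>F. finite F \<Longrightarrow> sum f F \<le> C"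
  shows "f summable_on UNIV" "infsum f UNIV \<le> C"
proof -
  show s: "f summable_on UNIV"
    using assms by (intro nonneg_bdd_above_summable_on bdd_aboveI2[of _ _ C]) auto
  show "infsum f UNIV \<le> C"
    by (rule infsum_le_finite_sums[OF s]) (use assms in auto)
qed

lemma Bessel_inequality:
  assumes e: "orthonormal X e" and f: "f \<in> square_integrable (meas X)"
  shows "(\<lambda>i. (cmod (inner_prod X f (e i)))\<^sup>2) summable_on UNIV"
    "(\<Sum>\<^sub>\<infinity>i. (cmod (inner_prod X f (e i)))\<^sup>2) \<le> (norm_in X f)\<^sup>2"
proof -
  have 1: "0 \<le> (cmod (inner_prod X f (e i)))\<^sup>2" for i by (rule zero_le_power2)
  note 2 = Bessel_inequality_finite[OF e _ f]
  show "(\<lambda>i. (cmod (inner_prod X f (e i)))\<^sup>2) summable_on UNIV"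
    by (rule nonneg_finite_sums_bounded_summable_on(1)[OF 1 2])
  show "(\<Sum>\<^sub>\<infinity>i. (cmod (inner_prod X f (e i)))\<^sup>2) \<le> (norm_in X f)\<^sup>2"
    by (rule nonneg_finite_sums_bounded_summable_on(2)[OF 1 2])
qed

lemma abs_summable_on_mult_square_summable:
  fixes a b :: "'i \<Rightarrow> complex"
  assumes "(\<lambda>i. (cmod (a i))\<^sup>2) summable_on A" "(\<lambda>i. (cmod (b i))\<^sup>2) summable_on A"
  shows "(\<lambda>i. cmod (a i * b i)) summable_on A"
proof (rule Infinite_Sum.abs_summable_on_comparison_test'[OF summable_on_add[OF assms]])
  have "x * y \<le> x\<^sup>2 + y\<^sup>2" if "0 \<le> x" "0 \<le> y" for x y :: real
    using sum_squares_bound[of x y] mult_nonneg_nonneg[OF that] by linarith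
  then show "cmod (a i * b i) \<le> (cmod (a i))\<^sup>2 + (cmod (b i))\<^sup>2" for i
    by (simp add: norm_mult)
qed

subsection \<open>Orthogonal series that converge pointwise\<close>

definition initial_indices :: "nat \<Rightarrow> 'i::countable set" where
  "initial_indices N = {i. to_nat i < N}"

lemma finite_initial_indices [simp]: "finite (initial_indices N :: 'i::countable set)"
  unfolding initial_indices_def
  by (rule finite_subset[OF _ finite_vimageI[OF finite_lessThan[of N] inj_to_nat]]) auto

lemma has_sum_imp_initial_sums_tendsto:
  fixes f :: "'i::countable \<Rightarrow> 'b::{comm_monoid_add, topological_space}"
  assumes "(f has_sum S) UNIV"
  shows "(\<lambda>N. sum f (initial_indices N)) \<longlonglongrightarrow> S"
proof -
  have "filterlim (initial_indices :: nat \<Rightarrow> 'i set) (finite_subsets_at_top UNIV) sequentially"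
    unfolding filterlim_finite_subsets_at_top
  proof (intro allI impI)
    fix F :: "'i set" assume F: "finite F \<and> F \<subseteq> UNIV"
    show "\<forall>\<^sub>F N in sequentially. finite (initial_indices N :: 'i set) \<and> F \<subseteq> initial_indices N \<and> initial_indices N \<subseteq> UNIV"
      using eventually_gt_at_top[of "Max (insert 0 (to_nat ` F))"]
      by eventually_elim (use F in \<open>simp add: subset_iff, auto simp: initial_indices_def\<close>)
  qed
  then show ?thesis using assms unfolding has_sum_def by (rule filterlim_compose[rotated])
qed

text \<open>The norm is lower semicontinuous under pointwise convergence, by Fatou's lemma.\<close>

lemma norm_in_le_of_limit:
  assumes h: "\<And>k. h k \<in> square_integrable (meas X)"
    and lim: "\<And>x. x \<in> space (meas X) \<Longrightarrow> (\<lambda>k. h k x) \<longlonglongrightarrow> g x"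
    and bound: "\<forall>\<^sub>F k in sequentially. (norm_in X (h k))\<^sup>2 \<le> C" and C: "0 \<le> C"
  shows "g \<in> square_integrable (meas X)" "(norm_in X g)\<^sup>2 \<le> C"
proof -
  let ?M = "meas X"
  note [measurable] = square_integrable_measurable[OF h]
  have g[measurable]: "g \<in> borel_measurable ?M"
    by (rule borel_measurable_LIMSEQ_metric[of h]) (use lim in auto)
  have "(\<integral>\<^sup>+x. ennreal ((cmod (g x))\<^sup>2) \<partial>?M) = (\<integral>\<^sup>+x. liminf (\<lambda>k. ennreal ((cmod (h k x))\<^sup>2)) \<partial>?M)"
  proof (rule nn_integral_cong)
    fix x assume "x \<in> space ?M"
    then have "(\<lambda>k. ennreal ((cmod (h k x))\<^sup>2)) \<longlonglongrightarrow> ennreal ((cmod (g x))\<^sup>2)"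
      by (intro tendsto_ennrealI tendsto_intros lim)
    then show "ennreal ((cmod (g x))\<^sup>2) = liminf (\<lambda>k. ennreal ((cmod (h k x))\<^sup>2))"
      by (intro lim_imp_Liminf[symmetric]) auto
  qed
  also have "\<dots> \<le> liminf (\<lambda>k. \<integral>\<^sup>+x. ennreal ((cmod (h k x))\<^sup>2) \<partial>?M)"
    by (rule nn_integral_liminf) measurable
  also have "\<dots> = liminf (\<lambda>k. ennreal ((norm_in X (h k))\<^sup>2))"
    unfolding norm_in_power2
    by (subst nn_integral_eq_integral) (auto intro: square_integrable_integrable_square[OF h])
  also have "\<dots> \<le> ennreal C"
  proof -
    have "\<forall>\<^sub>F k in sequentially. ennreal ((norm_in X (h k))\<^sup>2) \<le> ennreal C"
      using bound by eventually_elim (rule ennreal_leI)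
    then have "Liminf sequentially (\<lambda>k. ennreal ((norm_in X (h k))\<^sup>2)) \<le> Liminf sequentially (\<lambda>k. ennreal C)"
      by (rule Liminf_mono)
    then show ?thesis by (simp add: Liminf_const)
  qed
  finally have le: "(\<integral>\<^sup>+x. ennreal ((cmod (g x))\<^sup>2) \<partial>?M) \<le> ennreal C" .
  have int: "integrable ?M (\<lambda>x. (cmod (g x))\<^sup>2)"
    by (rule integrableI_bounded) (use le in \<open>auto intro: le_less_trans simp: less_top[symmetric] top_unique\<close>)
  then show "g \<in> square_integrable ?M" by (simp add: square_integrable_def)
  have "ennreal ((norm_in X g)\<^sup>2) \<le> ennreal C"
    unfolding norm_in_power2 using le nn_integral_eq_integral[OF int] by simp
  then show "(norm_in X g)\<^sup>2 \<le> C" using C by simp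
qed

text \<open>In \<open>L\<^sup>2\<close> the partial sums of an orthogonal series with square summable coefficients form a
  Cauchy sequence. Since the series is also assumed to converge at every point, its limit need
  not be obtained from completeness: the pointwise sum is the candidate, and Fatou's lemma bounds
  its distance from a partial sum by the tail of the coefficients.\<close>

lemma orthogonal_series:
  fixes e :: "'i::countable \<Rightarrow> 'a \<Rightarrow> complex"
  assumes e: "orthonormal X e"
    and a: "(\<lambda>i. (cmod (a i))\<^sup>2) summable_on UNIV"
    and pointwise: "\<And>x. x \<in> space (meas X) \<Longrightarrow> (\<lambda>i. cmod (a i * e i x)) summable_on UNIV"
  defines "g \<equiv> \<lambda>x. \<Sum>\<^sub>\<infinity>i. a i * e i x"
  shows "g \<in> square_integrable (meas X)"
    and "(norm_in X g)\<^sup>2 = (\<Sum>\<^sub>\<infinity>i. (cmod (a i))\<^sup>2)"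
    and "\<And>f. f \<in> square_integrable (meas X) \<Longrightarrow> inner_prod X g f = (\<Sum>\<^sub>\<infinity>i. a i * inner_prod X (e i) f)"
    and "\<And>j. inner_prod X g (e j) = a j"
proof -
  let ?M = "meas X"
  define h where "h N = (\<lambda>x. \<Sum>i\<in>initial_indices N. a i * e i x)" for N
  let ?S = "\<lambda>A. infsum (\<lambda>i. (cmod (a i))\<^sup>2) A"
  have h: "h N \<in> square_integrable ?M" for N
    unfolding h_def by (rule square_integrable_sum) (use e in \<open>auto simp: orthonormal_square_integrable\<close>)
  have lim: "(\<lambda>N. h N x) \<longlonglongrightarrow> g x" if "x \<in> space ?M" for x
    unfolding h_def g_def
    by (rule has_sum_imp_initial_sums_tendsto, rule has_sum_infsum, rule abs_summable_summable, rule pointwise[OF that])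
  have normh: "(norm_in X (h N))\<^sup>2 = (\<Sum>i\<in>initial_indices N. (cmod (a i))\<^sup>2)" for N
    unfolding h_def by (rule norm_in_sum_orthonormal[OF e]) simp
  have "(norm_in X (h N))\<^sup>2 \<le> ?S UNIV" for N
    unfolding normh by (rule finite_sum_le_infsum[OF a]) auto
  then show g: "g \<in> square_integrable ?M"
    by (intro norm_in_le_of_limit(1)[OF h lim, where C = "?S UNIV"]) (auto intro: infsum_nonneg)
  have tail: "(norm_in X (\<lambda>x. g x - h N x))\<^sup>2 \<le> ?S UNIV - (\<Sum>i\<in>initial_indices N. (cmod (a i))\<^sup>2)" for N
  proof (rule norm_in_le_of_limit(2)[of "\<lambda>k x. h k x - h N x"])
    show "(\<lambda>x. h k x - h N x) \<in> square_integrable ?M" for k by (intro square_integrable_diff h)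
    show "(\<lambda>k. h k x - h N x) \<longlonglongrightarrow> g x - h N x" if "x \<in> space ?M" for x by (intro tendsto_intros lim that)
    show "\<forall>\<^sub>F k in sequentially. (norm_in X (\<lambda>x. h k x - h N x))\<^sup>2 \<le> ?S UNIV - (\<Sum>i\<in>initial_indices N. (cmod (a i))\<^sup>2)"
      using eventually_ge_at_top[of N]
    proof eventually_elim
      case (elim k)
      have sub: "initial_indices N \<subseteq> (initial_indices k :: 'i set)" using elim by (auto simp: initial_indices_def)
      have "(\<lambda>x. h k x - h N x) = (\<lambda>x. \<Sum>i\<in>initial_indices k - initial_indices N. a i * e i x)"
        unfolding h_def by (intro ext) (simp add: sum_diff[OF _ sub])
      then have "(norm_in X (\<lambda>x. h k x - h N x))\<^sup>2 = (\<Sum>i\<in>initial_indices k - initial_indices N. (cmod (a i))\<^sup>2)"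
        by (simp add: norm_in_sum_orthonormal[OF e])
      also have "\<dots> = (\<Sum>i\<in>initial_indices k. (cmod (a i))\<^sup>2) - (\<Sum>i\<in>initial_indices N. (cmod (a i))\<^sup>2)"
        by (simp add: sum_diff[OF _ sub])
      also have "(\<Sum>i\<in>initial_indices k. (cmod (a i))\<^sup>2) \<le> ?S UNIV" by (rule finite_sum_le_infsum[OF a]) auto
      finally show ?case by simp
    qed
    show "0 \<le> ?S UNIV - (\<Sum>i\<in>initial_indices N. (cmod (a i))\<^sup>2)"
      using finite_sum_le_infsum[OF a, of "initial_indices N"] by simp
  qed
  have S: "(\<lambda>N. (\<Sum>i\<in>initial_indices N. (cmod (a i))\<^sup>2)) \<longlonglongrightarrow> ?S UNIV"
    by (rule has_sum_imp_initial_sums_tendsto[OF has_sum_infsum[OF a]])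
  have "(\<lambda>N. ?S UNIV - (\<Sum>i\<in>initial_indices N. (cmod (a i))\<^sup>2)) \<longlonglongrightarrow> ?S UNIV - ?S UNIV"
    by (intro tendsto_intros S)
  then have "(\<lambda>N. ?S UNIV - (\<Sum>i\<in>initial_indices N. (cmod (a i))\<^sup>2)) \<longlonglongrightarrow> 0" by simp
  then have "(\<lambda>N. (norm_in X (\<lambda>x. g x - h N x))\<^sup>2) \<longlonglongrightarrow> 0"
    by (rule Lim_null_comparison[rotated]) (simp add: tail)
  then have "(\<lambda>N. sqrt ((norm_in X (\<lambda>x. g x - h N x))\<^sup>2)) \<longlonglongrightarrow> sqrt 0"
    by (rule tendsto_real_sqrt)
  then have L2: "(\<lambda>N. norm_in X (\<lambda>x. g x - h N x)) \<longlonglongrightarrow> 0" by simp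
  have weak: "(\<lambda>N. inner_prod X (h N) f) \<longlonglongrightarrow> inner_prod X g f" if f: "f \<in> square_integrable ?M" for f
  proof -
    have "(\<lambda>N. inner_prod X g f - inner_prod X (h N) f) \<longlonglongrightarrow> 0"
    proof (rule Lim_null_comparison)
      show "\<forall>\<^sub>F N in sequentially. norm (inner_prod X g f - inner_prod X (h N) f) \<le> norm_in X (\<lambda>x. g x - h N x) * norm_in X f"
        using Cauchy_Schwarz_inner_prod[OF square_integrable_diff[OF g h] f]
        by (simp add: inner_prod_diff_left[OF g h f])
      show "(\<lambda>N. norm_in X (\<lambda>x. g x - h N x) * norm_in X f) \<longlonglongrightarrow> 0"
        using tendsto_mult_right[OF L2, of "norm_in X f"] by simp
    qed
    from tendsto_diff[OF tendsto_const[of "inner_prod X g f"] this] show ?thesis by simp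
  qed
  show inner: "inner_prod X g f = (\<Sum>\<^sub>\<infinity>i. a i * inner_prod X (e i) f)" if f: "f \<in> square_integrable ?M" for f
  proof -
    have "(\<lambda>i. (cmod (inner_prod X (e i) f))\<^sup>2) summable_on UNIV"
      unfolding cmod_inner_prod_commute[of X _ f] by (rule Bessel_inequality(1)[OF e f])
    from abs_summable_on_mult_square_summable[OF a this]
    have "((\<lambda>i. a i * inner_prod X (e i) f) has_sum (\<Sum>\<^sub>\<infinity>i. a i * inner_prod X (e i) f)) UNIV"
      by (rule has_sum_infsum[OF abs_summable_summable])
    from has_sum_imp_initial_sums_tendsto[OF this]
    have "(\<lambda>N. inner_prod X (h N) f) \<longlonglongrightarrow> (\<Sum>\<^sub>\<infinity>i. a i * inner_prod X (e i) f)"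
      unfolding h_def by (subst inner_prod_sum_left) (use e f in \<open>auto simp: orthonormal_square_integrable\<close>)
    then show ?thesis using weak[OF f] LIMSEQ_unique by blast
  qed
  show coeff: "inner_prod X g (e j) = a j" for j
  proof -
    have "inner_prod X g (e j) = (\<Sum>\<^sub>\<infinity>i. a i * inner_prod X (e i) (e j))"
      by (rule inner) (rule orthonormal_square_integrable[OF e])
    also have "\<dots> = (\<Sum>\<^sub>\<infinity>i\<in>{j}. a i)"
      by (rule infsum_cong_neutral) (auto simp: orthonormal_inner[OF e])
    finally show ?thesis by simp
  qed
  show "(norm_in X g)\<^sup>2 = ?S UNIV"
  proof -
    have "complex_of_real ((norm_in X g)\<^sup>2) = (\<Sum>\<^sub>\<infinity>i. a i * inner_prod X (e i) g)"
      unfolding inner_prod_self[symmetric] by (rule inner[OF g])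
    also have "\<dots> = (\<Sum>\<^sub>\<infinity>i. of_real ((cmod (a i))\<^sup>2))"
      by (rule infsum_cong) (simp add: inner_prod_commute[of X _ g] coeff complex_norm_square del: of_real_power)
    also have "\<dots> = of_real (?S UNIV)"
      by (rule infsumI[OF has_sum_of_real[OF has_sum_infsum[OF a]]])
    finally show ?thesis by (simp only: of_real_eq_iff)
  qed
qed

section \<open>Diagonal operators with square summable entries\<close>

text \<open>Dominated convergence for series: outside a finite set the weights sum up to little.\<close>

lemma infsum_weighted_tendsto_0:
  fixes b :: "'i \<Rightarrow> real" and x :: "nat \<Rightarrow> 'i \<Rightarrow> real"
  assumes b: "b summable_on UNIV" "\<And>i. 0 \<le> b i"
    and x: "\<And>k i. 0 \<le> x k i" "\<And>k i. x k i \<le> C" "\<And>i. (\<lambda>k. x k i) \<longlonglongrightarrow> 0"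
  shows "(\<lambda>k. \<Sum>\<^sub>\<infinity>i. b i * x k i) \<longlonglongrightarrow> 0"
proof (rule LIMSEQ_I)
  fix \<epsilon> :: real assume "\<epsilon> > 0"
  have C: "0 \<le> C" using x(1,2) order_trans by blast
  \<comment> \<open>The summand \<open>1\<close> avoids division by zero if \<open>C = 0\<close>.\<close>
  define \<delta> where "\<delta> = \<epsilon> / (2 * (C + 1))"
  have \<delta>: "\<delta> > 0" "C * \<delta> < \<epsilon> / 2"
    using \<open>\<epsilon> > 0\<close> C by (auto simp: \<delta>_def field_simps)
  obtain F where F: "finite F" "dist (sum b F) (infsum b UNIV) \<le> \<delta>"
    using infsum_finite_approximation[OF b(1) \<delta>(1)] by blast
  have sF: "b summable_on (- F)" by (rule summable_on_subset[OF b(1)]) simp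
  have sbx: "(\<lambda>i. b i * x k i) summable_on A" for k A
  proof (rule summable_on_subset[of _ UNIV])
    show "(\<lambda>i. b i * x k i) summable_on UNIV"
      by (rule summable_on_comparison_test[OF summable_on_cmult_left[OF b(1), of C]])
         (use b x in \<open>auto intro: mult_left_mono\<close>)
  qed simp
  have tail: "infsum b (- F) \<le> \<delta>"
  proof -
    have "infsum b UNIV = infsum b F + infsum b (- F)"
      using infsum_Un_disjoint[of b F "- F"] F sF by simp
    then show ?thesis using F by (simp add: dist_real_def)
  qed
  have "(\<lambda>k. \<Sum>i\<in>F. b i * x k i) \<longlonglongrightarrow> (\<Sum>i\<in>F. b i * 0)"
    by (intro tendsto_intros x)
  then have "\<forall>\<^sub>F k in sequentially. (\<Sum>i\<in>F. b i * x k i) < \<epsilon> / 2"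
    by (rule order_tendstoD(2)) (use \<open>\<epsilon> > 0\<close> in simp)
  then obtain K where K: "\<And>k. k \<ge> K \<Longrightarrow> (\<Sum>i\<in>F. b i * x k i) < \<epsilon> / 2"
    by (auto simp: eventually_sequentially)
  have "norm ((\<Sum>\<^sub>\<infinity>i. b i * x k i) - 0) < \<epsilon>" if "k \<ge> K" for k
  proof -
    have "(\<Sum>\<^sub>\<infinity>i\<in>- F. b i * x k i) \<le> (\<Sum>\<^sub>\<infinity>i\<in>- F. b i * C)"
      by (rule infsum_mono[OF sbx summable_on_cmult_left[OF sF]]) (use b x in \<open>auto intro: mult_left_mono\<close>)
    also have "\<dots> = infsum b (- F) * C" by (rule infsum_cmult_left) (use sF in simp)
    also have "\<dots> \<le> \<delta> * C" by (rule mult_right_mono[OF tail C])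
    finally have "(\<Sum>\<^sub>\<infinity>i\<in>- F. b i * x k i) < \<epsilon> / 2" using \<delta> by (simp add: mult.commute)
    moreover have "(\<Sum>\<^sub>\<infinity>i. b i * x k i) = (\<Sum>i\<in>F. b i * x k i) + (\<Sum>\<^sub>\<infinity>i\<in>- F. b i * x k i)"
      using infsum_Un_disjoint[of "\<lambda>i. b i * x k i" F "- F"] F sbx by simp
    moreover have "0 \<le> (\<Sum>\<^sub>\<infinity>i. b i * x k i)" by (rule infsum_nonneg) (use b x in simp)
    ultimately show ?thesis using K[OF that] by simp
  qed
  then show "\<exists>K. \<forall>k\<ge>K. norm ((\<Sum>\<^sub>\<infinity>i. b i * x k i) - 0) < \<epsilon>" by blast
qed

definition weighted_series :: "('i \<Rightarrow> real) \<Rightarrow> ('i \<Rightarrow> 'a \<Rightarrow> complex) \<Rightarrow> ('i \<Rightarrow> complex) \<Rightarrow> 'a \<Rightarrow> complex" where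
  "weighted_series s \<psi> a x = (\<Sum>\<^sub>\<infinity>i. of_real (s i) * a i * \<psi> i x)"

text \<open>Operators act on functions and not on classes, so a series that defines the value of an
  operator has to converge at every point. The weights make this possible: if the weighted values
  of the family at each point are square summable, as they are in spaces with bounded point
  evaluations, then the weighted series of every square summable family of coefficients converges
  absolutely everywhere.\<close>

locale weighted_orthonormal =
  fixes Z :: "'a fun_space" and \<psi> :: "'i::countable \<Rightarrow> 'a \<Rightarrow> complex" and s :: "'i \<Rightarrow> real"
  assumes orthonormal: "orthonormal Z \<psi>"
    and weight_nonneg: "\<And>i. 0 \<le> s i"
    and weight_summable: "(\<lambda>i. (s i)\<^sup>2) summable_on UNIV"
    and pointwise_summable: "\<And>x. x \<in> space (meas Z) \<Longrightarrow> (\<lambda>i. (s i * cmod (\<psi> i x))\<^sup>2) summable_on UNIV"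
begin

definition "weight_bound = sqrt (\<Sum>\<^sub>\<infinity>i. (s i)\<^sup>2)"

lemma weight_bound_nonneg: "0 \<le> weight_bound"
  by (simp add: weight_bound_def infsum_nonneg)

lemma weight_square_le: "(s i)\<^sup>2 \<le> weight_bound\<^sup>2"
proof -
  have "sum (\<lambda>i. (s i)\<^sup>2) {i} \<le> (\<Sum>\<^sub>\<infinity>i. (s i)\<^sup>2)"
    by (rule finite_sum_le_infsum[OF weight_summable]) auto
  then show ?thesis by (simp add: weight_bound_def infsum_nonneg)
qed

context
  fixes a :: "'i \<Rightarrow> complex"
  assumes a: "(\<lambda>i. (cmod (a i))\<^sup>2) summable_on UNIV"
begin

lemma weighted_coeffs_le: "(cmod (of_real (s i) * a i))\<^sup>2 \<le> weight_bound\<^sup>2 * (cmod (a i))\<^sup>2"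
  unfolding norm_mult power_mult_distrib
  by (rule mult_right_mono) (simp_all add: weight_square_le)

lemma weighted_coeffs_summable: "(\<lambda>i. (cmod (of_real (s i) * a i))\<^sup>2) summable_on UNIV"
  by (rule summable_on_comparison_test[OF summable_on_cmult_right[OF a, of "weight_bound\<^sup>2"]])
     (rule weighted_coeffs_le, rule zero_le_power2)

lemma weighted_series_abs_summable:
  assumes "x \<in> space (meas Z)"
  shows "(\<lambda>i. cmod (of_real (s i) * a i * \<psi> i x)) summable_on UNIV"
proof -
  have "(\<lambda>i. (cmod (of_real (s i) * \<psi> i x))\<^sup>2) summable_on UNIV"
    using pointwise_summable[OF assms] by (simp add: norm_mult power_mult_distrib)
  from abs_summable_on_mult_square_summable[OF a this] show ?thesis
    by (simp add: mult_ac)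
qed

lemma weighted_series_summable:
  assumes "x \<in> space (meas Z)"
  shows "(\<lambda>i. of_real (s i) * a i * \<psi> i x) summable_on UNIV"
  by (rule abs_summable_summable[OF weighted_series_abs_summable[OF assms]])

lemma weighted_series_eq: "weighted_series s \<psi> a = (\<lambda>x. \<Sum>\<^sub>\<infinity>i. (of_real (s i) * a i) * \<psi> i x)"
  by (simp add: weighted_series_def fun_eq_iff)

lemma weighted_series_square_integrable: "weighted_series s \<psi> a \<in> square_integrable (meas Z)"
  unfolding weighted_series_eq
  by (rule orthogonal_series(1)[OF orthonormal weighted_coeffs_summable weighted_series_abs_summable])

lemma norm_weighted_series:
  "(norm_in Z (weighted_series s \<psi> a))\<^sup>2 = (\<Sum>\<^sub>\<infinity>i. (s i)\<^sup>2 * (cmod (a i))\<^sup>2)"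
  unfolding weighted_series_eq
  using orthogonal_series(2)[OF orthonormal weighted_coeffs_summable weighted_series_abs_summable]
  by (simp add: norm_mult power_mult_distrib)

lemma norm_weighted_series_le:
  "(norm_in Z (weighted_series s \<psi> a))\<^sup>2 \<le> weight_bound\<^sup>2 * (\<Sum>\<^sub>\<infinity>i. (cmod (a i))\<^sup>2)"
proof -
  have "(\<Sum>\<^sub>\<infinity>i. (cmod (of_real (s i) * a i))\<^sup>2) \<le> (\<Sum>\<^sub>\<infinity>i. weight_bound\<^sup>2 * (cmod (a i))\<^sup>2)"
    by (rule infsum_mono[OF weighted_coeffs_summable summable_on_cmult_right[OF a] weighted_coeffs_le])
  also have "\<dots> = weight_bound\<^sup>2 * (\<Sum>\<^sub>\<infinity>i. (cmod (a i))\<^sup>2)"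
    by (rule infsum_cmult_right) (use a in simp)
  finally show ?thesis unfolding norm_weighted_series by (simp add: norm_mult power_mult_distrib)
qed

lemma inner_weighted_series:
  assumes "f \<in> square_integrable (meas Z)"
  shows "inner_prod Z (weighted_series s \<psi> a) f = (\<Sum>\<^sub>\<infinity>i. of_real (s i) * a i * inner_prod Z (\<psi> i) f)"
  unfolding weighted_series_eq
  by (rule orthogonal_series(3)[OF orthonormal weighted_coeffs_summable weighted_series_abs_summable assms])

lemma inner_weighted_series_coeff: "inner_prod Z (weighted_series s \<psi> a) (\<psi> j) = of_real (s j) * a j"
  unfolding weighted_series_eq
  by (rule orthogonal_series(4)[OF orthonormal weighted_coeffs_summable weighted_series_abs_summable])

end

lemma weighted_series_lincomb:
  assumes a: "(\<lambda>i. (cmod (a i))\<^sup>2) summable_on UNIV" and b: "(\<lambda>i. (cmod (b i))\<^sup>2) summable_on UNIV"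
    and x: "x \<in> space (meas Z)"
  shows "weighted_series s \<psi> (\<lambda>i. c * a i + d * b i) x = c * weighted_series s \<psi> a x + d * weighted_series s \<psi> b x"
proof -
  have "((\<lambda>i. c * (of_real (s i) * a i * \<psi> i x) + d * (of_real (s i) * b i * \<psi> i x)) has_sum
      c * weighted_series s \<psi> a x + d * weighted_series s \<psi> b x) UNIV"
    unfolding weighted_series_def
    by (intro has_sum_add has_sum_cmult_right has_sum_infsum weighted_series_summable a b x)
  then show ?thesis
    unfolding weighted_series_def by (intro infsumI) (simp add: algebra_simps)
qed

text \<open>By Bessel's inequality the coefficients of \<open>f\<close> are square summable, and weighting them multiplies
  their norm by at most the largest weight. The adjoint, the modulus and the operator itself are
  all of this form.\<close>

lemma bounded_op_weighted_series:
  fixes e :: "'i \<Rightarrow> 'b \<Rightarrow> complex"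
  assumes W: "funs W \<subseteq> square_integrable (meas W)" and e: "orthonormal W e"
    and V: "\<And>f. f \<in> funs W \<Longrightarrow> V f \<in> funs Z"
    and lin: "\<And>f g a b. f \<in> funs W \<Longrightarrow> g \<in> funs W \<Longrightarrow> (\<lambda>x. a * f x + b * g x) \<in> funs W"
    and V_eq: "\<And>f x. f \<in> funs W \<Longrightarrow> x \<in> space (meas Z) \<Longrightarrow>
        V f x = weighted_series s \<psi> (\<lambda>i. inner_prod W f (e i)) x"
  shows "bounded_op W Z V"
  unfolding bounded_op_def
proof (intro conjI ballI allI)
  note e_sq = orthonormal_square_integrable[OF e]
  have W': "f \<in> square_integrable (meas W)" if "f \<in> funs W" for f using W that by blast
  note bessel = Bessel_inequality[OF e W']
  show "V f \<in> funs Z" if "f \<in> funs W" for f by (rule V[OF that])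
  show "eq_in Z (V (\<lambda>x. a * f x + b * g x)) (\<lambda>y. a * V f y + b * V g y)"
    if f: "f \<in> funs W" and g: "g \<in> funs W" for f g a b
    unfolding eq_in_def
  proof (rule AE_I2)
    fix x assume x: "x \<in> space (meas Z)"
    have "V (\<lambda>x. a * f x + b * g x) x =
        weighted_series s \<psi> (\<lambda>i. a * inner_prod W f (e i) + b * inner_prod W g (e i)) x"
      unfolding V_eq[OF lin[OF f g] x] by (simp add: inner_prod_lincomb_left[OF W'[OF f] W'[OF g] e_sq])
    also have "\<dots> = a * V f x + b * V g x"
      unfolding V_eq[OF f x] V_eq[OF g x]
      by (rule weighted_series_lincomb[OF bessel(1)[OF f] bessel(1)[OF g] x])
    finally show "V (\<lambda>x. a * f x + b * g x) x = a * V f x + b * V g x" .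
  qed
  show "\<exists>C. \<forall>f\<in>funs W. norm_in Z (V f) \<le> C * norm_in W f"
  proof (intro exI ballI)
    fix f assume f: "f \<in> funs W"
    have "(norm_in Z (V f))\<^sup>2 = (norm_in Z (weighted_series s \<psi> (\<lambda>i. inner_prod W f (e i))))\<^sup>2"
      by (subst norm_in_cong[OF V_eq[OF f]]) simp_all
    also have "\<dots> \<le> weight_bound\<^sup>2 * (\<Sum>\<^sub>\<infinity>i. (cmod (inner_prod W f (e i)))\<^sup>2)"
      by (rule norm_weighted_series_le[OF bessel(1)[OF f]])
    also have "\<dots> \<le> weight_bound\<^sup>2 * (norm_in W f)\<^sup>2"
      by (rule mult_left_mono[OF bessel(2)[OF f]]) simp
    finally have "(norm_in Z (V f))\<^sup>2 \<le> (weight_bound * norm_in W f)\<^sup>2" by (simp only: power_mult_distrib)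
    then show "norm_in Z (V f) \<le> weight_bound * norm_in W f"
      by (rule power2_le_imp_le) (rule mult_nonneg_nonneg[OF weight_bound_nonneg norm_in_nonneg])
  qed
qed

end

text \<open>The operator sends \<open>e i\<close> to \<open>s i\<close> times \<open>\<phi> i\<close>. The eigenvalues of its modulus are counted in the
  domain, hence the completeness of \<open>e\<close>.\<close>

locale diagonal_operator =
  domain: weighted_orthonormal X e s + range: weighted_orthonormal Y \<phi> s
  for X :: "'a fun_space" and e :: "'i::countable \<Rightarrow> 'a \<Rightarrow> complex" and s :: "'i \<Rightarrow> real"
    and Y :: "'b fun_space" and \<phi> :: "'i \<Rightarrow> 'b \<Rightarrow> complex" +
  fixes T :: "('a \<Rightarrow> complex) \<Rightarrow> 'b \<Rightarrow> complex"
  assumes funs_X: "funs X = square_integrable (meas X)"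
    and complete: "\<And>f. f \<in> funs X \<Longrightarrow> (\<And>i. inner_prod X f (e i) = 0) \<Longrightarrow> eq_in X f (\<lambda>_. 0)"
    and funs_Y: "funs Y \<subseteq> square_integrable (meas Y)"
    and lin_Y: "\<And>f g a b. f \<in> funs Y \<Longrightarrow> g \<in> funs Y \<Longrightarrow> (\<lambda>y. a * f y + b * g y) \<in> funs Y"
    and series_Y: "\<And>a. (\<lambda>i. (cmod (a i))\<^sup>2) summable_on UNIV \<Longrightarrow> weighted_series s \<phi> a \<in> funs Y"
    and T_Y: "\<And>f. f \<in> funs X \<Longrightarrow> T f \<in> funs Y"
    and T_eq: "\<And>f y. f \<in> funs X \<Longrightarrow> y \<in> space (meas Y) \<Longrightarrow>
        T f y = weighted_series s \<phi> (\<lambda>i. inner_prod X f (e i)) y"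
begin

lemma funs_XD: "f \<in> funs X \<Longrightarrow> f \<in> square_integrable (meas X)"
  and funs_YD: "g \<in> funs Y \<Longrightarrow> g \<in> square_integrable (meas Y)"
  using funs_X funs_Y by auto

lemmas bessel_X = Bessel_inequality(1)[OF domain.orthonormal funs_XD]
lemmas bessel_Y = Bessel_inequality(1)[OF range.orthonormal funs_YD]

lemma lin_X: "f \<in> funs X \<Longrightarrow> g \<in> funs X \<Longrightarrow> (\<lambda>x. a * f x + b * g x) \<in> funs X"
  unfolding funs_X by (rule square_integrable_lincomb)

lemma bounded_T: "bounded_op X Y T"
  by (rule range.bounded_op_weighted_series[OF _ domain.orthonormal T_Y lin_X T_eq])
     (simp_all add: funs_X)

lemma inner_T: "f \<in> funs X \<Longrightarrow> inner_prod Y (T f) h = inner_prod Y (weighted_series s \<phi> (\<lambda>i. inner_prod X f (e i))) h"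
  by (rule inner_prod_cong) (rule T_eq)

text \<open>The coefficients of a bounded sequence converge along a subsequence, one index after the other, to a
  square summable family \<open>b\<close>. Against square summable weights this suffices for convergence of
  the images in norm.\<close>

lemma compact_T: "compact_op X Y T"
  unfolding compact_op_def
proof (intro conjI bounded_T allI impI)
  fix f assume f: "\<forall>k::nat. f k \<in> funs X \<and> norm_in X (f k) \<le> 1"
  define c where "c k i = inner_prod X (f k) (e i)" for k i
  have fX: "f k \<in> funs X" for k using f by blast
  have c2: "(\<lambda>i. (cmod (c k i))\<^sup>2) summable_on UNIV" for k
    unfolding c_def by (rule bessel_X[OF fX])
  have c_sum: "(\<Sum>i\<in>F. (cmod (c k i))\<^sup>2) \<le> 1" if "finite F" for F k
  proof -
    have "(\<Sum>i\<in>F. (cmod (c k i))\<^sup>2) \<le> (norm_in X (f k))\<^sup>2"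
      unfolding c_def by (rule Bessel_inequality_finite[OF domain.orthonormal that funs_XD[OF fX]])
    also have "\<dots> \<le> 1\<^sup>2" by (rule power_mono) (use f in auto)
    finally show ?thesis by simp
  qed
  have c_le: "cmod (c k i) \<le> 1" for k i
    using c_sum[of "{i}" k] by (simp add: power_le_one_iff)
  obtain r where r: "strict_mono r" and conv: "\<And>i. i \<in> UNIV \<Longrightarrow> \<exists>l. (\<lambda>k. c (r k) i) \<longlonglongrightarrow> l"
    using function_convergent_subsequence[of "UNIV :: 'i set" c 1] c_le by auto
  obtain b where b: "\<And>i. (\<lambda>k. c (r k) i) \<longlonglongrightarrow> b i" using conv by (metis UNIV_I)
  have b_sum: "(\<Sum>i\<in>F. (cmod (b i))\<^sup>2) \<le> 1" if "finite F" for F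
  proof (rule LIMSEQ_le_const2)
    show "(\<lambda>k. \<Sum>i\<in>F. (cmod (c (r k) i))\<^sup>2) \<longlonglongrightarrow> (\<Sum>i\<in>F. (cmod (b i))\<^sup>2)"
      by (intro tendsto_intros b)
  qed (use c_sum[OF that] in blast)
  have b2: "(\<lambda>i. (cmod (b i))\<^sup>2) summable_on UNIV"
    by (rule nonneg_finite_sums_bounded_summable_on(1)[OF zero_le_power2 b_sum])
  have b_le: "cmod (b i) \<le> 1" for i
    using b_sum[of "{i}"] by (simp add: power_le_one_iff)
  have diff2: "(\<lambda>i. (cmod (1 * c k i + (-1) * b i))\<^sup>2) summable_on UNIV" for k
  proof (rule summable_on_comparison_test[OF summable_on_cmult_right[OF summable_on_add[OF c2 b2], of 2 k]])
    show "(cmod (1 * c k i + (-1) * b i))\<^sup>2 \<le> 2 * ((cmod (c k i))\<^sup>2 + (cmod (b i))\<^sup>2)" for i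
    proof -
      have "(cmod (1 * c k i + (-1) * b i))\<^sup>2 \<le> (cmod (c k i) + cmod (b i))\<^sup>2"
        by (intro power_mono) (use norm_triangle_ineq4[of "c k i" "b i"] in auto)
      then show ?thesis using sum_squares_bound[of "cmod (c k i)" "cmod (b i)"] by (simp add: power2_sum)
    qed
  qed simp
  have norm_diff: "(norm_in Y (\<lambda>y. T (f k) y - weighted_series s \<phi> b y))\<^sup>2 = (\<Sum>\<^sub>\<infinity>i. (s i)\<^sup>2 * (cmod (1 * c k i + (-1) * b i))\<^sup>2)" for k
  proof -
    have "norm_in Y (\<lambda>y. T (f k) y - weighted_series s \<phi> b y) = norm_in Y (weighted_series s \<phi> (\<lambda>i. 1 * c k i + (-1) * b i))"
    proof (rule norm_in_cong)
      fix y assume y: "y \<in> space (meas Y)"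
      have "T (f k) y = weighted_series s \<phi> (c k) y" unfolding T_eq[OF fX y] c_def ..
      then show "T (f k) y - weighted_series s \<phi> b y = weighted_series s \<phi> (\<lambda>i. 1 * c k i + (-1) * b i) y"
        unfolding range.weighted_series_lincomb[OF c2 b2 y] by simp
    qed
    then show ?thesis using range.norm_weighted_series[OF diff2] by simp
  qed
  have "(\<lambda>k. \<Sum>\<^sub>\<infinity>i. (s i)\<^sup>2 * (cmod (1 * c (r k) i + (-1) * b i))\<^sup>2) \<longlonglongrightarrow> 0"
  proof (rule infsum_weighted_tendsto_0[OF domain.weight_summable, where C = 4])
    show "(cmod (1 * c (r k) i + (-1) * b i))\<^sup>2 \<le> 4" for k i
    proof -
      have "cmod (1 * c (r k) i + (-1) * b i) \<le> 2"
        using norm_triangle_ineq4[of "c (r k) i" "b i"] c_le[of "r k" i] b_le[of i] by simp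
      from power_mono[OF this norm_ge_zero, of 2] show ?thesis by simp
    qed
    show "(\<lambda>k. (cmod (1 * c (r k) i + (-1) * b i))\<^sup>2) \<longlonglongrightarrow> 0" for i
    proof -
      have "(\<lambda>k. (cmod (1 * c (r k) i + (-1) * b i))\<^sup>2) \<longlonglongrightarrow> (cmod (1 * b i + (-1) * b i))\<^sup>2"
        by (intro tendsto_intros b)
      then show ?thesis by simp
    qed
  qed auto
  then have "(\<lambda>k. sqrt ((norm_in Y (\<lambda>y. T (f (r k)) y - weighted_series s \<phi> b y))\<^sup>2)) \<longlonglongrightarrow> sqrt 0"
    unfolding norm_diff[symmetric] by (rule tendsto_real_sqrt)
  then have "(\<lambda>k. norm_in Y (\<lambda>y. T (f (r k)) y - weighted_series s \<phi> b y)) \<longlonglongrightarrow> 0" by simp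
  then show "\<exists>g\<in>funs Y. \<exists>r. strict_mono r \<and> (\<lambda>k. norm_in Y (\<lambda>y. T (f (r k)) y - g y)) \<longlonglongrightarrow> 0"
    using series_Y[OF b2] r by blast
qed

definition adj :: "('b \<Rightarrow> complex) \<Rightarrow> 'a \<Rightarrow> complex" where
  "adj g = weighted_series s e (\<lambda>i. inner_prod Y g (\<phi> i))"

definition modulus :: "('a \<Rightarrow> complex) \<Rightarrow> 'a \<Rightarrow> complex" where
  "modulus f = weighted_series s e (\<lambda>i. inner_prod X f (e i))"

lemma adjoint_adj: "is_adjoint X Y T adj"
  unfolding is_adjoint_def
proof (intro conjI ballI)
  show "bounded_op Y X adj"
    by (rule domain.bounded_op_weighted_series[OF funs_Y range.orthonormal _ lin_Y])
       (auto simp: adj_def funs_X intro: domain.weighted_series_square_integrable bessel_Y)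
  fix f g assume f: "f \<in> funs X" and g: "g \<in> funs Y"
  have "inner_prod X f (adj g) = cnj (inner_prod X (adj g) f)" by (rule inner_prod_commute)
  also have "\<dots> = (\<Sum>\<^sub>\<infinity>i. cnj (of_real (s i) * inner_prod Y g (\<phi> i) * inner_prod X (e i) f))"
    unfolding adj_def domain.inner_weighted_series[OF bessel_Y[OF g] funs_XD[OF f]] by (rule infsum_cnj[symmetric])
  also have "\<dots> = (\<Sum>\<^sub>\<infinity>i. of_real (s i) * inner_prod X f (e i) * inner_prod Y (\<phi> i) g)"
    by (rule infsum_cong) (simp add: inner_prod_commute[of X _ "e _"] inner_prod_commute[of Y _ "\<phi> _"])
  also have "\<dots> = inner_prod Y (T f) g"
    unfolding inner_T[OF f] by (rule range.inner_weighted_series[OF bessel_X[OF f] funs_YD[OF g], symmetric])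
  finally show "inner_prod Y (T f) g = inner_prod X f (adj g)" ..
qed

lemma modulus_in: "f \<in> funs X \<Longrightarrow> modulus f \<in> funs X"
  unfolding modulus_def funs_X
  by (rule domain.weighted_series_square_integrable) (rule bessel_X, simp add: funs_X)

lemma positive_modulus: "positive_op X modulus"
  unfolding positive_op_def
proof (intro conjI ballI)
  show "bounded_op X X modulus"
    by (rule domain.bounded_op_weighted_series[OF _ domain.orthonormal modulus_in lin_X])
       (auto simp: funs_X modulus_def)
  fix f assume f: "f \<in> funs X"
  have eq: "inner_prod X (modulus f) f = (\<Sum>\<^sub>\<infinity>i. of_real (s i * (cmod (inner_prod X f (e i)))\<^sup>2))"
    unfolding modulus_def domain.inner_weighted_series[OF bessel_X[OF f] funs_XD[OF f]]
    by (rule infsum_cong)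
       (simp add: inner_prod_commute[of X "e _" f] complex_norm_square mult.assoc del: of_real_power)
  also have "\<dots> = of_real (\<Sum>\<^sub>\<infinity>i. s i * (cmod (inner_prod X f (e i)))\<^sup>2)"
  proof (rule infsumI[OF has_sum_of_real[OF has_sum_infsum]])
    have "s i \<le> domain.weight_bound" for i
      using domain.weight_square_le domain.weight_bound_nonneg by (rule power2_le_imp_le)
    then show "(\<lambda>i. s i * (cmod (inner_prod X f (e i)))\<^sup>2) summable_on UNIV"
      by (intro summable_on_comparison_test[OF summable_on_cmult_right[OF bessel_X[OF f], of domain.weight_bound]])
         (auto intro: mult_right_mono mult_nonneg_nonneg domain.weight_nonneg)
  qed
  finally have eq: "inner_prod X (modulus f) f = of_real (\<Sum>\<^sub>\<infinity>i. s i * (cmod (inner_prod X f (e i)))\<^sup>2)" .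
  show "inner_prod X (modulus f) f \<in> \<real>" unfolding eq by simp
  show "0 \<le> Re (inner_prod X (modulus f) f)"
    unfolding eq by (simp add: infsum_nonneg domain.weight_nonneg)
qed

text \<open>Both operators multiply the coefficients of \<open>f\<close> by \<open>s\<^sup>2\<close>, and even their values agree.\<close>

lemma sqrt_modulus: "is_positive_sqrt X (\<lambda>f. adj (T f)) modulus"
  unfolding is_positive_sqrt_def
proof (intro conjI positive_modulus ballI)
  fix f assume f: "f \<in> funs X"
  have "inner_prod X (modulus f) (e i) = inner_prod Y (T f) (\<phi> i)" for i
    unfolding inner_T[OF f] range.inner_weighted_series_coeff[OF bessel_X[OF f]]
    unfolding modulus_def domain.inner_weighted_series_coeff[OF bessel_X[OF f]] ..
  then have "modulus (modulus f) = adj (T f)"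
    unfolding adj_def modulus_def[of "modulus f"] by simp
  then show "eq_in X (modulus (modulus f)) (adj (T f))" by (simp add: eq_in_def)
qed

lemma modulus_basis: "modulus (e j) = (\<lambda>x. of_real (s j) * e j x)"
proof
  fix x
  have "modulus (e j) x = (\<Sum>\<^sub>\<infinity>i\<in>{j}. of_real (s i) * 1 * e i x)"
    unfolding modulus_def weighted_series_def
    by (rule infsum_cong_neutral) (auto simp: orthonormal_inner[OF domain.orthonormal])
  then show "modulus (e j) x = of_real (s j) * e j x" by simp
qed

text \<open>Each basis vector \<open>e i\<close> is an eigenvector for \<open>s i\<close>. An eigenvector for \<open>c\<close> is orthogonal to every \<open>e i\<close>
  with \<open>s i \<noteq> c\<close>, by comparison of coefficients; if it is also orthogonal to the others, it vanishes
  because the basis is complete.\<close>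

lemma eigenvalues_modulus: "lists_eigenvalues X modulus UNIV s"
  unfolding lists_eigenvalues_def
proof (intro allI exI)
  fix c :: complex
  have e_X: "e i \<in> funs X" for i
    unfolding funs_X by (rule orthonormal_square_integrable[OF domain.orthonormal])
  show "orthonormal_basis X (eigenspace X modulus c) {i \<in> UNIV. of_real (s i) = c} e"
    unfolding orthonormal_basis_def
  proof (intro conjI ballI impI)
    show "e i \<in> eigenspace X modulus c" if "i \<in> {i \<in> UNIV. of_real (s i) = c}" for i
      using that e_X by (auto simp: eigenspace_def eq_in_def modulus_basis)
    show "inner_prod X (e i) (e j) = (if i = j then 1 else 0)" for i j
      by (rule orthonormal_inner[OF domain.orthonormal])
    fix f assume f: "f \<in> eigenspace X modulus c"
      and orth: "\<forall>i\<in>{i \<in> UNIV. of_real (s i) = c}. inner_prod X f (e i) = 0"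
    have fX: "f \<in> funs X" and ev: "eq_in X (modulus f) (\<lambda>x. c * f x)"
      using f by (auto simp: eigenspace_def)
    have "inner_prod X f (e i) = 0" for i
    proof (cases "of_real (s i) = c")
      case True then show ?thesis using orth by blast
    next
      case False
      have "of_real (s i) * inner_prod X f (e i) = inner_prod X (modulus f) (e i)"
        unfolding modulus_def by (rule domain.inner_weighted_series_coeff[OF bessel_X[OF fX], symmetric])
      also have "\<dots> = inner_prod X (\<lambda>x. c * f x) (e i)"
        by (rule inner_prod_cong_AE[OF _ _ _ ev])
           (use modulus_in[OF fX] fX e_X[of i] in \<open>auto simp: funs_X intro: square_integrable_measurable square_integrable_scale\<close>)
      also have "\<dots> = c * inner_prod X f (e i)" by (rule inner_prod_scale_left)
      finally show ?thesis using False by simp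
    qed
    then show "eq_in X f (\<lambda>_. 0)" by (rule complete[OF fX])
  qed
qed

theorem singular_values_T: "singular_values X Y T UNIV s"
  unfolding singular_values_def using adjoint_adj sqrt_modulus eigenvalues_modulus by blast

end

section \<open>Gaussian integrals over the plane\<close>

lemma integral_lborel_translate:
  fixes f :: "'a::euclidean_space \<Rightarrow> 'b::{banach, second_countable_topology}"
  shows "(LINT z|lborel. f (c + z)) = (LINT z|lborel. f z)"
proof (cases "f \<in> borel_measurable borel")
  case True
  have "(LINT z|lborel. f z) = (LINT z|distr lborel borel ((+) c). f z)" by (simp add: lborel_distr_plus)
  also have "\<dots> = (LINT z|lborel. f (c + z))" by (rule integral_distr) (use True in auto)
  finally show ?thesis ..
next
  case False
  have "\<not> integrable lborel f" using False borel_measurable_integrable by auto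
  moreover have "\<not> integrable lborel (\<lambda>z. f (c + z))"
  proof
    assume "integrable lborel (\<lambda>z. f (c + z))"
    then have "(\<lambda>z. f (c + z)) \<in> borel_measurable borel" by (simp add: borel_measurable_integrable)
    then have "(\<lambda>z. f (c + (- c + z))) \<in> borel_measurable borel" by (rule measurable_compose[rotated]) simp
    then show False using False by simp
  qed
  ultimately show ?thesis by (simp add: not_integrable_integral_eq)
qed

lemma integrable_lborel_translate:
  fixes f :: "'a::euclidean_space \<Rightarrow> 'b::{banach, second_countable_topology}"
  assumes "integrable lborel f"
  shows "integrable lborel (\<lambda>z. f (c + z))"
proof -
  have "integrable (distr lborel borel ((+) c)) f" using assms by (simp add: lborel_distr_plus)
  then show ?thesis by (subst (asm) integrable_distr_eq) (use assms in \<open>auto dest: borel_measurable_integrable\<close>)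
qed

text \<open>Integration by parts without boundary terms. The translates of \<open>\<phi>\<close> have the same integral, and
  \<open>\<phi> (h + z) - \<phi> z\<close> is the integral of the derivative along the segment from \<open>z\<close> to \<open>h + z\<close>. By
  Fubini and translation invariance the integral of this difference is that of \<open>\<psi>\<close>; hence no decay
  at infinity beyond integrability has to be discussed.\<close>

lemma integral_directional_derivative_eq_0:
  fixes \<phi> \<psi> :: "complex \<Rightarrow> complex"
  assumes D: "\<And>z. (\<phi> has_derivative D z) (at z)" and \<psi>: "\<And>z. \<psi> z = D z h"
    and cont: "continuous_on UNIV \<psi>"
    and int: "integrable lborel \<phi>" "integrable lborel \<psi>"
  shows "(LINT z|lborel. \<psi> z) = 0"
proof -
  let ?F = "\<lambda>z t. indicator {0..1::real} t *\<^sub>R \<psi> (t *\<^sub>R h + z)"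
  have [measurable]: "\<psi> \<in> borel_measurable borel" using cont by (rule borel_measurable_continuous_onI)
  have FTC: "(LINT t|lborel. ?F z t) = \<phi> (h + z) - \<phi> z" for z
  proof -
    have "(LINT t|lborel. ?F z t) = \<phi> (1 *\<^sub>R h + z) - \<phi> (0 *\<^sub>R h + z)"
    proof (rule integral_FTC_atLeastAtMost)
      fix t :: real
      have "((\<lambda>t. t *\<^sub>R h + z) has_derivative (\<lambda>t. t *\<^sub>R h)) (at t within {0..1})"
        by (auto intro!: derivative_eq_intros)
      from has_derivative_compose[OF this D]
      have "((\<lambda>t. \<phi> (t *\<^sub>R h + z)) has_derivative (\<lambda>x. D (t *\<^sub>R h + z) (x *\<^sub>R h))) (at t within {0..1})" .
      moreover have "D (t *\<^sub>R h + z) (x *\<^sub>R h) = x *\<^sub>R \<psi> (t *\<^sub>R h + z)" for x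
        unfolding \<psi> by (rule linear_cmul[OF has_derivative_linear[OF D]])
      ultimately show "((\<lambda>t. \<phi> (t *\<^sub>R h + z)) has_vector_derivative \<psi> (t *\<^sub>R h + z)) (at t within {0..1})"
        by (simp add: has_vector_derivative_def)
    next
      show "continuous_on {0..1} (\<lambda>t. \<psi> (t *\<^sub>R h + z))"
        by (rule continuous_on_compose2[OF cont]) (auto intro!: continuous_intros)
    qed simp
    then show ?thesis by simp
  qed
  have inner: "(LINT z|lborel. ?F z t) = indicator {0..1} t *\<^sub>R (LINT z|lborel. \<psi> z)" for t
    by (simp add: integral_lborel_translate)
  have "integrable (lborel \<Otimes>\<^sub>M lborel) (\<lambda>(t, z). ?F z t)"
  proof (rule lborel_pair.Fubini_integrable)
    show "(\<lambda>(t, z). ?F z t) \<in> borel_measurable (lborel \<Otimes>\<^sub>M lborel)" by measurable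
    have eq: "(LINT z|lborel. norm (?F z t)) = indicator {0..1} t *\<^sub>R (LINT z|lborel. norm (\<psi> z))" for t
      using integral_lborel_translate[of "\<lambda>z. norm (\<psi> z)" "t *\<^sub>R h"] by (simp split: split_indicator)
    have "integrable lborel (\<lambda>t::real. indicator {0..1} t *\<^sub>R (LINT z|lborel. norm (\<psi> z)))"
      by (rule integrable_scaleR_left) (simp add: integrable_indicator_iff)
    then show "integrable lborel (\<lambda>t. LINT z|lborel. norm (case (t, z) of (t, z) \<Rightarrow> ?F z t))"
      unfolding prod.case eq .
    show "AE t in lborel. integrable lborel (\<lambda>z. case (t, z) of (t, z) \<Rightarrow> ?F z t)"
      by (intro AE_I2) (simp add: integrable_lborel_translate[OF int(2)])
  qed
  from lborel_pair.Fubini_integral[OF this]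
  have "(LINT z|lborel. LINT t|lborel. ?F z t) = (LINT t|lborel. LINT z|lborel. ?F z t)" .
  then have "(LINT z|lborel. \<phi> (h + z) - \<phi> z) = (LINT t|lborel. indicator {0..1::real} t *\<^sub>R (LINT z|lborel. \<psi> z))"
    unfolding FTC inner .
  moreover have "(LINT z|lborel. \<phi> (h + z) - \<phi> z) = 0"
    using int(1) by (simp add: integrable_lborel_translate integral_lborel_translate)
  ultimately show ?thesis by simp
qed

subsection \<open>Radial functions\<close>

text \<open>Polar coordinates for radial integrands: \<open>\<bar>z\<bar>\<^sup>2\<close> is distributed with constant density \<open>\<pi>\<close> on the
  half line, because the disc of radius \<open>\<surd>a\<close> has area \<open>\<pi> a\<close>.\<close>

lemma distr_norm_square_lborel:
  "distr lborel borel (\<lambda>z::complex. (cmod z)\<^sup>2) = density lborel (\<lambda>t. ennreal (pi * indicator {0..} t))"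
proof (rule measure_eqI_generator_eq[where E = "range (\<lambda>a::real. {..a})" and \<Omega> = UNIV and A = "\<lambda>n. {..real n}"])
  let ?M = "distr lborel borel (\<lambda>z::complex. (cmod z)\<^sup>2)"
  have M: "emeasure ?M {..a} = ennreal (pi * max 0 a)" for a
  proof -
    have "emeasure ?M {..a} = emeasure lborel {z::complex. (cmod z)\<^sup>2 \<le> a}"
      by (subst emeasure_distr) (auto simp: vimage_def)
    also have "\<dots> = ennreal (pi * max 0 a)"
    proof (cases "a < 0")
      case True
      then have "{z::complex. (cmod z)\<^sup>2 \<le> a} = {}"
        using zero_le_power2 order.strict_trans1 by (metis (no_types, lifting) Collect_empty_eq leD order.trans)
      then show ?thesis using True by simp
    next
      case False
      have "{z::complex. (cmod z)\<^sup>2 \<le> a} = cball 0 (sqrt a)"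
        by (auto simp: real_le_rsqrt) (metis False norm_ge_zero not_less power_mono real_sqrt_pow2)
      then show ?thesis using False emeasure_cball[of "sqrt a" "0::complex"]
        by (simp add: unit_ball_vol_2 mult_ac max_def)
    qed
    finally show ?thesis .
  qed
  have "emeasure (density lborel (\<lambda>t. ennreal (pi * indicator {0..} t))) {..a} = ennreal (pi * max 0 a)" for a :: real
  proof -
    have "emeasure (density lborel (\<lambda>t. ennreal (pi * indicator {0..} t))) {..a} =
        (\<integral>\<^sup>+t. ennreal pi * indicator {0..a} t \<partial>lborel)"
      by (subst emeasure_density) (auto intro!: nn_integral_cong split: split_indicator)
    also have "\<dots> = ennreal pi * emeasure lborel {0..a}" by (rule nn_integral_cmult_indicator) simp
    also have "\<dots> = ennreal (pi * max 0 a)" by (simp add: emeasure_lborel_Icc_eq max_def ennreal_mult)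
    finally show ?thesis .
  qed
  then show "emeasure ?M X = emeasure (density lborel (\<lambda>t. ennreal (pi * indicator {0..} t))) X"
    if "X \<in> range (\<lambda>a::real. {..a})" for X using that M by auto
  show "sets ?M = sigma_sets UNIV (range (\<lambda>a::real. {..a}))"
    by (simp add: borel_eq_atMost) 
  then show "sets (density lborel (\<lambda>t. ennreal (pi * indicator {0..} t))) = sigma_sets UNIV (range (\<lambda>a::real. {..a}))"
    by simp
  show "Int_stable (range (\<lambda>a::real. {..a}))" by (auto simp: Int_stable_def)
  show "(\<Union>i. {..real i}) = UNIV" by (auto intro: real_arch_simple)
  show "emeasure ?M {..real i} \<noteq> \<infinity>" for i unfolding M by simp
qed auto

lemma has_bochner_integral_radial:
  fixes g :: "real \<Rightarrow> 'a::{banach, second_countable_topology}"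
  assumes [measurable]: "g \<in> borel_measurable borel"
    and g: "has_bochner_integral lborel (\<lambda>t. indicator {0..} t *\<^sub>R g t) I"
  shows "has_bochner_integral lborel (\<lambda>z::complex. g ((cmod z)\<^sup>2)) (pi *\<^sub>R I)"
proof -
  have eq: "(\<lambda>t. (pi * indicator {0..} t) *\<^sub>R g t) = (\<lambda>t. pi *\<^sub>R (indicator {0..} t *\<^sub>R g t))" by simp
  have "has_bochner_integral lborel (\<lambda>t. (pi * indicator {0..} t) *\<^sub>R g t) (pi *\<^sub>R I)"
    unfolding eq by (rule has_bochner_integral_scaleR_right) (use g in simp)
  then have "has_bochner_integral (density lborel (\<lambda>t. ennreal (pi * indicator {0..} t))) g (pi *\<^sub>R I)"
    by (rule has_bochner_integral_density[rotated 3]) auto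
  then have "has_bochner_integral (distr lborel borel (\<lambda>z::complex. (cmod z)\<^sup>2)) g (pi *\<^sub>R I)"
    unfolding distr_norm_square_lborel .
  then show ?thesis
    unfolding has_bochner_integral_iff by (simp add: integrable_distr_eq integral_distr)
qed

lemma has_bochner_integral_exp_half_line:
  assumes "Re \<gamma> > 0"
  shows "has_bochner_integral lborel (\<lambda>t. indicator {0..} t *\<^sub>R exp (- \<gamma> * of_real t)) (1 / \<gamma>)"
proof -
  have \<gamma>: "\<gamma> \<noteq> 0" using assms by auto
  have "(\<integral>\<^sup>+t. ennreal (exp (- Re \<gamma> * t)) * indicator {0..} t \<partial>lborel) = 0 - (- exp (- Re \<gamma> * 0) / Re \<gamma>)"
  proof (rule nn_integral_FTC_atLeast)
    show "((\<lambda>t. - exp (- Re \<gamma> * t) / Re \<gamma>) has_real_derivative exp (- Re \<gamma> * t)) (at t)" for t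
      using assms by (auto intro!: derivative_eq_intros)
    have "filterlim (\<lambda>t. Re \<gamma> * t) at_top at_top"
      by (rule filterlim_tendsto_pos_mult_at_top[OF tendsto_const assms filterlim_ident])
    then have "((\<lambda>t. exp (- (Re \<gamma> * t))) \<longlongrightarrow> 0) at_top"
      by (intro filterlim_compose[OF exp_at_bot]) (simp add: filterlim_uminus_at_top[symmetric])
    then have "((\<lambda>t. - exp (- (Re \<gamma> * t)) / Re \<gamma>) \<longlongrightarrow> - 0 / Re \<gamma>) at_top"
      by (intro tendsto_intros) (use assms in auto)
    then show "((\<lambda>t. - exp (- Re \<gamma> * t) / Re \<gamma>) \<longlongrightarrow> 0) at_top" by simp
  qed auto
  then have fin: "(\<integral>\<^sup>+t. ennreal (exp (- Re \<gamma> * t)) * indicator {0..} t \<partial>lborel) < \<infinity>" by simp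
  have dom: "integrable lborel (\<lambda>t. indicator {0..} t *\<^sub>R exp (- Re \<gamma> * t))"
  proof (rule integrableI_bounded)
    have "(\<integral>\<^sup>+t. ennreal (norm (indicator {0..} t *\<^sub>R exp (- Re \<gamma> * t))) \<partial>lborel) =
        (\<integral>\<^sup>+t. ennreal (exp (- Re \<gamma> * t)) * indicator {0..} t \<partial>lborel)"
      by (rule nn_integral_cong) (auto split: split_indicator)
    then show "(\<integral>\<^sup>+t. ennreal (norm (indicator {0..} t *\<^sub>R exp (- Re \<gamma> * t))) \<partial>lborel) < \<infinity>"
      using fin by simp
  qed simp
  let ?f = "\<lambda>t. indicator {0..} t *\<^sub>R exp (- \<gamma> * of_real t)"
  let ?s = "\<lambda>n t. indicator {0..real n} t *\<^sub>R exp (- \<gamma> * of_real t)"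
  have meas: "?f \<in> borel_measurable lborel" "\<And>n. ?s n \<in> borel_measurable lborel"
    by (auto intro!: borel_measurable_scaleR borel_measurable_continuous_onI continuous_intros)
  have lim: "AE t in lborel. (\<lambda>n. ?s n t) \<longlonglongrightarrow> ?f t"
  proof (rule AE_I2)
    fix t :: real
    obtain N where N: "t \<le> real N" using real_arch_simple by blast
    have "\<forall>\<^sub>F n in sequentially. ?s n t = ?f t"
      using eventually_ge_at_top[of N]
    proof eventually_elim
      case (elim n)
      then have "t \<le> real n" using N by linarith
      then show ?case by (auto split: split_indicator)
    qed
    then show "(\<lambda>n. ?s n t) \<longlonglongrightarrow> ?f t" by (rule tendsto_eventually)
  qed
  have bound: "AE t in lborel. norm (?s n t) \<le> indicator {0..} t *\<^sub>R exp (- Re \<gamma> * t)" for n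
    by (rule AE_I2) (auto split: split_indicator simp: norm_exp_eq_Re)
  have "integrable lborel ?f" by (rule integrable_dominated_convergence[OF meas dom lim bound])
  moreover have "(\<lambda>n. integral\<^sup>L lborel (?s n)) \<longlonglongrightarrow> integral\<^sup>L lborel ?f"
    by (rule integral_dominated_convergence[OF meas dom lim bound])
  moreover have "integral\<^sup>L lborel (?s n) = 1 / \<gamma> - exp (- \<gamma> * of_real (real n)) / \<gamma>" for n
  proof -
    have "integral\<^sup>L lborel (?s n) = - exp (- \<gamma> * of_real (real n)) / \<gamma> - (- exp (- \<gamma> * of_real 0) / \<gamma>)"
    proof (rule integral_FTC_atLeastAtMost)
      fix t :: real
      have "((\<lambda>x. - exp (- \<gamma> * x) / \<gamma>) has_field_derivative exp (- \<gamma> * of_real t)) (at (of_real t))"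
        using \<gamma> by (auto intro!: derivative_eq_intros)
      from has_vector_derivative_real_field[OF this]
      show "((\<lambda>t. - exp (- \<gamma> * of_real t) / \<gamma>) has_vector_derivative exp (- \<gamma> * of_real t)) (at t within {0..real n})" .
    qed (auto intro!: continuous_intros)
    then show ?thesis by simp
  qed
  moreover have "(\<lambda>n. 1 / \<gamma> - exp (- \<gamma> * of_real (real n)) / \<gamma>) \<longlonglongrightarrow> 1 / \<gamma> - 0 / \<gamma>"
  proof (intro tendsto_intros \<gamma>)
    have "(\<lambda>n. exp (- Re \<gamma>) ^ n) \<longlonglongrightarrow> 0"
      by (rule LIMSEQ_power_zero) (use assms in auto)
    moreover have "exp (- Re \<gamma>) ^ n = norm (exp (- \<gamma> * of_real (real n)))" for n
      by (simp add: norm_exp_eq_Re exp_of_nat_mult[symmetric] mult.commute)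
    ultimately have "(\<lambda>n. norm (exp (- \<gamma> * of_real (real n)))) \<longlonglongrightarrow> 0" by (simp only:)
    then show "(\<lambda>n. exp (- \<gamma> * of_real (real n))) \<longlonglongrightarrow> 0"
      by (rule tendsto_norm_zero_cancel)
  qed
  ultimately show ?thesis
    unfolding has_bochner_integral_iff using LIMSEQ_unique by fastforce
qed

lemma has_bochner_integral_gaussian:
  assumes "Re \<gamma> > 0"
  shows "has_bochner_integral lborel (\<lambda>z. exp (- \<gamma> * of_real ((cmod z)\<^sup>2))) (of_real pi / \<gamma>)"
  using has_bochner_integral_radial[OF _ has_bochner_integral_exp_half_line[OF assms]]
  by (simp add: scaleR_conv_of_real borel_measurable_continuous_onI continuous_intros)

lemma integrable_gaussian:
  assumes "c > 0"
  shows "integrable lborel (\<lambda>z::complex. exp (- c * (cmod z)\<^sup>2))"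
proof -
  have "integrable lborel (\<lambda>z. norm (exp (- complex_of_real c * of_real ((cmod z)\<^sup>2))))"
    using has_bochner_integral_gaussian[of "of_real c"] assms by (intro integrable_norm) (simp add: has_bochner_integral_iff)
  then show ?thesis by (simp add: norm_exp_eq_Re)
qed

subsection \<open>Integration by parts\<close>

text \<open>Continuous functions of at most exponential growth contain the polynomials in \<open>z\<close> and its
  conjugate and the exponentials of linear forms, are closed under products, and are integrable
  against every Gaussian. This makes all integrability questions below a matter of syntax.\<close>

definition exp_growth :: "(complex \<Rightarrow> complex) \<Rightarrow> bool" where
  "exp_growth f \<longleftrightarrow> continuous_on UNIV f \<and> (\<exists>K C. \<forall>z. cmod (f z) \<le> K * exp (C * cmod z))"

lemma exp_growthE:
  assumes "exp_growth f"
  obtains K C where "K \<ge> 0" "C \<ge> 0" "\<And>z. cmod (f z) \<le> K * exp (C * cmod z)"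
proof -
  from assms obtain K C where b: "\<And>z. cmod (f z) \<le> K * exp (C * cmod z)"
    by (auto simp: exp_growth_def)
  have "cmod (f 0) \<le> K" using b[of 0] by simp
  then have K: "K \<ge> 0" using norm_ge_zero order_trans by blast
  have "cmod (f z) \<le> K * exp (\<bar>C\<bar> * cmod z)" for z
  proof -
    have "K * exp (C * cmod z) \<le> K * exp (\<bar>C\<bar> * cmod z)"
      using K by (intro mult_left_mono) (auto intro: mult_right_mono)
    then show ?thesis using b[of z] by simp
  qed
  then show ?thesis using that[of K "\<bar>C\<bar>"] K by simp
qed

lemma exp_growth_continuous: "exp_growth f \<Longrightarrow> continuous_on UNIV f"
  by (simp add: exp_growth_def)

lemma exp_growth_const [simp, intro]: "exp_growth (\<lambda>z. c)"
  unfolding exp_growth_def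
proof (intro conjI exI allI)
  show "cmod c \<le> cmod c * exp (0 * cmod z)" for z :: complex by simp
qed simp

lemma exp_growth_id [simp, intro]: "exp_growth (\<lambda>z. z)"
  unfolding exp_growth_def
proof (intro conjI exI allI)
  fix z :: complex
  have "cmod z \<le> exp (cmod z)" using exp_ge_add_one_self[of "cmod z"] by linarith
  then show "cmod z \<le> 1 * exp (1 * cmod z)" by simp
qed auto

lemma exp_growth_cnj: "exp_growth f \<Longrightarrow> exp_growth (\<lambda>z. cnj (f z))"
  unfolding exp_growth_def by (auto intro: continuous_intros)

lemma exp_growth_mult:
  assumes "exp_growth f" "exp_growth g"
  shows "exp_growth (\<lambda>z. f z * g z)"
proof -
  obtain K C where f: "K \<ge> 0" "C \<ge> 0" "\<And>z. cmod (f z) \<le> K * exp (C * cmod z)"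
    using assms(1) by (rule exp_growthE) blast
  obtain L D where g: "L \<ge> 0" "D \<ge> 0" "\<And>z. cmod (g z) \<le> L * exp (D * cmod z)"
    using assms(2) by (rule exp_growthE) blast
  have "cmod (f z * g z) \<le> (K * L) * exp ((C + D) * cmod z)" for z
  proof -
    have "cmod (f z * g z) \<le> (K * exp (C * cmod z)) * (L * exp (D * cmod z))"
      unfolding norm_mult by (rule mult_mono[OF f(3) g(3)]) (use f in auto)
    also have "\<dots> = (K * L) * (exp (C * cmod z) * exp (D * cmod z))" by (simp only: mult_ac)
    also have "exp (C * cmod z) * exp (D * cmod z) = exp ((C + D) * cmod z)" by (simp only: exp_add distrib_right)
    finally show ?thesis .
  qed
  then show ?thesis using assms unfolding exp_growth_def by (auto intro: continuous_intros)
qed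

lemma exp_growth_add:
  assumes "exp_growth f" "exp_growth g"
  shows "exp_growth (\<lambda>z. f z + g z)"
proof -
  obtain K C where f: "K \<ge> 0" "C \<ge> 0" "\<And>z. cmod (f z) \<le> K * exp (C * cmod z)"
    using assms(1) by (rule exp_growthE) blast
  obtain L D where g: "L \<ge> 0" "D \<ge> 0" "\<And>z. cmod (g z) \<le> L * exp (D * cmod z)"
    using assms(2) by (rule exp_growthE) blast
  have "cmod (f z + g z) \<le> (K + L) * exp (max C D * cmod z)" for z
  proof -
    have "cmod (f z + g z) \<le> K * exp (C * cmod z) + L * exp (D * cmod z)"
      using norm_triangle_ineq[of "f z" "g z"] f(3)[of z] g(3)[of z] by linarith
    also have "\<dots> \<le> K * exp (max C D * cmod z) + L * exp (max C D * cmod z)"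
      using f g by (intro add_mono mult_left_mono) (auto intro: mult_right_mono)
    finally show ?thesis by (simp add: distrib_right)
  qed
  then show ?thesis using assms unfolding exp_growth_def by (auto intro: continuous_intros)
qed

lemma exp_growth_diff:
  assumes "exp_growth f" "exp_growth g"
  shows "exp_growth (\<lambda>z. f z - g z)"
  using exp_growth_add[OF assms(1) exp_growth_mult[OF exp_growth_const[of "-1"] assms(2)]] by simp

lemma exp_growth_power: "exp_growth f \<Longrightarrow> exp_growth (\<lambda>z. f z ^ n)"
  by (induction n) (auto intro: exp_growth_mult)

lemma exp_growth_exp_linear: "exp_growth (\<lambda>z. exp (A * z + B * cnj z))"
  unfolding exp_growth_def
proof (intro conjI exI allI)
  show "continuous_on UNIV (\<lambda>z. exp (A * z + B * cnj z))" by (intro continuous_intros)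
  fix z
  have "cmod (A * z + B * cnj z) \<le> (cmod A + cmod B) * cmod z"
    using norm_triangle_ineq[of "A * z" "B * cnj z"] by (simp add: norm_mult distrib_right)
  then have "exp (cmod (A * z + B * cnj z)) \<le> exp ((cmod A + cmod B) * cmod z)" by (simp only: exp_le_cancel_iff)
  then show "cmod (exp (A * z + B * cnj z)) \<le> 1 * exp ((cmod A + cmod B) * cmod z)"
    using norm_exp[of "A * z + B * cnj z"] by linarith
qed

lemmas exp_growth_intros = exp_growth_const exp_growth_id exp_growth_cnj exp_growth_mult exp_growth_add
  exp_growth_diff exp_growth_power exp_growth_exp_linear

lemma exp_series_sums:
  fixes r :: "'a::{banach, real_normed_field}"
  shows "(\<lambda>j. r ^ j / fact j) sums exp r"
  using exp_converges[of r] by (simp add: scaleR_conv_of_real divide_inverse mult.commute)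

text \<open>Completing the square.\<close>

lemma exp_linear_le_gaussian:
  fixes C c r :: real
  assumes "c > 0"
  shows "exp (C * r) \<le> exp (C\<^sup>2 / (4 * c)) * exp (c * r\<^sup>2)"
proof -
  have "0 \<le> (C - 2 * c * r)\<^sup>2 / (4 * c)" using assms by simp
  also have "\<dots> = C\<^sup>2 / (4 * c) + c * r\<^sup>2 - C * r"
    using assms by (simp add: power2_eq_square field_simps)
  finally show ?thesis by (simp add: exp_add[symmetric])
qed

lemma integrable_exp_growth_real:
  assumes f: "exp_growth f" and c: "c > 0"
  shows "integrable lborel (\<lambda>z. cmod (f z) * exp (- c * (cmod z)\<^sup>2))"
proof -
  obtain K C where b: "K \<ge> 0" "C \<ge> 0" "\<And>z. cmod (f z) \<le> K * exp (C * cmod z)"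
    using f by (rule exp_growthE) blast
  have [measurable]: "f \<in> borel_measurable borel"
    by (rule borel_measurable_continuous_onI[OF exp_growth_continuous[OF f]])
  show ?thesis
  proof (rule Bochner_Integration.integrable_bound)
    show "integrable lborel (\<lambda>z::complex. (K * exp (C\<^sup>2 / (4 * (c / 2)))) * exp (- (c / 2) * (cmod z)\<^sup>2))"
      by (rule integrable_mult_right) (rule integrable_gaussian, use c in simp)
    show "AE z in lborel. norm (cmod (f z) * exp (- c * (cmod z)\<^sup>2)) \<le> norm (K * exp (C\<^sup>2 / (4 * (c / 2))) * exp (- (c / 2) * (cmod z)\<^sup>2))"
    proof (rule AE_I2)
      fix z
      have "cmod (f z) \<le> K * (exp (C\<^sup>2 / (4 * (c / 2))) * exp (c / 2 * (cmod z)\<^sup>2))"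
        using b(3)[of z] mult_left_mono[OF exp_linear_le_gaussian[of "c / 2" C "cmod z"] b(1)] c by linarith
      then have "cmod (f z) * exp (- c * (cmod z)\<^sup>2) \<le> K * (exp (C\<^sup>2 / (4 * (c / 2))) * exp (c / 2 * (cmod z)\<^sup>2)) * exp (- c * (cmod z)\<^sup>2)"
        by (rule mult_right_mono) simp
      also have "\<dots> = K * exp (C\<^sup>2 / (4 * (c / 2))) * (exp (c / 2 * (cmod z)\<^sup>2) * exp (- c * (cmod z)\<^sup>2))" by simp
      also have "exp (c / 2 * (cmod z)\<^sup>2) * exp (- c * (cmod z)\<^sup>2) = exp (- (c / 2) * (cmod z)\<^sup>2)"
        by (simp add: exp_add[symmetric])
      finally show "norm (cmod (f z) * exp (- c * (cmod z)\<^sup>2)) \<le> norm (K * exp (C\<^sup>2 / (4 * (c / 2))) * exp (- (c / 2) * (cmod z)\<^sup>2))"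
        using b(1) by simp
    qed
  qed measurable
qed

definition gaussian :: "complex \<Rightarrow> complex \<Rightarrow> complex" where
  "gaussian \<gamma> z = exp (- \<gamma> * of_real ((cmod z)\<^sup>2))"

lemma cmod_gaussian: "cmod (gaussian \<gamma> z) = exp (- Re \<gamma> * (cmod z)\<^sup>2)"
  by (simp add: gaussian_def norm_exp_eq_Re del: of_real_power)

lemma continuous_on_gaussian [continuous_intros]: "continuous_on S (gaussian \<gamma>)"
  unfolding gaussian_def[abs_def] by (intro continuous_intros)

lemma integrable_exp_growth_gaussian:
  assumes f: "exp_growth f" and \<gamma>: "Re \<gamma> > 0"
  shows "integrable lborel (\<lambda>z. f z * gaussian \<gamma> z)"
proof (rule Bochner_Integration.integrable_bound[OF integrable_exp_growth_real[OF f \<gamma>]])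
  have "continuous_on UNIV (\<lambda>z. f z * gaussian \<gamma> z)"
    by (intro continuous_intros exp_growth_continuous f)
  then show "(\<lambda>z. f z * gaussian \<gamma> z) \<in> borel_measurable lborel" by (simp add: borel_measurable_continuous_onI)
qed (simp add: norm_mult cmod_gaussian)

definition gauss_int :: "complex \<Rightarrow> (complex \<Rightarrow> complex) \<Rightarrow> complex" where
  "gauss_int \<gamma> f = (LINT z|lborel. f z * gaussian \<gamma> z)"

lemma gauss_int_add:
  assumes "exp_growth f" "exp_growth g" "Re \<gamma> > 0"
  shows "gauss_int \<gamma> (\<lambda>z. f z + g z) = gauss_int \<gamma> f + gauss_int \<gamma> g"
  unfolding gauss_int_def distrib_right
  by (intro Bochner_Integration.integral_add integrable_exp_growth_gaussian assms)

lemma gauss_int_diff: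
  assumes "exp_growth f" "exp_growth g" "Re \<gamma> > 0"
  shows "gauss_int \<gamma> (\<lambda>z. f z - g z) = gauss_int \<gamma> f - gauss_int \<gamma> g"
  unfolding gauss_int_def left_diff_distrib
  by (intro Bochner_Integration.integral_diff integrable_exp_growth_gaussian assms)

lemma gauss_int_scale: "gauss_int \<gamma> (\<lambda>z. c * f z) = c * gauss_int \<gamma> f"
  unfolding gauss_int_def mult.assoc by simp

lemma gauss_int_one: "Re \<gamma> > 0 \<Longrightarrow> gauss_int \<gamma> (\<lambda>z. 1) = of_real pi / \<gamma>"
  using has_bochner_integral_gaussian[of \<gamma>]
  by (simp add: gauss_int_def gaussian_def has_bochner_integral_iff del: of_real_power)

text \<open>The numbers \<open>p\<close> and \<open>q\<close> are the two Wirtinger derivatives of \<open>f\<close> at \<open>z\<close>: a real linear map of the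
  plane is \<open>h \<mapsto> p h + q h'\<close>, with \<open>h'\<close> the conjugate of \<open>h\<close>, for exactly one pair.\<close>

definition has_wirtinger :: "(complex \<Rightarrow> complex) \<Rightarrow> complex \<Rightarrow> complex \<Rightarrow> complex \<Rightarrow> bool" where
  "has_wirtinger f p q z \<longleftrightarrow> (f has_derivative (\<lambda>h. p * h + q * cnj h)) (at z)"

lemma wirtinger_eqI:
  assumes "has_wirtinger f p q z"
  shows "wirtinger f z = p" "wirtinger_bar f z = q"
proof -
  have "frechet_derivative f (at z) = (\<lambda>h. p * h + q * cnj h)"
    using assms unfolding has_wirtinger_def by (rule frechet_derivative_at[symmetric])
  then show "wirtinger f z = p" "wirtinger_bar f z = q"
    by (simp_all add: wirtinger_def wirtinger_bar_def algebra_simps)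
qed

lemma has_wirtinger_const: "has_wirtinger (\<lambda>z. c) 0 0 z"
  by (simp add: has_wirtinger_def)

lemma has_wirtinger_id: "has_wirtinger (\<lambda>z. z) 1 0 z"
  by (simp add: has_wirtinger_def)

lemma has_wirtinger_cnj: "has_wirtinger cnj 0 1 z"
  unfolding has_wirtinger_def using bounded_linear_imp_has_derivative[OF bounded_linear_cnj] by simp

lemma has_wirtinger_add:
  assumes "has_wirtinger f p q z" "has_wirtinger g r s z"
  shows "has_wirtinger (\<lambda>z. f z + g z) (p + r) (q + s) z"
  using has_derivative_add[OF assms[unfolded has_wirtinger_def]]
  by (simp add: has_wirtinger_def algebra_simps)

lemma has_wirtinger_diff:
  assumes "has_wirtinger f p q z" "has_wirtinger g r s z"
  shows "has_wirtinger (\<lambda>z. f z - g z) (p - r) (q - s) z"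
  using has_derivative_diff[OF assms[unfolded has_wirtinger_def]]
  by (simp add: has_wirtinger_def algebra_simps)

lemma has_wirtinger_mult:
  assumes "has_wirtinger f p q z" "has_wirtinger g r s z"
  shows "has_wirtinger (\<lambda>z. f z * g z) (p * g z + f z * r) (q * g z + f z * s) z"
  using has_derivative_mult[OF assms[unfolded has_wirtinger_def]]
  by (simp add: has_wirtinger_def algebra_simps)

lemma has_wirtinger_scale:
  assumes "has_wirtinger f p q z"
  shows "has_wirtinger (\<lambda>z. c * f z) (c * p) (c * q) z"
  using has_wirtinger_mult[OF has_wirtinger_const assms] by simp

lemma has_wirtinger_compose_holomorphic:
  assumes "has_wirtinger f p q z" "(g has_field_derivative g') (at (f z))"
  shows "has_wirtinger (\<lambda>z. g (f z)) (g' * p) (g' * q) z"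
  using has_derivative_compose[OF assms(1)[unfolded has_wirtinger_def] assms(2)[unfolded has_field_derivative_def]]
  by (simp add: has_wirtinger_def algebra_simps)

lemma has_wirtinger_cong:
  "has_wirtinger f p q z \<Longrightarrow> p = p' \<Longrightarrow> q = q' \<Longrightarrow> has_wirtinger f p' q' z"
  by simp

lemma has_wirtinger_linear: "has_wirtinger (\<lambda>z. A * z + B * cnj z) A B z"
  using has_wirtinger_add[OF has_wirtinger_scale[OF has_wirtinger_id, of A] has_wirtinger_scale[OF has_wirtinger_cnj, of B]]
  by simp

lemma has_wirtinger_exp_linear:
  "has_wirtinger (\<lambda>z. exp (A * z + B * cnj z)) (A * exp (A * z + B * cnj z)) (B * exp (A * z + B * cnj z)) z"
  by (rule has_wirtinger_cong[OF has_wirtinger_compose_holomorphic[OF has_wirtinger_linear DERIV_exp]]) simp_all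

lemma has_wirtinger_gaussian:
  "has_wirtinger (gaussian \<gamma>) (- \<gamma> * cnj z * gaussian \<gamma> z) (- \<gamma> * z * gaussian \<gamma> z) z"
proof -
  have eq: "gaussian \<gamma> = (\<lambda>z. exp (- \<gamma> * (z * cnj z)))"
    by (simp add: gaussian_def fun_eq_iff complex_norm_square del: of_real_power)
  show ?thesis
    unfolding eq
    by (rule has_wirtinger_cong[OF has_wirtinger_compose_holomorphic[OF
          has_wirtinger_scale[OF has_wirtinger_mult[OF has_wirtinger_id has_wirtinger_cnj]] DERIV_exp]]) simp_all
qed

text \<open>The directional derivatives of \<open>f * gaussian \<gamma>\<close> in the directions \<open>1\<close> and \<open>\<i>\<close> have integral \<open>0\<close>;
  so have, by linear combination, both Wirtinger derivatives, whose Gaussian factors contribute \<open>- \<gamma> z'\<close> and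
  \<open>- \<gamma> z\<close>.\<close>

lemma gauss_int_by_parts:
  assumes \<gamma>: "Re \<gamma> > 0" and D: "\<And>z. has_wirtinger f (p z) (q z) z"
    and growth: "exp_growth f" "exp_growth p" "exp_growth q"
  shows "\<gamma> * gauss_int \<gamma> (\<lambda>z. z * f z) = gauss_int \<gamma> q"
    and "\<gamma> * gauss_int \<gamma> (\<lambda>z. cnj z * f z) = gauss_int \<gamma> p"
proof -
  define P where "P z = p z - \<gamma> * (cnj z * f z)" for z
  define Q where "Q z = q z - \<gamma> * (z * f z)" for z
  have PQ: "exp_growth P" "exp_growth Q"
    unfolding P_def[abs_def] Q_def[abs_def] by (intro exp_growth_intros growth)+
  have "gauss_int \<gamma> (\<lambda>z. P z * h + Q z * cnj h) = 0" for h
    unfolding gauss_int_def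
  proof (rule integral_directional_derivative_eq_0)
    fix z
    from has_wirtinger_mult[OF D[of z] has_wirtinger_gaussian[of \<gamma> z]]
    show "((\<lambda>z. f z * gaussian \<gamma> z) has_derivative (\<lambda>h. P z * gaussian \<gamma> z * h + Q z * gaussian \<gamma> z * cnj h)) (at z)"
      unfolding has_wirtinger_def P_def Q_def by (simp add: algebra_simps)
    show "(P z * h + Q z * cnj h) * gaussian \<gamma> z = P z * gaussian \<gamma> z * h + Q z * gaussian \<gamma> z * cnj h"
      by (simp add: algebra_simps)
  next
    show "continuous_on UNIV (\<lambda>z. (P z * h + Q z * cnj h) * gaussian \<gamma> z)"
      by (intro continuous_intros exp_growth_continuous PQ)
  qed (intro integrable_exp_growth_gaussian exp_growth_intros growth PQ \<gamma>)+
  moreover have "gauss_int \<gamma> (\<lambda>z. P z * h + Q z * cnj h) = h * gauss_int \<gamma> P + cnj h * gauss_int \<gamma> Q" for h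
    using gauss_int_add[of "\<lambda>z. h * P z" "\<lambda>z. cnj h * Q z" \<gamma>] PQ \<gamma>
    by (simp add: exp_growth_intros gauss_int_scale mult.commute)
  ultimately have eq: "h * gauss_int \<gamma> P + cnj h * gauss_int \<gamma> Q = 0" for h by simp
  from eq[of 1] eq[of \<i>] have "gauss_int \<gamma> P = 0" "gauss_int \<gamma> Q = 0"
    by (auto simp: algebra_simps add_eq_0_iff)
  moreover have "gauss_int \<gamma> P = gauss_int \<gamma> p - \<gamma> * gauss_int \<gamma> (\<lambda>z. cnj z * f z)"
    "gauss_int \<gamma> Q = gauss_int \<gamma> q - \<gamma> * gauss_int \<gamma> (\<lambda>z. z * f z)"
    unfolding P_def[abs_def] Q_def[abs_def]
    by (subst gauss_int_diff; simp add: gauss_int_scale exp_growth_intros growth \<gamma>)+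
  ultimately show "\<gamma> * gauss_int \<gamma> (\<lambda>z. z * f z) = gauss_int \<gamma> q"
    "\<gamma> * gauss_int \<gamma> (\<lambda>z. cnj z * f z) = gauss_int \<gamma> p" by simp_all
qed

text \<open>Integration by parts evaluates the moments \<open>M N\<close> of the powers of \<open>L z = A z + B z'\<close>: it gives
  \<open>\<gamma> M (N + 1) = 2 A B N M (N - 1)\<close>, so the odd moments vanish and the even ones are those of the
  series of \<open>exp (A B / \<gamma>)\<close>. The exponential series of \<open>L\<close> may be integrated termwise.
  Since \<open>\<gamma>\<close> is complex and \<open>A\<close>, \<open>B\<close> are independent, completing the square by a translation of the
  plane would not suffice.\<close>

lemma gauss_int_exp_linear:
  assumes \<gamma>: "Re \<gamma> > 0"
  shows "gauss_int \<gamma> (\<lambda>z. exp (A * z + B * cnj z)) = of_real pi / \<gamma> * exp (A * B / \<gamma>)"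
proof -
  let ?L = "\<lambda>z. A * z + B * cnj z"
  define M where "M N = gauss_int \<gamma> (\<lambda>z. ?L z ^ N)" for N
  have \<gamma>0: "\<gamma> \<noteq> 0" using \<gamma> by auto
  have step: "\<gamma> * M (Suc N) = 2 * A * B * of_nat N * M (N - 1)" for N
  proof -
    have D: "has_wirtinger (\<lambda>z. ?L z ^ N) (of_nat N * A * ?L z ^ (N - 1)) (of_nat N * B * ?L z ^ (N - 1)) z" for z
      by (rule has_wirtinger_cong[OF has_wirtinger_compose_holomorphic[OF has_wirtinger_linear DERIV_power[OF DERIV_ident]]]) simp_all
    note parts = gauss_int_by_parts[OF \<gamma> D]
    have "M (Suc N) = gauss_int \<gamma> (\<lambda>z. A * (z * ?L z ^ N) + B * (cnj z * ?L z ^ N))"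
      unfolding M_def by (simp add: algebra_simps)
    also have "\<dots> = A * gauss_int \<gamma> (\<lambda>z. z * ?L z ^ N) + B * gauss_int \<gamma> (\<lambda>z. cnj z * ?L z ^ N)"
      by (subst gauss_int_add) (auto intro!: exp_growth_intros \<gamma> simp: gauss_int_scale)
    finally have "\<gamma> * M (Suc N) = A * (\<gamma> * gauss_int \<gamma> (\<lambda>z. z * ?L z ^ N)) + B * (\<gamma> * gauss_int \<gamma> (\<lambda>z. cnj z * ?L z ^ N))"
      by (simp add: algebra_simps)
    also have "\<dots> = A * gauss_int \<gamma> (\<lambda>z. of_nat N * B * ?L z ^ (N - 1)) + B * gauss_int \<gamma> (\<lambda>z. of_nat N * A * ?L z ^ (N - 1))"
      by (subst parts, (intro exp_growth_intros)+, subst parts, (intro exp_growth_intros)+) (rule refl)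
    finally show ?thesis unfolding M_def by (simp add: gauss_int_scale)
  qed
  have odd: "M (Suc (2 * k)) = 0" for k
  proof (induction k)
    case 0 show ?case using step[of 0] \<gamma>0 by simp
  next
    case (Suc k) then show ?case using step[of "2 * Suc k"] \<gamma>0 by simp
  qed
  have even: "M (2 * k) / fact (2 * k) = M 0 * ((A * B / \<gamma>) ^ k / fact k)" for k
  proof (induction k)
    case (Suc k)
    have M: "M (2 * Suc k) = 2 * A * B * of_nat (2 * k + 1) * M (2 * k) / \<gamma>"
      using step[of "2 * k + 1"] \<gamma>0 by (simp add: field_simps)
    have "M (2 * Suc k) / fact (2 * Suc k) = (A * B / \<gamma>) / of_nat (Suc k) * (M (2 * k) / fact (2 * k))"
    proof -
      have f: "fact (2 * Suc k) = (2 * of_nat (Suc k)) * (of_nat (2 * k + 1) * fact (2 * k) :: complex)"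
        by (simp add: algebra_simps)
      have nz: "of_nat (Suc k) \<noteq> (0::complex)" "of_nat (2 * k + 1) \<noteq> (0::complex)" by (simp_all only: of_nat_eq_0_iff)
      show ?thesis unfolding M f using nz \<gamma>0 by (simp add: divide_simps del: of_nat_Suc of_nat_add)
    qed
    then show ?case unfolding Suc by (simp add: field_simps)
  qed simp
  have partial: "(\<Sum>N<2 * k. M N / fact N) = M 0 * (\<Sum>j<k. (A * B / \<gamma>) ^ j / fact j)" for k
    by (induction k) (simp_all add: odd even[simplified] distrib_left)
  let ?s = "\<lambda>n z. (\<Sum>N<n. ?L z ^ N / fact N) * gaussian \<gamma> z"
  have "(\<lambda>n. LINT z|lborel. ?s n z) \<longlonglongrightarrow> gauss_int \<gamma> (\<lambda>z. exp (?L z))"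
    unfolding gauss_int_def
  proof (rule integral_dominated_convergence)
    show "integrable lborel (\<lambda>z. exp ((cmod A + cmod B) * cmod z) * exp (- Re \<gamma> * (cmod z)\<^sup>2))"
    proof -
      have "exp_growth (\<lambda>z. of_real (exp ((cmod A + cmod B) * cmod z)))"
        unfolding exp_growth_def
        by (intro conjI continuous_intros exI[of _ 1] exI[of _ "cmod A + cmod B"]) simp
      from integrable_exp_growth_real[OF this \<gamma>] show ?thesis by simp
    qed
    show "(\<lambda>z. exp (?L z) * gaussian \<gamma> z) \<in> borel_measurable lborel"
      "\<And>n. ?s n \<in> borel_measurable lborel"
      by (auto intro!: borel_measurable_continuous_onI continuous_intros)
    show "AE z in lborel. (\<lambda>n. ?s n z) \<longlonglongrightarrow> exp (?L z) * gaussian \<gamma> z"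
    proof (rule AE_I2)
      fix z
      have "(\<lambda>N. ?L z ^ N / fact N) sums exp (?L z)" by (rule exp_series_sums)
      then show "(\<lambda>n. ?s n z) \<longlonglongrightarrow> exp (?L z) * gaussian \<gamma> z"
        unfolding sums_def by (intro tendsto_intros)
    qed
    show "AE z in lborel. norm (?s n z) \<le> exp ((cmod A + cmod B) * cmod z) * exp (- Re \<gamma> * (cmod z)\<^sup>2)" for n
    proof (rule AE_I2)
      fix z
      have "cmod (\<Sum>N<n. ?L z ^ N / fact N) \<le> (\<Sum>N<n. cmod (?L z) ^ N / fact N)"
        by (rule order_trans[OF norm_sum]) (simp add: norm_divide norm_power)
      also have "\<dots> \<le> exp (cmod (?L z))"
      proof -
        have "(\<lambda>N. cmod (?L z) ^ N / fact N) sums exp (cmod (?L z))" by (rule exp_series_sums)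
        then show ?thesis using sum_le_suminf[of "\<lambda>N. cmod (?L z) ^ N / fact N" "{..<n}"] by (simp add: sums_iff)
      qed
      also have "\<dots> \<le> exp ((cmod A + cmod B) * cmod z)"
        using norm_triangle_ineq[of "A * z" "B * cnj z"] by (simp add: norm_mult distrib_right)
      finally show "norm (?s n z) \<le> exp ((cmod A + cmod B) * cmod z) * exp (- Re \<gamma> * (cmod z)\<^sup>2)"
        unfolding norm_mult cmod_gaussian by (rule mult_right_mono) simp
    qed
  qed
  moreover have "(LINT z|lborel. ?s n z) = (\<Sum>N<n. M N / fact N)" for n
  proof -
    have "(LINT z|lborel. ?s n z) = (LINT z|lborel. (\<Sum>N<n. (1 / fact N) * (?L z ^ N * gaussian \<gamma> z)))"
      by (simp add: sum_distrib_right)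
    also have "\<dots> = (\<Sum>N<n. (1 / fact N) * M N)"
      unfolding M_def gauss_int_def
      by (subst Bochner_Integration.integral_sum)
         (auto intro!: integrable_mult_right integrable_exp_growth_gaussian exp_growth_intros \<gamma>)
    finally show ?thesis by simp
  qed
  ultimately have lim: "(\<lambda>n. \<Sum>N<n. M N / fact N) \<longlonglongrightarrow> gauss_int \<gamma> (\<lambda>z. exp (?L z))" by simp
  have "strict_mono (\<lambda>k::nat. 2 * k)" by (simp add: strict_mono_def)
  from LIMSEQ_subseq_LIMSEQ[OF lim this]
  have "(\<lambda>k. M 0 * (\<Sum>j<k. (A * B / \<gamma>) ^ j / fact j)) \<longlonglongrightarrow> gauss_int \<gamma> (\<lambda>z. exp (?L z))"
    by (simp add: partial o_def)
  moreover have "(\<lambda>k. M 0 * (\<Sum>j<k. (A * B / \<gamma>) ^ j / fact j)) \<longlonglongrightarrow> M 0 * exp (A * B / \<gamma>)"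
  proof (rule tendsto_mult_left)
    have "(\<lambda>j. (A * B / \<gamma>) ^ j / fact j) sums exp (A * B / \<gamma>)" by (rule exp_series_sums)
    then show "(\<lambda>k. \<Sum>j<k. (A * B / \<gamma>) ^ j / fact j) \<longlonglongrightarrow> exp (A * B / \<gamma>)" by (simp add: sums_def)
  qed
  ultimately have "gauss_int \<gamma> (\<lambda>z. exp (?L z)) = M 0 * exp (A * B / \<gamma>)" by (rule LIMSEQ_unique)
  then show ?thesis using gauss_int_one[OF \<gamma>] by (simp add: M_def)
qed

section \<open>Ito--Hermite polynomials\<close>

text \<open>Up to sign, the recursion is what one more derivative \<open>\<partial>/\<partial>z'\<close> does to \<open>hermite \<nu> m n z * exp (- \<nu> \<bar>z\<bar>\<^sup>2)\<close>.
  At \<open>n = 0\<close> the truncated index \<open>n - 1\<close> is harmless, since its coefficient is \<open>0\<close>.\<close>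

fun hermite :: "real \<Rightarrow> nat \<Rightarrow> nat \<Rightarrow> complex \<Rightarrow> complex" where
  "hermite \<nu> 0 n z = (of_real \<nu> * cnj z) ^ n"
| "hermite \<nu> (Suc m) n z = of_real \<nu> * z * hermite \<nu> m n z - of_real \<nu> * of_nat n * hermite \<nu> m (n - 1) z"

text \<open>The polynomials are symmetric in the two variables, but the defining recursion is not. This is
  the recursion in the other index.\<close>

lemma hermite_Suc_right:
  "hermite \<nu> m (Suc n) z = of_real \<nu> * cnj z * hermite \<nu> m n z - of_real \<nu> * of_nat m * hermite \<nu> (m - 1) n z"
proof (induction m arbitrary: n)
  case (Suc m)
  let ?h = "\<lambda>m n. hermite \<nu> m n z" and ?v = "complex_of_real \<nu>"
  have n: "of_nat n * ?h m n = of_nat n * (?v * cnj z * ?h m (n - 1) - ?v * of_nat m * ?h (m - 1) (n - 1))"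
    by (cases n) (simp_all add: Suc)
  have m: "of_nat m * ?h m n = of_nat m * (?v * z * ?h (m - 1) n - ?v * of_nat n * ?h (m - 1) (n - 1))"
    by (cases m) simp_all
  have "?h (Suc m) (Suc n) = ?v * z * (?v * cnj z * ?h m n - ?v * of_nat m * ?h (m - 1) n) - ?v * ?h m n
      - ?v * (of_nat n * ?h m n)"
    unfolding hermite.simps(2) Suc[of n] by (simp add: algebra_simps)
  also have "\<dots> = ?v * cnj z * (?v * z * ?h m n - ?v * of_nat n * ?h m (n - 1)) - ?v * ?h m n - ?v * (of_nat m * ?h m n)"
    unfolding m n by (simp add: algebra_simps)
  finally show ?case by (simp add: algebra_simps)
qed simp

lemma cnj_hermite: "cnj (hermite \<nu> m n z) = hermite \<nu> n m z"
proof (induction m arbitrary: n)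
  case 0
  show ?case by (induction n) simp_all
next
  case (Suc m)
  show ?case unfolding hermite_Suc_right by (simp add: Suc)
qed

lemma exp_growth_hermite: "exp_growth (hermite \<nu> m n)"
proof (induction m arbitrary: n)
  case 0
  have "exp_growth (\<lambda>z. (of_real \<nu> * cnj z) ^ n)" by (intro exp_growth_intros)
  then show ?case by simp
next
  case (Suc m)
  have "exp_growth (\<lambda>z. of_real \<nu> * z * hermite \<nu> m n z - of_real \<nu> * of_nat n * hermite \<nu> m (n - 1) z)"
    by (intro exp_growth_intros Suc)
  then show ?case by simp
qed

lemma has_wirtinger_hermite:
  "has_wirtinger (hermite \<nu> m n) (of_real \<nu> * of_nat m * hermite \<nu> (m - 1) n z)
     (of_real \<nu> * of_nat n * hermite \<nu> m (n - 1) z) z"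
proof (induction m arbitrary: n)
  case 0
  have "has_wirtinger (\<lambda>z. (of_real \<nu> * cnj z) ^ n) 0 (of_real \<nu> * of_nat n * (of_real \<nu> * cnj z) ^ (n - 1)) z"
    by (rule has_wirtinger_cong[OF has_wirtinger_compose_holomorphic[OF has_wirtinger_scale[OF has_wirtinger_cnj] DERIV_power[OF DERIV_ident]]]) simp_all
  then show ?case by simp
next
  case (Suc m)
  have m: "of_nat m * hermite \<nu> m k z = of_nat m * (of_real \<nu> * z * hermite \<nu> (m - 1) k z - of_real \<nu> * of_nat k * hermite \<nu> (m - 1) (k - 1) z)" for k
    by (cases m) auto
  have "has_wirtinger (\<lambda>z. of_real \<nu> * (z * hermite \<nu> m n z) - of_real \<nu> * of_nat n * hermite \<nu> m (n - 1) z)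
      (of_real \<nu> * of_nat (Suc m) * hermite \<nu> m n z)
      (of_real \<nu> * of_nat n * hermite \<nu> (Suc m) (n - 1) z) z"
  proof (rule has_wirtinger_cong[OF has_wirtinger_diff[OF has_wirtinger_scale[OF has_wirtinger_mult[OF has_wirtinger_id Suc]] has_wirtinger_scale[OF Suc]]])
    have "of_real \<nu> * (of_nat m * (of_real \<nu> * z * hermite \<nu> (m - 1) n z - of_real \<nu> * of_nat n * hermite \<nu> (m - 1) (n - 1) z)) =
      of_real \<nu> * of_nat m * hermite \<nu> m n z" by (simp only: m[of n] mult.assoc)
    then show "of_real \<nu> * (1 * hermite \<nu> m n z + z * (of_real \<nu> * of_nat m * hermite \<nu> (m - 1) n z)) -
        of_real \<nu> * of_nat n * (of_real \<nu> * of_nat m * hermite \<nu> (m - 1) (n - 1) z) =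
        of_real \<nu> * of_nat (Suc m) * hermite \<nu> m n z"
      by (simp add: algebra_simps)
    show "of_real \<nu> * (0 * hermite \<nu> m n z + z * (of_real \<nu> * of_nat n * hermite \<nu> m (n - 1) z)) -
        of_real \<nu> * of_nat n * (of_real \<nu> * of_nat (n - 1) * hermite \<nu> m (n - 1 - 1) z) =
        of_real \<nu> * of_nat n * hermite \<nu> (Suc m) (n - 1) z"
      by (simp add: algebra_simps)
  qed
  then show ?case by (simp add: mult.assoc)
qed

lemma ito_hermite_eq: "ito_hermite \<nu> m n = hermite \<nu> m n"
proof
  fix z
  have g: "(\<lambda>z. of_real (exp (- \<nu> * (cmod z)\<^sup>2))) = gaussian (of_real \<nu>)"
    by (simp add: gaussian_def fun_eq_iff exp_of_real[symmetric])
  have 1: "(wirtinger ^^ n) (gaussian (of_real \<nu>)) = (\<lambda>z. (- 1) ^ n * (hermite \<nu> 0 n z * gaussian (of_real \<nu>) z))"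
  proof (induction n)
    case (Suc n)
    show ?case
    proof
      fix z
      have "has_wirtinger (\<lambda>z. (- 1) ^ n * (hermite \<nu> 0 n z * gaussian (of_real \<nu>) z))
          ((- 1) ^ Suc n * (hermite \<nu> 0 (Suc n) z * gaussian (of_real \<nu>) z))
          ((- 1) ^ n * (of_real \<nu> * of_nat n * hermite \<nu> 0 (n - 1) z * gaussian (of_real \<nu>) z + hermite \<nu> 0 n z * (- of_real \<nu> * z * gaussian (of_real \<nu>) z))) z"
        by (rule has_wirtinger_cong[OF has_wirtinger_scale[OF has_wirtinger_mult[OF has_wirtinger_hermite has_wirtinger_gaussian]]]) simp_all
      from wirtinger_eqI(1)[OF this]
      show "(wirtinger ^^ Suc n) (gaussian (of_real \<nu>)) z = (- 1) ^ Suc n * (hermite \<nu> 0 (Suc n) z * gaussian (of_real \<nu>) z)"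
        by (simp add: Suc)
    qed
  qed simp
  have 2: "(wirtinger_bar ^^ m) ((wirtinger ^^ n) (gaussian (of_real \<nu>))) = (\<lambda>z. (- 1) ^ (m + n) * (hermite \<nu> m n z * gaussian (of_real \<nu>) z))"
  proof (induction m)
    case (Suc m)
    show ?case
    proof
      fix z
      have "has_wirtinger (\<lambda>z. (- 1) ^ (m + n) * (hermite \<nu> m n z * gaussian (of_real \<nu>) z))
          ((- 1) ^ (m + n) * (of_real \<nu> * of_nat m * hermite \<nu> (m - 1) n z * gaussian (of_real \<nu>) z + hermite \<nu> m n z * (- of_real \<nu> * cnj z * gaussian (of_real \<nu>) z)))
          ((- 1) ^ (Suc m + n) * (hermite \<nu> (Suc m) n z * gaussian (of_real \<nu>) z)) z"
        by (rule has_wirtinger_cong[OF has_wirtinger_scale[OF has_wirtinger_mult[OF has_wirtinger_hermite has_wirtinger_gaussian]]])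
           (simp_all add: algebra_simps)
      from wirtinger_eqI(2)[OF this]
      show "(wirtinger_bar ^^ Suc m) ((wirtinger ^^ n) (gaussian (of_real \<nu>))) z = (- 1) ^ (Suc m + n) * (hermite \<nu> (Suc m) n z * gaussian (of_real \<nu>) z)"
        by (simp add: Suc)
    qed
  qed (simp add: 1)
  have exp: "of_real (exp (\<nu> * (cmod z)\<^sup>2)) * gaussian (of_real \<nu>) z = 1"
    by (simp add: gaussian_def exp_of_real[symmetric] exp_minus)
  have sgn: "(- 1) ^ (m + n) * (- 1) ^ (m + n) = (1::complex)" by (simp add: power_mult_distrib[symmetric])
  have "ito_hermite \<nu> m n z = ((- 1) ^ (m + n) * (- 1) ^ (m + n)) * (of_real (exp (\<nu> * (cmod z)\<^sup>2)) * gaussian (of_real \<nu>) z) * hermite \<nu> m n z"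
    unfolding ito_hermite_def g 2 by (simp only: mult_ac)
  then show "ito_hermite \<nu> m n z = hermite \<nu> m n z" by (simp add: exp sgn)
qed

text \<open>Up to the Gaussian factor, raising an index of the polynomial is a derivative; integration by
  parts moves this derivative to \<open>f\<close>.\<close>

lemma gauss_int_hermite_shift:
  assumes \<nu>: "\<nu> > 0" and D: "\<And>z. has_wirtinger f (p z) (q z) z"
    and f: "exp_growth f" "exp_growth p" "exp_growth q"
  shows "gauss_int (of_real \<nu>) (\<lambda>z. hermite \<nu> (Suc m) n z * f z) = gauss_int (of_real \<nu>) (\<lambda>z. hermite \<nu> m n z * q z)"
    and "gauss_int (of_real \<nu>) (\<lambda>z. hermite \<nu> m (Suc n) z * f z) = gauss_int (of_real \<nu>) (\<lambda>z. hermite \<nu> m n z * p z)"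
proof -
  have \<gamma>: "Re (of_real \<nu>) > 0" using \<nu> by simp
  note g = exp_growth_intros exp_growth_hermite f
  note parts = gauss_int_by_parts[OF \<gamma> has_wirtinger_mult[OF has_wirtinger_hermite[of \<nu> m n] D]]
  let ?I = "gauss_int (of_real \<nu>)"
  let ?h = "hermite \<nu>"
  have "?I (\<lambda>z. ?h (Suc m) n z * f z) = ?I (\<lambda>z. of_real \<nu> * (z * (?h m n z * f z)) - of_real \<nu> * of_nat n * ?h m (n - 1) z * f z)"
    by (simp add: algebra_simps)
  also have "\<dots> = of_real \<nu> * ?I (\<lambda>z. z * (?h m n z * f z)) - ?I (\<lambda>z. of_real \<nu> * of_nat n * ?h m (n - 1) z * f z)"
    by (subst gauss_int_diff) (auto intro!: g \<gamma> simp: gauss_int_scale \<nu>)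
  also have "of_real \<nu> * ?I (\<lambda>z. z * (?h m n z * f z)) =
      ?I (\<lambda>z. of_real \<nu> * of_nat n * ?h m (n - 1) z * f z + ?h m n z * q z)"
    by (rule parts(1)) (intro g)+
  also have "\<dots> = ?I (\<lambda>z. of_real \<nu> * of_nat n * ?h m (n - 1) z * f z) + ?I (\<lambda>z. ?h m n z * q z)"
    by (rule gauss_int_add) (intro g \<gamma>)+
  finally show "?I (\<lambda>z. ?h (Suc m) n z * f z) = ?I (\<lambda>z. ?h m n z * q z)" by simp
  have "?I (\<lambda>z. ?h m (Suc n) z * f z) = ?I (\<lambda>z. of_real \<nu> * (cnj z * (?h m n z * f z)) - of_real \<nu> * of_nat m * ?h (m - 1) n z * f z)"
    unfolding hermite_Suc_right by (simp add: algebra_simps)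
  also have "\<dots> = of_real \<nu> * ?I (\<lambda>z. cnj z * (?h m n z * f z)) - ?I (\<lambda>z. of_real \<nu> * of_nat m * ?h (m - 1) n z * f z)"
    by (subst gauss_int_diff) (auto intro!: g \<gamma> simp: gauss_int_scale \<nu>)
  also have "of_real \<nu> * ?I (\<lambda>z. cnj z * (?h m n z * f z)) =
      ?I (\<lambda>z. of_real \<nu> * of_nat m * ?h (m - 1) n z * f z + ?h m n z * p z)"
    by (rule parts(2)) (intro g)+
  also have "\<dots> = ?I (\<lambda>z. of_real \<nu> * of_nat m * ?h (m - 1) n z * f z) + ?I (\<lambda>z. ?h m n z * p z)"
    by (rule gauss_int_add) (intro g \<gamma>)+
  finally show "?I (\<lambda>z. ?h m (Suc n) z * f z) = ?I (\<lambda>z. ?h m n z * p z)" by simp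
qed

lemma gauss_int_hermite_hermite_Suc:
  assumes "\<nu> > 0"
  shows "gauss_int (of_real \<nu>) (\<lambda>z. hermite \<nu> (Suc m) n z * hermite \<nu> l k z) =
      of_real \<nu> * of_nat k * gauss_int (of_real \<nu>) (\<lambda>z. hermite \<nu> m n z * hermite \<nu> l (k - 1) z)"
    and "gauss_int (of_real \<nu>) (\<lambda>z. hermite \<nu> m (Suc n) z * hermite \<nu> l k z) =
      of_real \<nu> * of_nat l * gauss_int (of_real \<nu>) (\<lambda>z. hermite \<nu> m n z * hermite \<nu> (l - 1) k z)"
proof -
  note g = exp_growth_intros exp_growth_hermite
  have "gauss_int (of_real \<nu>) (\<lambda>z. hermite \<nu> (Suc m) n z * hermite \<nu> l k z) =
      gauss_int (of_real \<nu>) (\<lambda>z. hermite \<nu> m n z * (of_real \<nu> * of_nat k * hermite \<nu> l (k - 1) z))"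
    by (rule gauss_int_hermite_shift(1)[OF assms has_wirtinger_hermite]) (intro g)+
  also have "\<dots> = gauss_int (of_real \<nu>) (\<lambda>z. (of_real \<nu> * of_nat k) * (hermite \<nu> m n z * hermite \<nu> l (k - 1) z))"
    by (simp only: mult_ac)
  finally show "gauss_int (of_real \<nu>) (\<lambda>z. hermite \<nu> (Suc m) n z * hermite \<nu> l k z) =
      of_real \<nu> * of_nat k * gauss_int (of_real \<nu>) (\<lambda>z. hermite \<nu> m n z * hermite \<nu> l (k - 1) z)"
    by (simp only: gauss_int_scale)
  have "gauss_int (of_real \<nu>) (\<lambda>z. hermite \<nu> m (Suc n) z * hermite \<nu> l k z) =
      gauss_int (of_real \<nu>) (\<lambda>z. hermite \<nu> m n z * (of_real \<nu> * of_nat l * hermite \<nu> (l - 1) k z))"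
    by (rule gauss_int_hermite_shift(2)[OF assms has_wirtinger_hermite]) (intro g)+
  also have "\<dots> = gauss_int (of_real \<nu>) (\<lambda>z. (of_real \<nu> * of_nat l) * (hermite \<nu> m n z * hermite \<nu> (l - 1) k z))"
    by (simp only: mult_ac)
  finally show "gauss_int (of_real \<nu>) (\<lambda>z. hermite \<nu> m (Suc n) z * hermite \<nu> l k z) =
      of_real \<nu> * of_nat l * gauss_int (of_real \<nu>) (\<lambda>z. hermite \<nu> m n z * hermite \<nu> (l - 1) k z)"
    by (simp only: gauss_int_scale)
qed

text \<open>As conjugation exchanges the two indices, this is orthogonality. Each step lowers one index on both sides, with a factor that is \<open>0\<close> when the second polynomial has
  nothing left to lower; unequal indices thus run into \<open>0\<close>.\<close>

lemma gauss_int_hermite_hermite: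
  assumes \<nu>: "\<nu> > 0"
  shows "gauss_int (of_real \<nu>) (\<lambda>z. hermite \<nu> m n z * hermite \<nu> l k z) =
    (if m = k \<and> n = l then of_real (pi / \<nu> * (fact m * fact n * \<nu> ^ (m + n))) else 0)"
proof -
  let ?I = "\<lambda>m n l k. gauss_int (of_real \<nu>) (\<lambda>z. hermite \<nu> m n z * hermite \<nu> l k z)"
  note Suc1 = gauss_int_hermite_hermite_Suc(1)[OF \<nu>] and Suc2 = gauss_int_hermite_hermite_Suc(2)[OF \<nu>]
  have sym: "?I m n l k = ?I l k m n" for m n l k by (simp only: mult.commute)
  have base: "?I 0 0 l k = (if l = 0 \<and> k = 0 then of_real (pi / \<nu>) else 0)" for l k
  proof (cases l)
    case (Suc l')
    then show ?thesis using Suc1[of l' k 0 0] by (simp only: sym[of 0 0]) simp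
  next
    case 0
    show ?thesis
    proof (cases k)
      case (Suc k')
      then show ?thesis using Suc2[of l k' 0 0] by (simp only: sym[of 0 0]) simp
    next
      case 0
      then show ?thesis using \<open>l = 0\<close> gauss_int_one[of "of_real \<nu>"] \<nu> by simp
    qed
  qed
  have zero: "?I 0 n l k = (if k = 0 \<and> n = l then of_real (pi / \<nu> * (fact n * \<nu> ^ n)) else 0)" for n l k
  proof (induction n arbitrary: l)
    case (Suc n)
    show ?case
    proof (cases l)
      case (Suc l')
      show ?thesis unfolding Suc2 Suc.IH unfolding Suc using \<nu> by simp
    qed (unfold Suc2, simp)
  qed (use base in auto)
  show ?thesis
  proof (induction m arbitrary: k)
    case 0 show ?case unfolding zero by simp
  next
    case (Suc m)
    show ?case
    proof (cases k)
      case (Suc k')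
      show ?thesis unfolding Suc1 Suc.IH unfolding Suc using \<nu> by simp
    qed (unfold Suc1, simp)
  qed
qed

section \<open>The orthonormal system in the Gaussian space\<close>

lemma L2_gauss_simps:
  "meas (L2_gauss \<nu>) = density lborel (\<lambda>z. ennreal (exp (- \<nu> * (cmod z)\<^sup>2)))"
  "funs (L2_gauss \<nu>) = square_integrable (meas (L2_gauss \<nu>))"
  by (simp_all add: L2_gauss_def Let_def)

lemma space_L2_gauss [simp]: "space (meas (L2_gauss \<nu>)) = UNIV"
  by (simp add: L2_gauss_simps)

lemma borel_measurable_L2_gauss_iff [simp]:
  "f \<in> borel_measurable (meas (L2_gauss \<nu>)) \<longleftrightarrow> f \<in> borel_measurable borel"
  by (simp add: L2_gauss_simps)

lemma gaussian_of_real: "gaussian (of_real \<nu>) z = of_real (exp (- \<nu> * (cmod z)\<^sup>2))"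
  by (simp add: gaussian_def exp_of_real[symmetric])

lemma integral_L2_gauss:
  fixes f :: "complex \<Rightarrow> complex"
  assumes [measurable]: "f \<in> borel_measurable borel"
  shows "(LINT z|meas (L2_gauss \<nu>). f z) = gauss_int (of_real \<nu>) f"
  unfolding L2_gauss_simps gauss_int_def
  by (subst integral_density) (auto simp: gaussian_of_real scaleR_conv_of_real mult.commute)

lemma integrable_L2_gauss_iff:
  fixes f :: "complex \<Rightarrow> 'a::{banach, second_countable_topology}"
  assumes [measurable]: "f \<in> borel_measurable borel"
  shows "integrable (meas (L2_gauss \<nu>)) f \<longleftrightarrow> integrable lborel (\<lambda>z. exp (- \<nu> * (cmod z)\<^sup>2) *\<^sub>R f z)"
  unfolding L2_gauss_simps by (subst integrable_density) auto

lemma inner_prod_L2_gauss: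
  assumes [measurable]: "f \<in> borel_measurable borel" "g \<in> borel_measurable borel"
  shows "inner_prod (L2_gauss \<nu>) f g = gauss_int (of_real \<nu>) (\<lambda>z. f z * cnj (g z))"
  unfolding inner_prod_def by (rule integral_L2_gauss) measurable

lemma exp_growth_measurable: "exp_growth f \<Longrightarrow> f \<in> borel_measurable borel"
  by (rule borel_measurable_continuous_onI[OF exp_growth_continuous])

lemma exp_growth_square_integrable:
  assumes "\<nu> > 0" "exp_growth f"
  shows "f \<in> square_integrable (meas (L2_gauss \<nu>))"
proof -
  note [measurable] = exp_growth_measurable[OF assms(2)]
  have "exp_growth (\<lambda>z. f z * f z)" by (intro exp_growth_intros assms)
  from integrable_exp_growth_real[OF this assms(1)]
  show ?thesis
    by (simp add: square_integrable_def integrable_L2_gauss_iff norm_mult power2_eq_square mult.commute)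
qed

definition hermite_norm :: "real \<Rightarrow> nat \<Rightarrow> nat \<Rightarrow> real" where
  "hermite_norm \<nu> m n = sqrt (pi / \<nu> * (fact m * fact n * \<nu> ^ (m + n)))"

lemma hermite_norm_pos: "\<nu> > 0 \<Longrightarrow> hermite_norm \<nu> m n > 0"
  by (simp add: hermite_norm_def)

lemma hermite_norm_square: "\<nu> > 0 \<Longrightarrow> (hermite_norm \<nu> m n)\<^sup>2 = pi / \<nu> * (fact m * fact n * \<nu> ^ (m + n))"
  by (simp add: hermite_norm_def)

definition hermite_basis :: "real \<Rightarrow> nat \<times> nat \<Rightarrow> complex \<Rightarrow> complex" where
  "hermite_basis \<nu> = (\<lambda>(m, n) z. hermite \<nu> m n z / of_real (hermite_norm \<nu> m n))"

lemma exp_growth_hermite_basis: "exp_growth (hermite_basis \<nu> i)"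
proof (cases i)
  case (Pair m n)
  have "exp_growth (\<lambda>z. (1 / of_real (hermite_norm \<nu> m n)) * hermite \<nu> m n z)"
    by (intro exp_growth_intros exp_growth_hermite)
  then show ?thesis by (simp add: Pair hermite_basis_def)
qed

lemma orthonormal_hermite_basis:
  assumes \<nu>: "\<nu> > 0"
  shows "orthonormal (L2_gauss \<nu>) (hermite_basis \<nu>)"
  unfolding orthonormal_def
proof (intro conjI allI)
  show "hermite_basis \<nu> i \<in> square_integrable (meas (L2_gauss \<nu>))" for i
    by (intro exp_growth_square_integrable exp_growth_hermite_basis \<nu>)
  fix i j :: "nat \<times> nat"
  obtain m n k l where ij: "i = (m, n)" "j = (k, l)" by (metis surj_pair)
  let ?c = "1 / (of_real (hermite_norm \<nu> m n) * of_real (hermite_norm \<nu> k l)) :: complex"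
  have "inner_prod (L2_gauss \<nu>) (hermite_basis \<nu> i) (hermite_basis \<nu> j) =
      gauss_int (of_real \<nu>) (\<lambda>z. ?c * (hermite \<nu> m n z * hermite \<nu> l k z))"
    by (subst inner_prod_L2_gauss)
       (simp_all add: exp_growth_measurable exp_growth_hermite_basis, simp add: ij hermite_basis_def cnj_hermite)
  also have "\<dots> = ?c * (if m = k \<and> n = l then of_real (pi / \<nu> * (fact m * fact n * \<nu> ^ (m + n))) else 0)"
    by (simp only: gauss_int_scale gauss_int_hermite_hermite[OF \<nu>])
  also have "\<dots> = (if i = j then 1 else 0)"
  proof (cases "i = j")
    case True
    have "pi / \<nu> * (fact m * fact n * \<nu> ^ (m + n)) = hermite_norm \<nu> m n * hermite_norm \<nu> m n"
      unfolding power2_eq_square[symmetric] hermite_norm_square[OF \<nu>] ..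
    then show ?thesis using True hermite_norm_pos[OF \<nu>, of m n] unfolding ij by simp
  next
    case False
    then have "\<not> (m = k \<and> n = l)" by (simp add: ij)
    then show ?thesis using False by (simp only: if_False mult_zero_right)
  qed
  finally show "inner_prod (L2_gauss \<nu>) (hermite_basis \<nu> i) (hermite_basis \<nu> j) = (if i = j then 1 else 0)" .
qed

subsection \<open>A pointwise bound\<close>

lemma hermite_left: "hermite \<nu> m 0 z = (of_real \<nu> * z) ^ m"
  using cnj_hermite[of \<nu> 0 m z] by simp

lemma norm_hermite_0: 
  assumes "\<nu> > 0"
  shows "(norm_in (L2_gauss \<nu>) (hermite \<nu> m 0))\<^sup>2 = pi / \<nu> * (fact m * \<nu> ^ m)"
proof -
  have "complex_of_real ((norm_in (L2_gauss \<nu>) (hermite \<nu> m 0))\<^sup>2) = of_real (pi / \<nu> * (fact m * \<nu> ^ m))"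
    unfolding inner_prod_self[symmetric]
    by (subst inner_prod_L2_gauss)
       (simp_all only: exp_growth_measurable exp_growth_hermite cnj_hermite gauss_int_hermite_hermite[OF assms], simp)
  then show ?thesis by (simp only: of_real_eq_iff)
qed

text \<open>The numbers \<open>hermite \<nu> m n w\<close> are, up to normalization, the coefficients of the function
  \<open>\<phi> n s = (\<nu> (w' - s)) ^ n * exp (\<nu> w s)\<close> with respect to the orthogonal system of the powers of \<open>s\<close>.
  Against the Gaussian weight the modulus of \<open>\<phi> n\<close> is that of a translated power, times the constant
  \<open>exp (\<nu> \<bar>w\<bar>\<^sup>2 / 2)\<close>. So its norm is explicit, and Cauchy--Schwarz gives the bound. Adding up the
  absolute values of the terms of the normalized polynomial would lose, for \<open>m = n\<close>, a factor that
  grows like \<open>exp (2 \<surd>(\<nu> n) \<bar>w\<bar>)\<close> up to powers of \<open>n\<close>, too much for the Schatten exponents.\<close>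

lemma hermite_bound:
  assumes \<nu>: "\<nu> > 0"
  shows "(cmod (hermite \<nu> m n w))\<^sup>2 \<le> fact m * fact n * \<nu> ^ (m + n) * exp (\<nu> * (cmod w)\<^sup>2)"
proof -
  let ?X = "L2_gauss \<nu>" and ?I = "gauss_int (of_real \<nu>)"
  define \<phi> where "\<phi> n s = (of_real \<nu> * (cnj w - s)) ^ n * exp (of_real \<nu> * w * s + 0 * cnj s)" for n s
  have \<phi>: "exp_growth (\<phi> n)" for n
    unfolding \<phi>_def[abs_def] by (intro exp_growth_intros)
  have D\<phi>: "has_wirtinger (\<phi> n) (of_real \<nu> * w * \<phi> n s - of_real \<nu> * of_nat n * \<phi> (n - 1) s) 0 s" for n s
  proof -
    have D: "has_wirtinger (\<lambda>s. (of_real \<nu> * (cnj w - s)) ^ n)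
        (of_nat n * (of_real \<nu> * (cnj w - s)) ^ (n - 1) * (of_real \<nu> * (0 - 1))) 
        (of_nat n * (of_real \<nu> * (cnj w - s)) ^ (n - 1) * (of_real \<nu> * (0 - 0))) s"
      by (rule has_wirtinger_cong[OF has_wirtinger_compose_holomorphic[OF has_wirtinger_scale[OF
            has_wirtinger_diff[OF has_wirtinger_const has_wirtinger_id]] DERIV_power[OF DERIV_ident]]]) simp_all
    show ?thesis
      unfolding \<phi>_def[abs_def]
      by (rule has_wirtinger_cong[OF has_wirtinger_mult[OF D has_wirtinger_exp_linear]])
         (simp_all add: algebra_simps)
  qed
  have base: "?I (\<phi> n) = of_real (pi / \<nu>) * hermite \<nu> 0 n w" for n
  proof (induction n)
    case 0
    show ?case using gauss_int_exp_linear[of "of_real \<nu>" "of_real \<nu> * w" 0] \<nu> by (simp add: \<phi>_def[abs_def])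
  next
    case (Suc n)
    have "of_real \<nu> * ?I (\<lambda>s. s * \<phi> n s) = ?I (\<lambda>s. 0)"
      by (rule gauss_int_by_parts(1)[OF _ D\<phi>]) (use \<nu> in \<open>auto intro!: exp_growth_intros \<phi>\<close>)
    then have 0: "?I (\<lambda>s. s * \<phi> n s) = 0" using \<nu> by (simp add: gauss_int_def)
    have "?I (\<phi> (Suc n)) = ?I (\<lambda>s. of_real \<nu> * cnj w * \<phi> n s - of_real \<nu> * (s * \<phi> n s))"
      by (simp add: \<phi>_def[abs_def] algebra_simps)
    also have "\<dots> = of_real \<nu> * cnj w * ?I (\<phi> n)"
      by (subst gauss_int_diff) (use \<nu> in \<open>auto intro!: exp_growth_intros \<phi> simp: gauss_int_scale 0\<close>)
    finally show ?case by (simp add: Suc)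
  qed
  have "?I (\<lambda>s. hermite \<nu> 0 m s * \<phi> n s) = of_real (pi / \<nu>) * hermite \<nu> m n w" for m n
  proof (induction m arbitrary: n)
    case 0 show ?case using base by simp
  next
    case (Suc m)
    have "?I (\<lambda>s. hermite \<nu> 0 (Suc m) s * \<phi> n s) =
        ?I (\<lambda>s. hermite \<nu> 0 m s * (of_real \<nu> * w * \<phi> n s - of_real \<nu> * of_nat n * \<phi> (n - 1) s))"
      by (rule gauss_int_hermite_shift(2)[OF \<nu> D\<phi>]) (intro exp_growth_intros \<phi>)+
    also have "\<dots> = ?I (\<lambda>s. of_real \<nu> * w * (hermite \<nu> 0 m s * \<phi> n s) - of_real \<nu> * of_nat n * (hermite \<nu> 0 m s * \<phi> (n - 1) s))"
      by (simp only: right_diff_distrib mult_ac)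
    also have "\<dots> = of_real \<nu> * w * ?I (\<lambda>s. hermite \<nu> 0 m s * \<phi> n s) - of_real \<nu> * of_nat n * ?I (\<lambda>s. hermite \<nu> 0 m s * \<phi> (n - 1) s)"
      by (subst gauss_int_diff)
         (use \<nu> in \<open>auto intro!: exp_growth_intros \<phi> exp_growth_hermite simp: gauss_int_scale simp del: hermite.simps\<close>)
    also have "\<dots> = of_real (pi / \<nu>) * hermite \<nu> (Suc m) n w" unfolding Suc by (simp add: algebra_simps)
    finally show ?case .
  qed
  then have coeff: "inner_prod ?X (\<phi> n) (hermite \<nu> m 0) = of_real (pi / \<nu>) * hermite \<nu> m n w"
    by (subst inner_prod_L2_gauss) (simp_all only: exp_growth_measurable exp_growth_hermite \<phi> cnj_hermite mult.commute)
  have norm\<phi>: "(norm_in ?X (\<phi> n))\<^sup>2 = exp (\<nu> * (cmod w)\<^sup>2) * (pi / \<nu> * (fact n * \<nu> ^ n))"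
  proof -
    \<comment> \<open>Translation by the conjugate of \<open>w\<close> turns the exponential factor of \<open>\<phi> n\<close> into part of the Gaussian.\<close>
    have pt: "(cmod (\<phi> n (cnj w + s)))\<^sup>2 * exp (- \<nu> * (cmod (cnj w + s))\<^sup>2) =
        exp (\<nu> * (cmod w)\<^sup>2) * ((cmod (hermite \<nu> n 0 s))\<^sup>2 * exp (- \<nu> * (cmod s)\<^sup>2))" for s
    proof -
      have n: "cmod (of_real \<nu> * (cnj w - (cnj w + s))) = cmod (of_real \<nu> * s)" by (simp add: norm_mult)
      have A: "(cmod (\<phi> n (cnj w + s)))\<^sup>2 = (cmod (hermite \<nu> n 0 s))\<^sup>2 * (exp (\<nu> * Re (w * (cnj w + s))))\<^sup>2"
        unfolding \<phi>_def hermite_left norm_mult norm_power n power_mult_distrib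
        by (simp add: norm_exp_eq_Re mult.assoc)
      have B: "(exp (\<nu> * Re (w * (cnj w + s))))\<^sup>2 * exp (- \<nu> * (cmod (cnj w + s))\<^sup>2) = exp (\<nu> * (cmod w)\<^sup>2) * exp (- \<nu> * (cmod s)\<^sup>2)"
      proof -
        have "2 * Re (w * (cnj w + s)) - (cmod (cnj w + s))\<^sup>2 = (cmod w)\<^sup>2 - (cmod s)\<^sup>2"
          unfolding cmod_power2 by (simp add: power2_eq_square algebra_simps)
        then have "2 * (\<nu> * Re (w * (cnj w + s))) + - \<nu> * (cmod (cnj w + s))\<^sup>2 = \<nu> * (cmod w)\<^sup>2 + - \<nu> * (cmod s)\<^sup>2"
          by (metis (no_types, opaque_lifting) add_uminus_conv_diff mult.left_commute mult_minus_left right_diff_distrib)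
        then show ?thesis by (simp only: exp_add[symmetric] exp_double[symmetric])
      qed
      show ?thesis unfolding A by (simp only: mult.assoc B mult.left_commute)
    qed
    have mod: "(norm_in ?X f)\<^sup>2 = (LINT s|lborel. (cmod (f s))\<^sup>2 * exp (- \<nu> * (cmod s)\<^sup>2))" if "exp_growth f" for f
      unfolding norm_in_power2 L2_gauss_simps
      by (subst integral_density) (use exp_growth_measurable[OF that] in \<open>auto simp: mult.commute\<close>)
    have "(norm_in ?X (\<phi> n))\<^sup>2 = (LINT s|lborel. (cmod (\<phi> n (cnj w + s)))\<^sup>2 * exp (- \<nu> * (cmod (cnj w + s))\<^sup>2))"
      unfolding mod[OF \<phi>] by (rule integral_lborel_translate[symmetric])
    also have "\<dots> = exp (\<nu> * (cmod w)\<^sup>2) * (norm_in ?X (hermite \<nu> n 0))\<^sup>2"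
      unfolding pt mod[OF exp_growth_hermite] by simp
    finally show ?thesis unfolding norm_hermite_0[OF \<nu>] .
  qed
  have "cmod (of_real (pi / \<nu>) * hermite \<nu> m n w) \<le> norm_in ?X (\<phi> n) * norm_in ?X (hermite \<nu> m 0)"
    unfolding coeff[symmetric]
    by (intro Cauchy_Schwarz_inner_prod exp_growth_square_integrable \<nu> \<phi> exp_growth_hermite)
  then have "(cmod (of_real (pi / \<nu>) * hermite \<nu> m n w))\<^sup>2 \<le> (norm_in ?X (\<phi> n) * norm_in ?X (hermite \<nu> m 0))\<^sup>2"
    by (rule power_mono) simp
  moreover have "cmod (complex_of_real (pi / \<nu>)) = pi / \<nu>" unfolding norm_of_real using \<nu> by simp
  ultimately have "(pi / \<nu>)\<^sup>2 * (cmod (hermite \<nu> m n w))\<^sup>2 \<le> (pi / \<nu>)\<^sup>2 * (fact m * fact n * \<nu> ^ (m + n) * exp (\<nu> * (cmod w)\<^sup>2))"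
    unfolding norm_mult power_mult_distrib norm\<phi> norm_hermite_0[OF \<nu>]
    by (simp only: power2_eq_square power_add mult_ac)
  then show ?thesis using \<nu> by (simp only: mult_le_cancel_left_pos zero_less_power divide_pos_pos pi_gt_zero)
qed

lemma hermite_basis_bound:
  assumes \<nu>: "\<nu> > 0"
  shows "(cmod (hermite_basis \<nu> i w))\<^sup>2 \<le> \<nu> / pi * exp (\<nu> * (cmod w)\<^sup>2)"
proof (cases i)
  case (Pair m n)
  have "(cmod (hermite_basis \<nu> i w))\<^sup>2 = (cmod (hermite \<nu> m n w))\<^sup>2 / (pi / \<nu> * (fact m * fact n * \<nu> ^ (m + n)))"
    unfolding hermite_norm_square[OF \<nu>, symmetric] by (simp add: Pair hermite_basis_def norm_divide power_divide)
  also have "\<dots> \<le> (fact m * fact n * \<nu> ^ (m + n) * exp (\<nu> * (cmod w)\<^sup>2)) / (pi / \<nu> * (fact m * fact n * \<nu> ^ (m + n)))"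
    by (rule divide_right_mono[OF hermite_bound[OF \<nu>]]) (use \<nu> in simp)
  also have "\<dots> = \<nu> / pi * exp (\<nu> * (cmod w)\<^sup>2)" using \<nu> by (simp add: field_simps)
  finally show ?thesis .
qed

section \<open>Completeness\<close>

text \<open>The positive and the negative part of \<open>f\<close> are densities of two finite measures that agree on the
  open sets, an intersection stable generator of the Borel sets.\<close>

lemma AE_zero_if_integral_open_zero:
  fixes M :: "'a::topological_space measure" and f :: "'a \<Rightarrow> real"
  assumes sets: "sets M = sets borel" and f: "integrable M f"
    and zero: "\<And>V. open V \<Longrightarrow> (LINT x|M. indicator V x * f x) = 0"
  shows "AE x in M. f x = 0"
proof -
  define P where "P x = max 0 (f x)" for x
  define N where "N x = max 0 (- f x)" for x
  have [measurable]: "f \<in> borel_measurable M" using f by (rule borel_measurable_integrable)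
  have PN: "integrable M P" "integrable M N"
    unfolding P_def[abs_def] N_def[abs_def] using f by auto
  have [measurable]: "P \<in> borel_measurable M" "N \<in> borel_measurable M"
    using PN by (auto dest: borel_measurable_integrable)
  have V_sets[measurable]: "V \<in> sets M" if "open V" for V using that sets by simp
  have emeasure: "emeasure (density M (\<lambda>x. ennreal (g x))) V = ennreal (LINT x|M. indicator V x * g x)"
    if "open V" and g: "integrable M g" and nonneg: "\<And>x. 0 \<le> g x" for g :: "'a \<Rightarrow> real" and V
  proof -
    note [measurable] = borel_measurable_integrable[OF g] V_sets[OF that(1)]
    have int: "integrable M (\<lambda>x. indicator V x * g x)"
      using integrable_mult_indicator[OF V_sets[OF that(1)] g] by simp
    have "emeasure (density M (\<lambda>x. ennreal (g x))) V = (\<integral>\<^sup>+x. ennreal (indicator V x * g x) \<partial>M)"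
      by (subst emeasure_density) (auto intro!: nn_integral_cong split: split_indicator)
    also have "\<dots> = ennreal (LINT x|M. indicator V x * g x)"
      by (rule nn_integral_eq_integral[OF int]) (simp add: nonneg)
    finally show ?thesis .
  qed
  have eq: "density M (\<lambda>x. ennreal (P x)) = density M (\<lambda>x. ennreal (N x))"
  proof (rule measure_eqI_generator_eq[where E = "{V. open V}" and \<Omega> = UNIV and A = "\<lambda>_. UNIV"])
    show "Int_stable {V::'a set. open V}" by (auto simp: Int_stable_def)
    fix V :: "'a set" assume "V \<in> {V. open V}"
    then have V: "open V" by simp
    have "(LINT x|M. indicator V x * P x) - (LINT x|M. indicator V x * N x) = (LINT x|M. indicator V x * P x - indicator V x * N x)"
      using integrable_mult_indicator[OF V_sets[OF V] PN(1)] integrable_mult_indicator[OF V_sets[OF V] PN(2)] by simp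
    also have "\<dots> = (LINT x|M. indicator V x * f x)"
      by (rule Bochner_Integration.integral_cong) (auto simp: P_def N_def split: split_indicator)
    finally have "(LINT x|M. indicator V x * P x) = (LINT x|M. indicator V x * N x)" using zero[OF V] by simp
    then show "emeasure (density M (\<lambda>x. ennreal (P x))) V = emeasure (density M (\<lambda>x. ennreal (N x))) V"
      using emeasure[OF V PN(1)] emeasure[OF V PN(2)] by (simp add: P_def N_def)
  next
    show "emeasure (density M (\<lambda>x. ennreal (P x))) UNIV \<noteq> \<infinity>"
      using emeasure[OF open_UNIV PN(1)] by (simp add: P_def)
  qed (auto simp: sets borel_def)
  have "AE x in M. ennreal (P x) = ennreal (N x)"
  proof (rule iffD1[OF finite_density_unique eq])
    show "(\<integral>\<^sup>+x. ennreal (P x) \<partial>M) \<noteq> \<infinity>"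
      using nn_integral_eq_integral[OF PN(1)] by (simp add: P_def)
  qed auto
  then show ?thesis
    by eventually_elim (auto simp: P_def N_def max_def split: if_splits)
qed

text \<open>Let \<open>f\<close> be orthogonal to all polynomials in \<open>z\<close> and its conjugate. Then it is orthogonal to their
  products with powers of the Gaussian \<open>damping\<close>. Among these products is the algebra generated by
  the bounded functions \<open>damping\<close>, \<open>z * damping\<close> and its conjugate. Stone--Weierstrass applies to
  this algebra, and the limits include the indicators of all open sets.\<close>

context
  fixes \<nu> :: real and f :: "complex \<Rightarrow> complex"
  assumes \<nu>: "\<nu> > 0" and f: "f \<in> square_integrable (meas (L2_gauss \<nu>))"
begin

definition pairing :: "(complex \<Rightarrow> complex) \<Rightarrow> complex" where
  "pairing \<psi> = (LINT z|meas (L2_gauss \<nu>). f z * \<psi> z)"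

definition damping :: "complex \<Rightarrow> real" where
  "damping z = exp (- (\<nu> / 4) * (cmod z)\<^sup>2)"

lemma damping_le_1: "damping z \<le> 1" and damping_pos: "damping z > 0"
  using \<nu> by (auto simp: damping_def)

lemma continuous_on_damping [continuous_intros]: "continuous_on S damping"
  unfolding damping_def[abs_def] by (intro continuous_intros)

lemma exp_growth_damping: "exp_growth (\<lambda>z. of_real (damping z))"
  unfolding exp_growth_def
proof (intro conjI exI allI)
  show "cmod (complex_of_real (damping z)) \<le> 1 * exp (0 * cmod z)" for z
    using damping_le_1[of z] damping_pos[of z] by simp
qed (intro continuous_intros)

lemma integrable_pairing:
  assumes "exp_growth \<psi>"
  shows "integrable (meas (L2_gauss \<nu>)) (\<lambda>z. f z * \<psi> z)"
  using integrable_mult_cnj[OF f exp_growth_square_integrable[OF \<nu> exp_growth_cnj[OF assms]]] by simp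

lemma pairing_add:
  "exp_growth \<psi> \<Longrightarrow> exp_growth \<eta> \<Longrightarrow> pairing (\<lambda>z. \<psi> z + \<eta> z) = pairing \<psi> + pairing \<eta>"
  unfolding pairing_def distrib_left by (intro Bochner_Integration.integral_add integrable_pairing)

lemma pairing_scale: "pairing (\<lambda>z. c * \<psi> z) = c * pairing \<psi>"
  unfolding pairing_def by (simp add: mult.left_commute)

lemma f_measurable: "f \<in> borel_measurable borel"
  using square_integrable_measurable[OF f] by simp

text \<open>Multiply by one more factor \<open>damping\<close>, and expand it into a power series in \<open>\<bar>z\<bar>\<^sup>2\<close>. The partial
  sums are dominated by \<open>exp (\<nu>/4 \<bar>z\<bar>\<^sup>2)\<close>, which is still square integrable against the Gaussian
  weight; any rate below \<open>\<nu>/2\<close> in place of \<open>\<nu>/4\<close> would do.\<close>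

lemma pairing_damped_polynomial:
  assumes polynomial: "\<And>a b. pairing (\<lambda>z. z ^ a * cnj z ^ b) = 0"
  shows "pairing (\<lambda>z. z ^ a * cnj z ^ b * of_real (damping z) ^ k) = 0"
proof (induction k arbitrary: a b)
  case 0 then show ?case using polynomial by simp
next
  case (Suc k)
  let ?M = "meas (L2_gauss \<nu>)"
  let ?c = "- complex_of_real (\<nu> / 4)"
  define g where "g z = z ^ a * cnj z ^ b * of_real (damping z) ^ k" for z
  define S where "S n z = (\<Sum>j<n. (?c * (z * cnj z)) ^ j / fact j)" for n z
  have g_growth: "exp_growth g" unfolding g_def[abs_def] by (intro exp_growth_intros exp_growth_damping)
  have g_meas: "g \<in> borel_measurable borel" by (rule exp_growth_measurable[OF g_growth])
  have S_growth: "exp_growth (S n)" for n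
  proof -
    have "exp_growth (\<lambda>z. \<Sum>j<n. (1 / fact j) * (?c * (z * cnj z)) ^ j)"
      by (induction n) (simp_all only: sum.lessThan_Suc lessThan_0 sum.empty, (intro exp_growth_intros | assumption)+)
    then show ?thesis unfolding S_def[abs_def] by simp
  qed
  have w_sq: "(\<lambda>z. of_real (cmod (g z) * exp (\<nu> / 4 * (cmod z)\<^sup>2))) \<in> square_integrable ?M"
  proof -
    have "exp_growth (\<lambda>z. g z * g z)" by (intro exp_growth_intros g_growth)
    from integrable_exp_growth_real[OF this, of "\<nu> / 2"] \<nu>
    have 1: "integrable lborel (\<lambda>z. cmod (g z * g z) * exp (- (\<nu> / 2) * (cmod z)\<^sup>2))" by simp
    have 2: "exp (- \<nu> * (cmod z)\<^sup>2) * (cmod (of_real (cmod (g z) * exp (\<nu> / 4 * (cmod z)\<^sup>2))))\<^sup>2 =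
        cmod (g z * g z) * exp (- (\<nu> / 2) * (cmod z)\<^sup>2)" for z
    proof -
      have "exp (- \<nu> * (cmod z)\<^sup>2) * (exp (\<nu> / 4 * (cmod z)\<^sup>2))\<^sup>2 = exp (- (\<nu> / 2) * (cmod z)\<^sup>2)"
        by (simp add: exp_double[symmetric] exp_add[symmetric])
      then show ?thesis
        by (simp add: norm_mult power_mult_distrib power2_eq_square[of "cmod (g z)"] mult_ac)
    qed
    show ?thesis
      unfolding square_integrable_def
    proof (intro CollectI conjI)
      show meas: "(\<lambda>z. complex_of_real (cmod (g z) * exp (\<nu> / 4 * (cmod z)\<^sup>2))) \<in> borel_measurable ?M"
        using g_meas by simp
      show "integrable ?M (\<lambda>z. (cmod (of_real (cmod (g z) * exp (\<nu> / 4 * (cmod z)\<^sup>2))))\<^sup>2)"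
        by (subst integrable_L2_gauss_iff) (use g_meas 1 2 in simp_all)
    qed
  qed
  have "(\<lambda>n. LINT z|?M. f z * (g z * S n z)) \<longlonglongrightarrow> (LINT z|?M. f z * (g z * of_real (damping z)))"
  proof (rule integral_dominated_convergence)
    show "integrable ?M (\<lambda>z. cmod (f z * of_real (cmod (g z) * exp (\<nu> / 4 * (cmod z)\<^sup>2))))"
      using integrable_norm[OF integrable_mult_cnj[OF f w_sq]] by simp
    show "(\<lambda>z. f z * (g z * of_real (damping z))) \<in> borel_measurable ?M"
      "\<And>n. (\<lambda>z. f z * (g z * S n z)) \<in> borel_measurable ?M"
      using f_measurable g_meas exp_growth_measurable[OF S_growth] exp_growth_measurable[OF exp_growth_damping] by simp_all
    show "AE z in ?M. (\<lambda>n. f z * (g z * S n z)) \<longlonglongrightarrow> f z * (g z * of_real (damping z))"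
    proof (rule AE_I2)
      fix z
      have "complex_of_real (damping z) = exp (?c * (z * cnj z))"
        unfolding damping_def complex_norm_square[symmetric] by (simp only: exp_of_real of_real_mult[symmetric] of_real_minus[symmetric])
      then have "(\<lambda>j. (?c * (z * cnj z)) ^ j / fact j) sums of_real (damping z)"
        using exp_series_sums[of "?c * (z * cnj z)"] by (simp only:)
      then show "(\<lambda>n. f z * (g z * S n z)) \<longlonglongrightarrow> f z * (g z * of_real (damping z))"
        unfolding sums_def S_def by (intro tendsto_intros)
    qed
    show "AE z in ?M. norm (f z * (g z * S n z)) \<le> cmod (f z * of_real (cmod (g z) * exp (\<nu> / 4 * (cmod z)\<^sup>2)))" for n
    proof (rule AE_I2)
      fix z
      let ?r = "\<nu> / 4 * (cmod z)\<^sup>2"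
      have r: "cmod (?c * (z * cnj z)) = ?r" using \<nu> by (simp add: norm_mult power2_eq_square)
      have "cmod (S n z) \<le> (\<Sum>j<n. ?r ^ j / fact j)"
        unfolding S_def by (rule order_trans[OF norm_sum]) (simp only: norm_divide norm_power r norm_fact order_refl)
      also have "\<dots> \<le> exp ?r"
      proof -
        have "(\<lambda>j. ?r ^ j / fact j) sums exp ?r" by (rule exp_series_sums)
        then show ?thesis
          using sum_le_suminf[of "\<lambda>j. ?r ^ j / fact j" "{..<n}"] \<nu> by (simp add: sums_iff)
      qed
      finally show "norm (f z * (g z * S n z)) \<le> cmod (f z * of_real (cmod (g z) * exp ?r))"
        by (simp add: norm_mult mult_left_mono)
    qed
  qed
  moreover have "(LINT z|?M. f z * (g z * S n z)) = 0" for n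
  proof -
    have "pairing (\<lambda>z. g z * S n z) = 0"
    proof (induction n)
      case (Suc n)
      have eq: "g z * S (Suc n) z = g z * S n z + (?c ^ n / fact n) * (z ^ (a + n) * cnj z ^ (b + n) * of_real (damping z) ^ k)" for z
        unfolding S_def g_def by (simp only: sum.lessThan_Suc distrib_left power_mult_distrib power_add times_divide_eq_left times_divide_eq_right mult_ac)
      have "pairing (\<lambda>z. g z * S (Suc n) z) = pairing (\<lambda>z. g z * S n z) +
          pairing (\<lambda>z. (?c ^ n / fact n) * (z ^ (a + n) * cnj z ^ (b + n) * of_real (damping z) ^ k))"
        unfolding eq by (intro pairing_add exp_growth_intros g_growth S_growth exp_growth_damping)
      then show ?case by (simp only: Suc pairing_scale Suc.IH \<open>\<And>b a. pairing (\<lambda>z. z ^ a * cnj z ^ b * of_real (damping z) ^ k) = 0\<close>) simp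
    qed (simp add: S_def pairing_def)
    then show ?thesis by (simp add: pairing_def)
  qed
  ultimately have "(LINT z|?M. f z * (g z * of_real (damping z))) = 0"
    by (simp add: LIMSEQ_const_iff)
  then show ?case by (simp add: pairing_def g_def mult_ac)
qed

text \<open>All monomials and powers of \<open>damping\<close> are built into the predicate, to make it stable under
  multiplication by them.\<close>

definition annihilated :: "(complex \<Rightarrow> complex) \<Rightarrow> bool" where
  "annihilated \<psi> \<longleftrightarrow> exp_growth \<psi> \<and> (\<forall>a b k. pairing (\<lambda>z. \<psi> z * (z ^ a * cnj z ^ b * of_real (damping z) ^ k)) = 0)"

lemma annihilated_lincomb:
  assumes "annihilated \<psi>" "annihilated \<eta>"
  shows "annihilated (\<lambda>z. c * \<psi> z + d * \<eta> z)"
  unfolding annihilated_def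
proof (intro conjI allI)
  have g: "exp_growth \<psi>" "exp_growth \<eta>" using assms by (simp_all add: annihilated_def)
  show "exp_growth (\<lambda>z. c * \<psi> z + d * \<eta> z)" by (intro exp_growth_intros g)
  fix a b k
  let ?m = "\<lambda>z. z ^ a * cnj z ^ b * of_real (damping z) ^ k"
  have "pairing (\<lambda>z. (c * \<psi> z + d * \<eta> z) * ?m z) = pairing (\<lambda>z. c * (\<psi> z * ?m z) + d * (\<eta> z * ?m z))"
    by (simp only: distrib_right mult.assoc)
  also have "\<dots> = c * pairing (\<lambda>z. \<psi> z * ?m z) + d * pairing (\<lambda>z. \<eta> z * ?m z)"
    by (subst pairing_add, (intro exp_growth_intros g exp_growth_damping)+) (simp only: pairing_scale)
  also have "\<dots> = 0" using assms by (simp add: annihilated_def)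
  finally show "pairing (\<lambda>z. (c * \<psi> z + d * \<eta> z) * ?m z) = 0" .
qed

lemma annihilated_damping:
  assumes "annihilated \<psi>"
  shows "annihilated (\<lambda>z. \<psi> z * (z ^ a * cnj z ^ b * of_real (damping z) ^ k))"
  unfolding annihilated_def
proof (intro conjI allI)
  show "exp_growth (\<lambda>z. \<psi> z * (z ^ a * cnj z ^ b * of_real (damping z) ^ k))"
    using assms by (intro exp_growth_intros exp_growth_damping) (simp add: annihilated_def)
  fix a' b' k'
  have "pairing (\<lambda>z. \<psi> z * (z ^ (a + a') * cnj z ^ (b + b') * of_real (damping z) ^ (k + k'))) = 0"
    using assms unfolding annihilated_def by blast
  then show "pairing (\<lambda>z. \<psi> z * (z ^ a * cnj z ^ b * of_real (damping z) ^ k) * (z ^ a' * cnj z ^ b' * of_real (damping z) ^ k')) = 0"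
    by (simp only: power_add mult_ac)
qed

text \<open>A bounded injective continuous image of the plane; the point \<open>z\<close> is recovered as the quotient of the two
  components.\<close>

definition embed :: "complex \<Rightarrow> real \<times> complex" where
  "embed z = (damping z, of_real (damping z) * z)"

text \<open>The functions \<open>\<phi>\<close> such that multiplication by \<open>\<phi>\<close> preserves \<open>annihilated\<close> are closed under sums and
  products, and contain \<open>damping\<close>, \<open>z * damping\<close> and its conjugate. The claim is stated for all \<open>\<psi>\<close>,
  rather than for the constant \<open>1\<close> only, to make the induction pass through products.\<close>

lemma annihilated_polynomial_multiple:
  assumes "real_polynomial_function q" "annihilated \<psi>"
  shows "annihilated (\<lambda>z. \<psi> z * of_real (q (embed z)))"
  using assms
proof (induction q arbitrary: \<psi> rule: real_polynomial_function.induct)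
  case (linear l)
  define c1 c2 c3 where "c1 = complex_of_real (l (1, 0))" and "c2 = complex_of_real (l (0, 1))" and "c3 = complex_of_real (l (0, \<i>))"
  have split: "complex_of_real (l (e, of_real e * z)) =
      c1 * of_real e + ((c2 - \<i> * c3) / 2) * (z * of_real e) + ((c2 + \<i> * c3) / 2) * (cnj z * of_real e)" for e :: real and z
  proof -
    have "(e, of_real e * z) = e *\<^sub>R (1, 0) + (e * Re z) *\<^sub>R (0, 1) + (e * Im z) *\<^sub>R (0, \<i>)"
      by (simp add: complex_eq_iff)
    then have "l (e, of_real e * z) = e * l (1, 0) + (e * Re z) * l (0, 1) + (e * Im z) * l (0, \<i>)"
      using linear by (simp only: linear_add linear_cmul bounded_linear.linear real_scaleR_def)
    then show ?thesis
      unfolding c1_def c2_def c3_def by (simp add: complex_eq_iff algebra_simps add_divide_distrib diff_divide_distrib)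
  qed
  have "annihilated (\<lambda>z. c1 * (\<psi> z * (z ^ 0 * cnj z ^ 0 * of_real (damping z) ^ 1)) +
      1 * (((c2 - \<i> * c3) / 2) * (\<psi> z * (z ^ 1 * cnj z ^ 0 * of_real (damping z) ^ 1)) +
       ((c2 + \<i> * c3) / 2) * (\<psi> z * (z ^ 0 * cnj z ^ 1 * of_real (damping z) ^ 1))))"
    by (intro annihilated_lincomb annihilated_damping linear)
  moreover have "\<psi> z * of_real (l (embed z)) = c1 * (\<psi> z * (z ^ 0 * cnj z ^ 0 * of_real (damping z) ^ 1)) +
      1 * (((c2 - \<i> * c3) / 2) * (\<psi> z * (z ^ 1 * cnj z ^ 0 * of_real (damping z) ^ 1)) +
       ((c2 + \<i> * c3) / 2) * (\<psi> z * (z ^ 0 * cnj z ^ 1 * of_real (damping z) ^ 1)))" for z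
    unfolding embed_def split power_0 power_one_right mult_1 mult_1_right by (simp only: distrib_left mult_ac add.assoc)
  ultimately show ?case by (simp only:)
next
  case (const c)
  then show ?case using annihilated_lincomb[OF const const, of "of_real c" 0] by (simp add: mult.commute)
next
  case (add p q)
  then show ?case using annihilated_lincomb[OF add.IH(1)[OF add.prems] add.IH(2)[OF add.prems], of 1 1]
    by (simp add: distrib_left)
next
  case (mult p q)
  then show ?case using mult.IH(2)[OF mult.IH(1)[OF mult.prems]] by (simp add: mult.assoc)
qed

lemma continuous_on_embed: "continuous_on S embed"
  unfolding embed_def[abs_def] by (intro continuous_intros)

lemma embed_bounded: "embed z \<in> {0..1} \<times> cball 0 (exp (1 / \<nu>))"
proof -
  have "cmod z \<le> exp (cmod z)" using exp_ge_add_one_self[of "cmod z"] by linarith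
  also have "\<dots> = exp (1 * cmod z)" by simp
  also have "\<dots> \<le> exp (1\<^sup>2 / (4 * (\<nu> / 4))) * exp (\<nu> / 4 * (cmod z)\<^sup>2)"
    by (rule exp_linear_le_gaussian) (use \<nu> in simp)
  finally have "cmod z * damping z \<le> (exp (1 / \<nu>) * exp (\<nu> / 4 * (cmod z)\<^sup>2)) * damping z"
    by (intro mult_right_mono) (auto simp: damping_def)
  also have "\<dots> = exp (1 / \<nu>)" by (simp add: damping_def exp_minus)
  finally show ?thesis
    using damping_le_1[of z] damping_pos[of z] by (simp add: embed_def norm_mult mult.commute)
qed

text \<open>The image of \<open>embed\<close> lies in a compact set, on which \<open>H\<close> is a uniform limit of polynomials.\<close>

lemma pairing_continuous_embed:
  assumes one: "annihilated (\<lambda>_. 1)" and H: "continuous_on UNIV H"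
  shows "pairing (\<lambda>z. of_real (H (embed z))) = 0"
proof -
  let ?M = "meas (L2_gauss \<nu>)" and ?K = "{0..1::real} \<times> cball 0 (exp (1 / \<nu>)) :: (real \<times> complex) set"
  have K: "compact ?K" by (intro compact_Times) auto
  have in_K: "embed z \<in> ?K" for z
    using embed_bounded[of z] by auto
  have int_f: "integrable ?M f" using integrable_pairing[of "\<lambda>_. 1"] by simp
  define C where "C = (LINT z|?M. cmod (f z))"
  have bound: "cmod (pairing (\<lambda>z. of_real (H (embed z)))) \<le> \<epsilon> * C" if \<epsilon>: "\<epsilon> > 0" for \<epsilon>
  proof -
    obtain q where q: "real_polynomial_function q" "\<And>x. x \<in> ?K \<Longrightarrow> \<bar>H x - q x\<bar> < \<epsilon>"
      using Stone_Weierstrass_real_polynomial_function[OF K continuous_on_subset[OF H subset_UNIV] \<epsilon>] by blast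
    have cq: "continuous_on UNIV q"
      by (rule continuous_on_polymonial_function) (use q(1) in \<open>simp add: real_polynomial_function_eq\<close>)
    have "annihilated (\<lambda>z. 1 * of_real (q (embed z)))" by (rule annihilated_polynomial_multiple[OF q(1) one])
    then have "pairing (\<lambda>z. 1 * of_real (q (embed z)) * (z ^ 0 * cnj z ^ 0 * of_real (damping z) ^ 0)) = 0"
      unfolding annihilated_def by blast
    then have pq: "pairing (\<lambda>z. of_real (q (embed z))) = 0" by simp
    obtain BH where BH: "\<And>x. x \<in> ?K \<Longrightarrow> \<bar>H x\<bar> \<le> BH"
      using compact_imp_bounded[OF compact_continuous_image[OF continuous_on_subset[OF H subset_UNIV] K]]
      by (auto simp: bounded_iff)
    have gH: "exp_growth (\<lambda>z. of_real (H (embed z)))"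
      unfolding exp_growth_def
    proof (intro conjI exI allI)
      show "continuous_on UNIV (\<lambda>z. complex_of_real (H (embed z)))"
        by (intro continuous_intros continuous_on_compose2[OF H continuous_on_embed]) simp
      show "cmod (complex_of_real (H (embed z))) \<le> BH * exp (0 * cmod z)" for z
        using BH[OF in_K[of z]] by simp
    qed
    have gq: "exp_growth (\<lambda>z. of_real (q (embed z)))"
      using \<open>annihilated (\<lambda>z. 1 * of_real (q (embed z)))\<close> by (simp add: annihilated_def)
    have "pairing (\<lambda>z. of_real (H (embed z))) = pairing (\<lambda>z. of_real (H (embed z))) + (- 1) * pairing (\<lambda>z. of_real (q (embed z)))"
      by (simp add: pq)
    also have "\<dots> = pairing (\<lambda>z. of_real (H (embed z)) + (- 1) * of_real (q (embed z)))"
      unfolding pairing_scale[symmetric] by (rule pairing_add[symmetric]) (intro exp_growth_intros gH gq)+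
    also have "cmod \<dots> \<le> (LINT z|?M. \<epsilon> * cmod (f z))"
      unfolding pairing_def
    proof (rule order_trans[OF integral_norm_bound], rule integral_mono)
      show "integrable ?M (\<lambda>z. norm (f z * (of_real (H (embed z)) + - 1 * of_real (q (embed z)))))"
        by (intro integrable_norm integrable_pairing exp_growth_intros gH gq)
      show "integrable ?M (\<lambda>z. \<epsilon> * cmod (f z))" using int_f by (intro integrable_mult_right integrable_norm)
      fix z
      have "cmod (of_real (H (embed z)) + - 1 * of_real (q (embed z))) = \<bar>H (embed z) - q (embed z)\<bar>"
        by (simp flip: of_real_diff)
      then have "cmod (of_real (H (embed z)) + - 1 * of_real (q (embed z))) \<le> \<epsilon>" using q(2)[OF in_K[of z]] by linarith
      then show "norm (f z * (of_real (H (embed z)) + - 1 * of_real (q (embed z)))) \<le> \<epsilon> * cmod (f z)"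
        unfolding norm_mult by (subst mult.commute) (rule mult_right_mono, auto)
    qed
    also have "\<dots> = \<epsilon> * C" by (simp add: C_def)
    finally show ?thesis .
  qed
  have C: "C \<ge> 0" by (simp add: C_def integral_nonneg_AE)
  have "cmod (pairing (\<lambda>z. of_real (H (embed z)))) \<le> 0 + \<epsilon>" if "\<epsilon> > 0" for \<epsilon>
  proof -
    have "cmod (pairing (\<lambda>z. of_real (H (embed z)))) \<le> (\<epsilon> / (C + 1)) * C"
      by (rule bound) (use that C in simp)
    also have "\<dots> \<le> \<epsilon>" using that C by (simp add: field_simps)
    finally show ?thesis by simp
  qed
  then have "cmod (pairing (\<lambda>z. of_real (H (embed z)))) \<le> 0" by (rule field_le_epsilon)
  then show ?thesis by simp
qed

text \<open>The preimage of \<open>V\<close> under the quotient map is an open set \<open>U\<close> in the target of \<open>embed\<close>, and the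
  indicator of an open set is a limit of continuous functions of the distance to its complement.\<close>

lemma pairing_open:
  assumes one: "annihilated (\<lambda>_. 1)" and V: "open V"
  shows "(LINT z|meas (L2_gauss \<nu>). f z * of_real (indicator V z)) = 0"
proof -
  let ?M = "meas (L2_gauss \<nu>)"
  define U :: "(real \<times> complex) set" where "U = {p. fst p > 0} \<inter> (\<lambda>p. snd p /\<^sub>R fst p) -` V"
  have "open U"
    unfolding U_def
  proof (rule continuous_open_preimage[OF _ _ V])
    show "open {p::real \<times> complex. fst p > 0}" by (intro open_Collect_less continuous_intros)
    show "continuous_on {p. fst p > 0} (\<lambda>p::real \<times> complex. snd p /\<^sub>R fst p)"
      by (intro continuous_intros) auto
  qed
  then have closed: "closed (- U)" by (rule closed_Compl)
  have "(0, 0) \<in> - U" by (simp add: U_def)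
  then have ne: "- U \<noteq> {}" by blast
  have in_U: "embed z \<in> U \<longleftrightarrow> z \<in> V" for z
  proof -
    have "complex_of_real (damping z) \<noteq> 0" using damping_pos[of z] by simp
    then have "snd (embed z) /\<^sub>R fst (embed z) = z" by (simp add: embed_def scaleR_conv_of_real)
    then show ?thesis using damping_pos[of z] by (simp add: U_def) (simp add: embed_def)
  qed
  \<comment> \<open>These functions increase to the indicator of \<open>U\<close>.\<close>
  define H where "H n p = min 1 (real n * infdist p (- U))" for n p
  have H_lim: "(\<lambda>n. H n p) \<longlonglongrightarrow> indicator U p" for p
  proof (cases "p \<in> U")
    case False
    then have "infdist p (- U) = 0" by (simp add: in_closed_iff_infdist_zero[OF closed ne, symmetric])
    then show ?thesis using False by (simp add: H_def)
  next
    case True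
    then have "infdist p (- U) > 0"
      using in_closed_iff_infdist_zero[OF closed ne, of p] infdist_nonneg[of p "- U"] by simp
    then obtain N where N: "real N * infdist p (- U) > 1" using reals_Archimedean3 by blast
    have "\<forall>\<^sub>F n in sequentially. H n p = indicator U p"
      using eventually_ge_at_top[of N]
    proof eventually_elim
      case (elim n)
      then have "real N * infdist p (- U) \<le> real n * infdist p (- U)" by (intro mult_right_mono) (auto simp: infdist_nonneg)
      then show ?case using N True by (simp add: H_def)
    qed
    then show ?thesis by (rule tendsto_eventually)
  qed
  have H_cont: "continuous_on UNIV (H n)" for n
    unfolding H_def[abs_def] by (intro continuous_intros)
  have H_emb: "(\<lambda>z. H n (embed z)) \<in> borel_measurable borel" for n
    by (rule borel_measurable_continuous_onI) (rule continuous_on_compose2[OF H_cont continuous_on_embed], simp)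
  have [measurable]: "V \<in> sets borel" using V by simp
  have int_f: "integrable ?M f" using integrable_pairing[of "\<lambda>_. 1"] by simp
  have "(\<lambda>n. LINT z|?M. f z * of_real (H n (embed z))) \<longlonglongrightarrow> (LINT z|?M. f z * of_real (indicator V z))"
  proof (rule integral_dominated_convergence)
    show "integrable ?M (\<lambda>z. cmod (f z))" using int_f by (rule integrable_norm)
    show "(\<lambda>z. f z * of_real (indicator V z)) \<in> borel_measurable ?M"
      "\<And>n. (\<lambda>z. f z * of_real (H n (embed z))) \<in> borel_measurable ?M"
      using f_measurable H_emb by simp_all
    show "AE z in ?M. (\<lambda>n. f z * of_real (H n (embed z))) \<longlonglongrightarrow> f z * of_real (indicator V z)"
    proof (rule AE_I2)
      fix z
      have "indicator U (embed z) = (indicator V z :: real)" using in_U by (simp add: indicator_def)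
      then show "(\<lambda>n. f z * of_real (H n (embed z))) \<longlonglongrightarrow> f z * of_real (indicator V z)"
        using H_lim[of "embed z"] by (intro tendsto_intros) simp
    qed
    show "AE z in ?M. norm (f z * of_real (H n (embed z))) \<le> cmod (f z)" for n
      by (rule AE_I2) (auto simp: norm_mult H_def infdist_nonneg intro!: mult_left_le)
  qed
  then show ?thesis
    using pairing_continuous_embed[OF one H_cont] by (simp add: pairing_def LIMSEQ_const_iff)
qed

lemma AE_zero_if_polynomials_annihilated:
  assumes "\<And>a b. pairing (\<lambda>z. z ^ a * cnj z ^ b) = 0"
  shows "AE z in meas (L2_gauss \<nu>). f z = 0"
proof -
  let ?M = "meas (L2_gauss \<nu>)"
  have one: "annihilated (\<lambda>_. 1)"
    unfolding annihilated_def using pairing_damped_polynomial[OF assms] by simp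
  have int_f: "integrable ?M f" using integrable_pairing[of "\<lambda>_. 1"] by simp
  have sets: "sets ?M = sets borel" by (simp add: L2_gauss_simps)
  have int_V: "integrable ?M (\<lambda>z. f z * of_real (indicator V z))" if "open V" for V
  proof -
    have "integrable ?M (\<lambda>z. indicator V z *\<^sub>R f z)"
      by (rule integrable_mult_indicator[OF _ int_f]) (use that sets in simp)
    then show ?thesis by (simp add: scaleR_conv_of_real mult.commute)
  qed
  have "AE z in ?M. Re (f z) = 0"
  proof (rule AE_zero_if_integral_open_zero[OF sets])
    fix V :: "complex set" assume V: "open V"
    have "(LINT z|?M. indicator V z * Re (f z)) = (LINT z|?M. Re (f z * of_real (indicator V z)))"
      by (simp add: mult.commute)
    also have "\<dots> = Re (LINT z|?M. f z * of_real (indicator V z))" using int_V[OF V] by (rule integral_Re)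
    finally show "(LINT z|?M. indicator V z * Re (f z)) = 0" by (simp add: pairing_open[OF one V])
  qed (use int_f in simp)
  moreover have "AE z in ?M. Im (f z) = 0"
  proof (rule AE_zero_if_integral_open_zero[OF sets])
    fix V :: "complex set" assume V: "open V"
    have "(LINT z|?M. indicator V z * Im (f z)) = (LINT z|?M. Im (f z * of_real (indicator V z)))"
      by (simp add: mult.commute)
    also have "\<dots> = Im (LINT z|?M. f z * of_real (indicator V z))" using int_V[OF V] by (rule integral_Im)
    finally show "(LINT z|?M. indicator V z * Im (f z)) = 0" by (simp add: pairing_open[OF one V])
  qed (use int_f in simp)
  ultimately show ?thesis by eventually_elim (simp add: complex_eq_iff)
qed

text \<open>The recursions express \<open>\<nu> z\<close> times a Hermite polynomial, and likewise for the conjugate of \<open>z\<close>, by Hermite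
  polynomials; so their span contains all monomials.\<close>

lemma hermite_basis_complete:
  assumes orth: "\<And>i. inner_prod (L2_gauss \<nu>) f (hermite_basis \<nu> i) = 0"
  shows "eq_in (L2_gauss \<nu>) f (\<lambda>_. 0)"
proof -
  have hermite: "pairing (hermite \<nu> m n) = 0" for m n
  proof -
    have "inner_prod (L2_gauss \<nu>) f (hermite_basis \<nu> (n, m)) = pairing (\<lambda>z. (1 / of_real (hermite_norm \<nu> n m)) * hermite \<nu> m n z)"
      by (simp add: inner_prod_def pairing_def hermite_basis_def cnj_hermite)
    then show ?thesis
      using orth[of "(n, m)"] hermite_norm_pos[OF \<nu>, of n m] unfolding pairing_scale by simp
  qed
  have a: "pairing (\<lambda>z. z ^ a * hermite \<nu> m n z) = 0" for a m n
  proof (induction a arbitrary: m n)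
    case (Suc a)
    have "z ^ Suc a * hermite \<nu> m n z =
        (1 / of_real \<nu>) * (z ^ a * hermite \<nu> (Suc m) n z) + of_nat n * (z ^ a * hermite \<nu> m (n - 1) z)" for z
      using \<nu> by (simp add: field_simps)
    then have "pairing (\<lambda>z. z ^ Suc a * hermite \<nu> m n z) =
        pairing (\<lambda>z. (1 / of_real \<nu>) * (z ^ a * hermite \<nu> (Suc m) n z) + of_nat n * (z ^ a * hermite \<nu> m (n - 1) z))"
      by (simp only:)
    also have "\<dots> = 0"
      by (subst pairing_add, (intro exp_growth_intros exp_growth_hermite)+) (simp only: pairing_scale Suc mult_zero_right add_0_right)
    finally show ?case .
  qed (use hermite in simp)
  have ab: "pairing (\<lambda>z. z ^ a * cnj z ^ b * hermite \<nu> m n z) = 0" for a b m n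
  proof (induction b arbitrary: m n)
    case (Suc b)
    have "z ^ a * cnj z ^ Suc b * hermite \<nu> m n z =
        (1 / of_real \<nu>) * (z ^ a * cnj z ^ b * hermite \<nu> m (Suc n) z) + of_nat m * (z ^ a * cnj z ^ b * hermite \<nu> (m - 1) n z)" for z
      unfolding hermite_Suc_right using \<nu> by (simp add: field_simps)
    then have "pairing (\<lambda>z. z ^ a * cnj z ^ Suc b * hermite \<nu> m n z) =
        pairing (\<lambda>z. (1 / of_real \<nu>) * (z ^ a * cnj z ^ b * hermite \<nu> m (Suc n) z) + of_nat m * (z ^ a * cnj z ^ b * hermite \<nu> (m - 1) n z))"
      by (simp only:)
    also have "\<dots> = 0"
      by (subst pairing_add, (intro exp_growth_intros exp_growth_hermite)+) (simp only: pairing_scale Suc mult_zero_right add_0_right)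
    finally show ?case .
  qed (use a in simp)
  have "pairing (\<lambda>z. z ^ a * cnj z ^ b) = 0" for a b
    using ab[of a b 0 0] by simp
  then show ?thesis unfolding eq_in_def by (rule AE_zero_if_polynomials_annihilated)
qed

end

section \<open>Power series in two variables\<close>

lemma summable_on_prod_mult:
  fixes f g :: "nat \<Rightarrow> real"
  assumes f: "summable f" "\<And>n. 0 \<le> f n" and g: "summable g" "\<And>n. 0 \<le> g n"
  shows "(\<lambda>(m, n). f m * g n) summable_on UNIV"
proof (rule nonneg_bdd_above_summable_on)
  show "bdd_above (sum (\<lambda>(m, n). f m * g n) ` {F. F \<subseteq> UNIV \<and> finite F})"
  proof (rule bdd_aboveI2)
    fix F :: "(nat \<times> nat) set" assume "F \<in> {F. F \<subseteq> UNIV \<and> finite F}"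
    then have F: "finite F" by simp
    have "sum (\<lambda>(m, n). f m * g n) F \<le> sum (\<lambda>(m, n). f m * g n) (fst ` F \<times> snd ` F)"
      by (rule sum_mono2) (use F f g in \<open>auto intro: rev_image_eqI mult_nonneg_nonneg\<close>)
    also have "\<dots> = sum f (fst ` F) * sum g (snd ` F)"
      by (simp add: sum_product sum.cartesian_product)
    also have "\<dots> \<le> suminf f * suminf g"
      using F f g by (intro mult_mono sum_le_suminf suminf_nonneg sum_nonneg) auto
    finally show "sum (\<lambda>(m, n). f m * g n) F \<le> suminf f * suminf g" .
  qed
qed (use f g in auto)

lemma summable_prod_decode:
  fixes h :: "nat \<times> nat \<Rightarrow> real"
  assumes "h summable_on UNIV"
  shows "summable (\<lambda>i. h (prod_decode i))"
  by (rule summable_on_imp_summable) (use summable_on_reindex_bij_betw[OF bij_prod_decode, of h] assms in simp)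

lemma has_sum_imp_sums_prod_decode:
  fixes h :: "nat \<times> nat \<Rightarrow> 'a::{topological_comm_monoid_add, t2_space}"
  assumes "(h has_sum S) UNIV"
  shows "(\<lambda>i. h (prod_decode i)) sums S"
  by (rule has_sum_imp_sums) (use has_sum_reindex_bij_betw[OF bij_prod_decode, of h] assms in simp)

lemma summable_nat_times_power:
  fixes r :: real
  assumes "0 \<le> r" "r < 1"
  shows "summable (\<lambda>n. real n * r ^ (n - 1))"
proof -
  have "summable (\<lambda>n. real (Suc n) * r ^ (Suc n - 1))"
    using geometric_deriv_sums[of r] assms by (simp add: sums_iff)
  then show ?thesis by (subst (asm) summable_Suc_iff)
qed

text \<open>The coefficients are bounded, so the series and the two series of termwise partial derivatives
  converge uniformly on each smaller bidisc, by comparison with products of geometric series and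
  of their derivatives.\<close>

lemma analytic2_on_power_series:
  fixes c :: "nat \<times> nat \<Rightarrow> complex"
  assumes c: "\<And>i. cmod (c i) \<le> K"
  shows "analytic2_on (\<lambda>(u, v). \<Sum>\<^sub>\<infinity>(m, n). c (m, n) * (u ^ m * v ^ n)) bidisc"
    (is "analytic2_on ?F bidisc")
  unfolding analytic2_on_def
proof (intro conjI ballI)
  show "open bidisc" unfolding bidisc_def by (intro open_Times open_ball)
  have K: "0 \<le> K" using c norm_ge_zero order_trans by blast
  fix p0 assume "p0 \<in> bidisc"
  then have "cmod (fst p0) < 1" "cmod (snd p0) < 1" by (auto simp: bidisc_def)
  then obtain r where r: "cmod (fst p0) < r" "cmod (snd p0) < r" "r < 1"
    using dense[of "max (cmod (fst p0)) (cmod (snd p0))" 1] by auto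
  have r0: "0 \<le> r" using r norm_ge_zero[of "fst p0"] by linarith
  define S :: "(complex \<times> complex) set" where "S = ball 0 r \<times> ball 0 r"
  have S: "open S" "convex S" "p0 \<in> S" unfolding S_def using r by (auto intro!: open_Times convex_Times simp: mem_Times_iff)
  let ?m = "\<lambda>i. fst (prod_decode i)" and ?n = "\<lambda>i. snd (prod_decode i)"
  define f where "f i p = c (prod_decode i) * (fst p ^ ?m i * snd p ^ ?n i)" for i and p :: "complex \<times> complex"
  define A where "A i p = c (prod_decode i) * (of_nat (?m i) * fst p ^ (?m i - 1) * snd p ^ ?n i)" for i and p :: "complex \<times> complex"
  define B where "B i p = c (prod_decode i) * (fst p ^ ?m i * (of_nat (?n i) * snd p ^ (?n i - 1)))" for i and p :: "complex \<times> complex"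
  have geo: "summable (\<lambda>n. r ^ n)" using r r0 by (simp add: summable_geometric)
  have dgeo: "summable (\<lambda>n. real n * r ^ (n - 1))" by (rule summable_nat_times_power[OF r0 r(3)])
  have bound_sum: "summable (\<lambda>i. K * (real (?m i) * r ^ (?m i - 1) * r ^ ?n i))"
    "summable (\<lambda>i. K * (r ^ ?m i * (real (?n i) * r ^ (?n i - 1))))"
    using summable_prod_decode[OF summable_on_prod_mult[OF dgeo _ geo]]
      summable_prod_decode[OF summable_on_prod_mult[OF geo _ dgeo]] r0
    by (auto intro!: summable_mult simp: case_prod_beta)
  have pow: "cmod (fst p) ^ k \<le> r ^ k" "cmod (snd p) ^ k \<le> r ^ k" if "p \<in> S" for p k
    using that by (auto simp: S_def intro!: power_mono)
  have A_le: "norm (A i p) \<le> K * (real (?m i) * r ^ (?m i - 1) * r ^ ?n i)" if "p \<in> S" for i p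
    unfolding A_def norm_mult norm_power norm_of_nat by (intro mult_mono c pow[OF that] order_refl) (use r0 K in auto)
  have B_le: "norm (B i p) \<le> K * (r ^ ?m i * (real (?n i) * r ^ (?n i - 1)))" if "p \<in> S" for i p
    unfolding B_def norm_mult norm_power norm_of_nat by (intro mult_mono c pow[OF that] order_refl) (use r0 K in auto)
  define a where "a p = (\<Sum>i. A i p)" for p
  define b where "b p = (\<Sum>i. B i p)" for p
  have uA: "uniform_limit S (\<lambda>n p. \<Sum>i<n. A i p) a sequentially"
    unfolding a_def[abs_def] by (rule Weierstrass_m_test[OF A_le bound_sum(1)])
  have uB: "uniform_limit S (\<lambda>n p. \<Sum>i<n. B i p) b sequentially"
    unfolding b_def[abs_def] by (rule Weierstrass_m_test[OF B_le bound_sum(2)])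
  have F_sums: "(\<lambda>i. f i p) sums ?F p" if "p \<in> S" for p
  proof -
    let ?h = "\<lambda>(m, n). c (m, n) * (fst p ^ m * snd p ^ n)"
    have "?h summable_on UNIV"
    proof (rule abs_summable_summable, rule Infinite_Sum.abs_summable_on_comparison_test')
      show "(\<lambda>i. K * (case i of (m, n) \<Rightarrow> r ^ m * r ^ n)) summable_on UNIV"
        by (intro summable_on_cmult_right summable_on_prod_mult geo) (use r0 in auto)
      show "norm (?h i) \<le> K * (case i of (m, n) \<Rightarrow> r ^ m * r ^ n)" for i
        by (cases i) (auto simp: norm_mult norm_power intro!: mult_mono c pow[OF that] r0 K zero_le_power)
    qed
    from has_sum_imp_sums_prod_decode[OF has_sum_infsum[OF this]]
    show ?thesis by (simp add: f_def case_prod_beta)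
  qed
  have "\<exists>g. \<forall>p\<in>S. (\<lambda>i. f i p) sums (g p) \<and> (g has_derivative (\<lambda>h. a p * fst h + b p * snd h)) (at p within S)"
  proof (rule has_derivative_series[OF S(2)])
    show "(f i has_derivative (\<lambda>h. A i p * fst h + B i p * snd h)) (at p within S)" for i p
      unfolding f_def[abs_def] A_def B_def
      by (auto intro!: derivative_eq_intros simp: fun_eq_iff algebra_simps)
    show "p0 \<in> S" by (rule S(3))
    show "(\<lambda>i. f i p0) sums ?F p0" by (rule F_sums[OF S(3)])
    fix e :: real assume e: "e > 0"
    have "\<forall>\<^sub>F n in sequentially. (\<forall>p\<in>S. dist (\<Sum>i<n. A i p) (a p) < e / 2) \<and> (\<forall>p\<in>S. dist (\<Sum>i<n. B i p) (b p) < e / 2)"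
      using uniform_limitD[OF uA, of "e / 2"] uniform_limitD[OF uB, of "e / 2"] e by (simp add: eventually_conj_iff)
    then show "\<forall>\<^sub>F n in sequentially. \<forall>p\<in>S. \<forall>h. norm ((\<Sum>i<n. A i p * fst h + B i p * snd h) - (a p * fst h + b p * snd h)) \<le> e * norm h"
    proof eventually_elim
      case (elim n)
      show ?case
      proof (intro ballI allI)
        fix p h assume p: "p \<in> S"
        let ?dA = "(\<Sum>i<n. A i p) - a p" and ?dB = "(\<Sum>i<n. B i p) - b p"
        have "(\<Sum>i<n. A i p * fst h + B i p * snd h) - (a p * fst h + b p * snd h) = ?dA * fst h + ?dB * snd h"
          by (simp add: sum.distrib sum_distrib_right left_diff_distrib)
        also have "norm \<dots> \<le> norm ?dA * norm (fst h) + norm ?dB * norm (snd h)"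
          by (rule order_trans[OF norm_triangle_ineq]) (simp add: norm_mult)
        also have "\<dots> \<le> e / 2 * norm h + e / 2 * norm h"
          using elim p e norm_fst_le[of "fst h" "snd h"] norm_snd_le[of "snd h" "fst h"]
          by (intro add_mono mult_mono) (auto simp: dist_norm less_imp_le)
        finally show "norm ((\<Sum>i<n. A i p * fst h + B i p * snd h) - (a p * fst h + b p * snd h)) \<le> e * norm h" by simp
      qed
    qed
  qed
  then obtain g where g: "\<And>p. p \<in> S \<Longrightarrow> (\<lambda>i. f i p) sums (g p)"
    "\<And>p. p \<in> S \<Longrightarrow> (g has_derivative (\<lambda>h. a p * fst h + b p * snd h)) (at p within S)" by blast
  have gF: "g p = ?F p" if "p \<in> S" for p
    using sums_unique2[OF g(1)[OF that] F_sums[OF that]] .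
  have "(g has_derivative (\<lambda>h. a p0 * fst h + b p0 * snd h)) (at p0)"
    using g(2)[OF S(3)] at_within_open[OF S(3,1)] by simp
  then have "(?F has_derivative (\<lambda>h. a p0 * fst h + b p0 * snd h)) (at p0)"
    by (rule has_derivative_transform_within_open[OF _ S(1,3) gF])
  then show "\<exists>a b. (?F has_derivative (\<lambda>(h, k). a * h + b * k)) (at p0)"
    unfolding case_prod_beta' by blast
qed

section \<open>Monomials on the bidisc\<close>

lemma lborel_complex: "lborel = distr (lborel \<Otimes>\<^sub>M lborel) borel (\<lambda>(x, y). Complex x y)"
proof (rule lborel_eqI)
  have [measurable]: "(\<lambda>p. Complex (fst p) (snd p)) \<in> borel_measurable (lborel \<Otimes>\<^sub>M lborel)"
    unfolding Complex_eq by measurable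
  fix l u :: complex assume le: "\<And>b. b \<in> Basis \<Longrightarrow> l \<bullet> b \<le> u \<bullet> b"
  have lu: "Re l \<le> Re u" "Im l \<le> Im u" using le[of 1] le[of \<i>] by (auto simp: Basis_complex_def)
  have "emeasure (distr (lborel \<Otimes>\<^sub>M lborel) borel (\<lambda>(x, y). Complex x y)) (box l u) =
      emeasure (lborel \<Otimes>\<^sub>M lborel) ({Re l<..<Re u} \<times> {Im l<..<Im u})"
    by (subst emeasure_distr)
       (auto simp: case_prod_beta' in_box_complex_iff space_pair_measure intro!: arg_cong2[where f = emeasure])
  also have "\<dots> = emeasure lborel {Re l<..<Re u} * emeasure lborel {Im l<..<Im u}"
    by (rule lborel.emeasure_pair_measure_Times) auto
  also have "\<dots> = ennreal (\<Prod>b\<in>Basis. (u - l) \<bullet> b)"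
    using lu by (simp add: Basis_complex_def ennreal_mult[symmetric])
  finally show "emeasure (distr (lborel \<Otimes>\<^sub>M lborel) borel (\<lambda>(x, y). Complex x y)) (box l u) = ennreal (\<Prod>b\<in>Basis. (u - l) \<bullet> b)" .
qed simp

lemma nn_integral_complex:
  assumes [measurable]: "f \<in> borel_measurable borel"
  shows "(\<integral>\<^sup>+z. f z \<partial>lborel) = (\<integral>\<^sup>+x. \<integral>\<^sup>+y. f (Complex x y) \<partial>lborel \<partial>lborel)"
    and "(\<integral>\<^sup>+z. f z \<partial>lborel) = (\<integral>\<^sup>+y. \<integral>\<^sup>+x. f (Complex x y) \<partial>lborel \<partial>lborel)"
proof -
  have [measurable]: "(\<lambda>p. Complex (fst p) (snd p)) \<in> borel_measurable (lborel \<Otimes>\<^sub>M lborel)"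
    unfolding Complex_eq by measurable
  have f: "(\<lambda>p. f (Complex (fst p) (snd p))) \<in> borel_measurable (lborel \<Otimes>\<^sub>M lborel)" by measurable
  have eq: "(\<integral>\<^sup>+z. f z \<partial>lborel) = (\<integral>\<^sup>+p. f (Complex (fst p) (snd p)) \<partial>(lborel \<Otimes>\<^sub>M lborel))"
    by (subst lborel_complex) (simp add: nn_integral_distr case_prod_beta')
  show "(\<integral>\<^sup>+z. f z \<partial>lborel) = (\<integral>\<^sup>+x. \<integral>\<^sup>+y. f (Complex x y) \<partial>lborel \<partial>lborel)"
    unfolding eq using lborel.nn_integral_fst[OF f] by simp
  show "(\<integral>\<^sup>+z. f z \<partial>lborel) = (\<integral>\<^sup>+y. \<integral>\<^sup>+x. f (Complex x y) \<partial>lborel \<partial>lborel)"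
    unfolding eq using lborel_pair.nn_integral_snd[OF f] by simp
qed

lemma nn_integral_lborel_translate:
  fixes f :: "real \<Rightarrow> ennreal"
  assumes [measurable]: "f \<in> borel_measurable borel"
  shows "(\<integral>\<^sup>+x. f (x + c) \<partial>lborel) = (\<integral>\<^sup>+x. f x \<partial>lborel)"
proof -
  have "(\<integral>\<^sup>+x. f x \<partial>lborel) = (\<integral>\<^sup>+x. f x \<partial>distr lborel borel ((+) c))" by (simp add: lborel_distr_plus)
  then show ?thesis by (simp add: nn_integral_distr add.commute)
qed

lemma measurable_Complex [measurable (raw)]:
  assumes [measurable]: "f \<in> borel_measurable M" "g \<in> borel_measurable M"
  shows "(\<lambda>x. Complex (f x) (g x)) \<in> borel_measurable M"
  unfolding Complex_eq by measurable

text \<open>Rotations preserve Lebesgue measure, because a rotation other than the half turn is a product of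
  three shears, and a shear preserves it by Fubini and translation invariance on each line.\<close>

lemma nn_integral_rotation:
  assumes f: "f \<in> borel_measurable borel" and e: "cmod e = 1" "Im e \<noteq> 0"
  shows "(\<integral>\<^sup>+z. f (e * z) \<partial>lborel) = (\<integral>\<^sup>+z. f z \<partial>lborel)"
proof -
  have shear1: "(\<integral>\<^sup>+z. g (Complex (Re z + t * Im z) (Im z)) \<partial>lborel) = (\<integral>\<^sup>+z. g z \<partial>lborel)"
    if [measurable]: "g \<in> borel_measurable borel" for g :: "complex \<Rightarrow> ennreal" and t
  proof -
    have "(\<integral>\<^sup>+z. g (Complex (Re z + t * Im z) (Im z)) \<partial>lborel) = (\<integral>\<^sup>+y. \<integral>\<^sup>+x. g (Complex (x + t * y) y) \<partial>lborel \<partial>lborel)"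
      by (subst nn_integral_complex(2)) simp_all
    also have "\<dots> = (\<integral>\<^sup>+y. \<integral>\<^sup>+x. g (Complex x y) \<partial>lborel \<partial>lborel)"
      by (intro nn_integral_cong nn_integral_lborel_translate) measurable
    also have "\<dots> = (\<integral>\<^sup>+z. g z \<partial>lborel)" by (rule nn_integral_complex(2)[symmetric]) measurable
    finally show ?thesis .
  qed
  have shear2: "(\<integral>\<^sup>+z. g (Complex (Re z) (Im z + t * Re z)) \<partial>lborel) = (\<integral>\<^sup>+z. g z \<partial>lborel)"
    if [measurable]: "g \<in> borel_measurable borel" for g :: "complex \<Rightarrow> ennreal" and t
  proof -
    have "(\<integral>\<^sup>+z. g (Complex (Re z) (Im z + t * Re z)) \<partial>lborel) = (\<integral>\<^sup>+x. \<integral>\<^sup>+y. g (Complex x (y + t * x)) \<partial>lborel \<partial>lborel)"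
      by (subst nn_integral_complex(1)) simp_all
    also have "\<dots> = (\<integral>\<^sup>+x. \<integral>\<^sup>+y. g (Complex x y) \<partial>lborel \<partial>lborel)"
      by (intro nn_integral_cong nn_integral_lborel_translate) measurable
    also have "\<dots> = (\<integral>\<^sup>+z. g z \<partial>lborel)" by (rule nn_integral_complex(1)[symmetric]) measurable
    finally show ?thesis .
  qed
  note [measurable] = f
  \<comment> \<open>The slope \<open>t = (c - 1) / s\<close> is minus the tangent of half the angle.\<close>
  define c s t where "c = Re e" and "s = Im e" and "t = (c - 1) / s"
  have s: "s \<noteq> 0" using e by (simp add: s_def)
  have cs: "c * c + s * s = 1"
    using e(1) cmod_power2[of e] by (simp add: c_def s_def power2_eq_square)
  have ts: "t * s = c - 1" using s by (simp add: t_def)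
  have tc: "t * (c + 1) = - s"
  proof -
    have "t * (c + 1) * s = (t * s) * (c + 1)" by simp
    also have "\<dots> = - s * s" unfolding ts using cs by (simp add: algebra_simps)
    finally show ?thesis using s by (simp only: mult_cancel_right) simp
  qed
  let ?T = "\<lambda>z. Complex (Re z + t * Im z) (Im z)" and ?S = "\<lambda>z. Complex (Re z) (Im z + s * Re z)"
  have "e * z = ?T (?S (?T z))" for z
  proof (rule complex_eqI)
    have "Re (?T (?S (?T z))) = (1 + t * s) * Re z + (t * (c + 1) + t * (t * s - (c - 1))) * Im z"
      by (simp add: algebra_simps)
    also have "\<dots> = c * Re z - s * Im z" unfolding ts tc by simp
    finally show "Re (e * z) = Re (?T (?S (?T z)))" by (simp add: c_def s_def)
    have "Im (?T (?S (?T z))) = s * Re z + (1 + t * s) * Im z" by (simp add: algebra_simps)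
    then show "Im (e * z) = Im (?T (?S (?T z)))" unfolding ts by (simp add: c_def s_def)
  qed
  then have "(\<integral>\<^sup>+z. f (e * z) \<partial>lborel) = (\<integral>\<^sup>+z. f (?T (?S (?T z))) \<partial>lborel)" by (simp only:)
  also have "\<dots> = (\<integral>\<^sup>+z. f (?T (?S z)) \<partial>lborel)" by (rule shear1[where g = "\<lambda>z. f (?T (?S z))"]) measurable
  also have "\<dots> = (\<integral>\<^sup>+z. f (?T z) \<partial>lborel)" by (rule shear2[where g = "\<lambda>z. f (?T z)"]) measurable
  also have "\<dots> = (\<integral>\<^sup>+z. f z \<partial>lborel)" by (rule shear1) measurable
  finally show ?thesis .
qed

lemma distr_lborel_rotation:
  assumes "cmod e = 1" "Im e \<noteq> 0"
  shows "distr lborel borel ((*) e) = lborel"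
proof (rule measure_eqI)
  fix A assume "A \<in> sets (distr lborel borel ((*) e))"
  then have A[measurable]: "A \<in> sets borel" by simp
  have "emeasure (distr lborel borel ((*) e)) A = (\<integral>\<^sup>+z. indicator A z \<partial>distr lborel borel ((*) e))" by simp
  also have "\<dots> = (\<integral>\<^sup>+z. indicator A (e * z) \<partial>lborel)" by (rule nn_integral_distr) simp_all
  also have "\<dots> = (\<integral>\<^sup>+z. indicator A z \<partial>lborel)" by (rule nn_integral_rotation[OF _ assms]) simp
  finally show "emeasure (distr lborel borel ((*) e)) A = emeasure lborel A" by simp
qed simp

text \<open>A rotation multiplies the integrand by a phase that is not \<open>1\<close>, and leaves the integral unchanged.\<close>

lemma integral_radial_times_monomial_eq_0:
  fixes g :: "real \<Rightarrow> real"
  assumes [measurable]: "g \<in> borel_measurable borel" and "a \<noteq> b"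
  shows "(LINT z|lborel. of_real (g (cmod z)) * (z ^ a * cnj z ^ b)) = 0"
proof -
  \<comment> \<open>The angle makes the phase \<open>\<i>\<close> or \<open>- \<i>\<close>, and it is below \<open>\<pi>\<close>,
    so that the rotation is no half turn.\<close>
  define \<theta> where "\<theta> = pi / (2 * \<bar>real a - real b\<bar>)"
  define e where "e = cis \<theta>"
  have d: "\<bar>real a - real b\<bar> \<ge> 1" using \<open>a \<noteq> b\<close> by linarith
  then have \<theta>: "0 < \<theta>" "\<theta> < pi" unfolding \<theta>_def by (auto simp: field_simps)
  have e: "cmod e = 1" "Im e \<noteq> 0" using sin_gt_zero[OF \<theta>] by (auto simp: e_def)
  let ?f = "\<lambda>z. complex_of_real (g (cmod z)) * (z ^ a * cnj z ^ b)"
  have fe: "?f (e * z) = (e ^ a * cnj e ^ b) * ?f z" for z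
    using e by (simp add: norm_mult power_mult_distrib mult_ac)
  have "(LINT z|lborel. ?f z) = (LINT z|distr lborel borel ((*) e). ?f z)"
    by (simp only: distr_lborel_rotation[OF e])
  also have "\<dots> = (LINT z|lborel. ?f (e * z))" by (rule integral_distr) measurable
  also have "\<dots> = (e ^ a * cnj e ^ b) * (LINT z|lborel. ?f z)" unfolding fe by simp
  finally have eq: "(LINT z|lborel. ?f z) = (e ^ a * cnj e ^ b) * (LINT z|lborel. ?f z)" .
  have "e ^ a * cnj e ^ b = cis ((real a - real b) * \<theta>)"
    unfolding e_def cis_cnj Complex.DeMoivre cis_mult by (rule arg_cong[where f = cis]) (simp add: left_diff_distrib)
  also have "\<dots> = cis (sgn (real a - real b) * (pi / 2))"
    using d by (intro arg_cong[where f = cis]) (simp add: \<theta>_def sgn_if abs_if field_simps split: if_splits)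
  also have "\<dots> \<noteq> 1"
    using d by (auto simp: sgn_if complex_eq_iff)
  finally show ?thesis using eq by auto
qed

definition disc_weight :: "real \<Rightarrow> complex \<Rightarrow> real" where
  "disc_weight \<alpha> z = indicator (ball 0 1) z * (1 - (cmod z)\<^sup>2) powr \<alpha>"

lemma disc_weight_measurable [measurable]: "disc_weight \<alpha> \<in> borel_measurable borel"
  unfolding disc_weight_def[abs_def]
  by (intro borel_measurable_times borel_measurable_indicator powr_real_measurable borel_measurable_diff
      borel_measurable_power borel_measurable_norm borel_measurable_const) auto

lemma disc_weight_bounds:
  assumes "\<alpha> > 0"
  shows "0 \<le> disc_weight \<alpha> z" "disc_weight \<alpha> z \<le> indicator (ball 0 1) z"
proof -
  have "(1 - (cmod z)\<^sup>2) powr \<alpha> \<le> 1" if "cmod z < 1"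
    using that assms by (intro powr_le1) (auto simp: abs_square_le_1 power_le_one)
  then show "0 \<le> disc_weight \<alpha> z" "disc_weight \<alpha> z \<le> indicator (ball 0 1) z"
    by (auto simp: disc_weight_def split: split_indicator)
qed

lemma integrable_disc_monomial:
  assumes "\<alpha> > 0"
  shows "integrable lborel (\<lambda>z. of_real (disc_weight \<alpha> z) * (z ^ a * cnj z ^ b))"
proof (rule Bochner_Integration.integrable_bound)
  show "integrable lborel (indicator (ball 0 1) :: complex \<Rightarrow> real)"
    using emeasure_ball[of 1 "0::complex"] by (simp add: integrable_indicator_iff)
  show "AE z in lborel. norm (of_real (disc_weight \<alpha> z) * (z ^ a * cnj z ^ b)) \<le> norm (indicator (ball 0 1) z :: real)"
  proof (rule AE_I2)
    fix z :: complex
    have "cmod z ^ a * cmod z ^ b \<le> 1" if "cmod z < 1"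
      using that by (intro mult_le_one power_le_one) auto
    then show "norm (of_real (disc_weight \<alpha> z) * (z ^ a * cnj z ^ b)) \<le> norm (indicator (ball 0 1) z :: real)"
      using disc_weight_bounds[OF assms, of z]
        mult_le_one[of "disc_weight \<alpha> z" "cmod z ^ a * cmod z ^ b"]
      by (cases "cmod z < 1") (auto simp: norm_mult norm_power)
  qed
qed measurable

lemma integral_Beta_lborel:
  fixes \<alpha> :: real
  assumes "\<alpha> > 0"
  shows "has_bochner_integral lborel (\<lambda>t. indicator {0..} t *\<^sub>R (indicator {..<1} t * (t ^ a * (1 - t) powr \<alpha>))) (Beta (real a + 1) (\<alpha> + 1))"
proof -
  let ?f = "\<lambda>t::real. indicator {0..} t *\<^sub>R (indicator {..<1} t * (t ^ a * (1 - t) powr \<alpha>))"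
  have int: "integrable lborel ?f"
  proof (rule Bochner_Integration.integrable_bound)
    show "integrable lborel (indicator {0..1} :: real \<Rightarrow> real)" by (simp add: integrable_indicator_iff)
    show "AE t in lborel. norm (?f t) \<le> norm (indicator {0..1} t :: real)"
    proof (rule AE_I2)
      fix t :: real
      have "t ^ a * (1 - t) powr \<alpha> \<le> 1" if "0 \<le> t" "t < 1"
        using that assms by (intro mult_le_one power_le_one powr_le1) auto
      then show "norm (?f t) \<le> norm (indicator {0..1} t :: real)"
        by (auto simp: abs_mult split: split_indicator)
    qed
  qed measurable
  have "((\<lambda>t. t powr (real a + 1 - 1) * (1 - t) powr (\<alpha> + 1 - 1)) has_integral Beta (real a + 1) (\<alpha> + 1)) {0..1}"
    by (rule has_integral_Beta_real) (use assms in auto)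
  then have "((\<lambda>t. if t \<in> {0..1} then t powr real a * (1 - t) powr \<alpha> else 0) has_integral Beta (real a + 1) (\<alpha> + 1)) UNIV"
    by (subst has_integral_restrict_UNIV) simp
  then have "(?f has_integral Beta (real a + 1) (\<alpha> + 1)) UNIV"
    by (rule has_integral_spike[where S = "{0, 1}", rotated 2])
       (auto simp: powr_realpow split: split_indicator)
  then have "integral\<^sup>L lborel ?f = Beta (real a + 1) (\<alpha> + 1)"
    using has_integral_integral_lborel[OF int] has_integral_unique by blast
  then show ?thesis using int by (simp add: has_bochner_integral_iff)
qed

lemma integral_disc_monomial:
  assumes "\<alpha> > 0"
  shows "(LINT z|lborel. of_real (disc_weight \<alpha> z) * (z ^ a * cnj z ^ b)) =
    (if a = b then of_real (pi * Beta (real a + 1) (\<alpha> + 1)) else 0)"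
proof (cases "a = b")
  case False
  have "disc_weight \<alpha> z = (\<lambda>r. indicator {..<1} r * (1 - r\<^sup>2) powr \<alpha>) (cmod z)" for z
    by (auto simp: disc_weight_def split: split_indicator)
  then show ?thesis
    using False integral_radial_times_monomial_eq_0[of "\<lambda>r. indicator {..<1} r * (1 - r\<^sup>2) powr \<alpha>" a b] by simp
next
  case True
  have "of_real (disc_weight \<alpha> z) * (z ^ a * cnj z ^ b) = complex_of_real (indicator {..<1} ((cmod z)\<^sup>2) * (((cmod z)\<^sup>2) ^ a * (1 - (cmod z)\<^sup>2) powr \<alpha>))" for z
  proof -
    have "z ^ a * cnj z ^ b = of_real (((cmod z)\<^sup>2) ^ a)"
      using True by (simp add: power_mult_distrib[symmetric] complex_norm_square[symmetric])
    moreover have "(cmod z)\<^sup>2 < 1 \<longleftrightarrow> cmod z < 1" by (simp add: abs_square_less_1)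
    ultimately show ?thesis by (simp add: disc_weight_def indicator_def)
  qed
  then have "(LINT z|lborel. of_real (disc_weight \<alpha> z) * (z ^ a * cnj z ^ b)) =
      of_real (LINT z|lborel. indicator {..<1} ((cmod (z::complex))\<^sup>2) * (((cmod z)\<^sup>2) ^ a * (1 - (cmod z)\<^sup>2) powr \<alpha>))"
    by (simp only: integral_complex_of_real)
  also have "\<dots> = of_real (pi * Beta (real a + 1) (\<alpha> + 1))"
    using has_bochner_integral_radial[OF _ integral_Beta_lborel[OF assms, of a]] by (simp add: has_bochner_integral_iff)
  finally show ?thesis using True by simp
qed

lemma space_bergman2 [simp]: "space (meas (bergman2 \<alpha> \<beta>)) = bidisc"
  by (simp add: bergman2_def mu_weight_def space_restrict_space)

lemma open_bidisc: "open bidisc"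
  unfolding bidisc_def by (intro open_Times open_ball)

lemma meas_bergman2: "meas (bergman2 \<alpha> \<beta>) = density (restrict_space lborel bidisc) (\<lambda>p. ennreal (disc_weight \<alpha> (fst p) * disc_weight \<beta> (snd p)))"
proof -
  have "density (restrict_space lborel bidisc) (\<lambda>(z, w). ennreal ((1 - (cmod z)\<^sup>2) powr \<alpha> * (1 - (cmod w)\<^sup>2) powr \<beta>)) =
      density (restrict_space lborel bidisc) (\<lambda>p. ennreal (disc_weight \<alpha> (fst p) * disc_weight \<beta> (snd p)))"
  proof (rule density_cong)
    have [measurable]: "(\<lambda>p. p) \<in> measurable (restrict_space lborel bidisc) (borel \<Otimes>\<^sub>M borel)"
      by (rule measurable_restrict_space1) (simp add: borel_prod)
    have "(\<lambda>p. ennreal ((1 - (cmod (fst p))\<^sup>2) powr \<alpha> * (1 - (cmod (snd p))\<^sup>2) powr \<beta>)) \<in> borel_measurable (restrict_space lborel bidisc)"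
      by measurable
    then show "(\<lambda>(z, w). ennreal ((1 - (cmod z)\<^sup>2) powr \<alpha> * (1 - (cmod w)\<^sup>2) powr \<beta>)) \<in> borel_measurable (restrict_space lborel bidisc)"
      by (simp only: case_prod_beta')
    show "(\<lambda>p. ennreal (disc_weight \<alpha> (fst p) * disc_weight \<beta> (snd p))) \<in> borel_measurable (restrict_space lborel bidisc)"
      by measurable
    show "AE p in restrict_space lborel bidisc. (case p of (z, w) \<Rightarrow> ennreal ((1 - (cmod z)\<^sup>2) powr \<alpha> * (1 - (cmod w)\<^sup>2) powr \<beta>)) = ennreal (disc_weight \<alpha> (fst p) * disc_weight \<beta> (snd p))"
      by (rule AE_I2) (auto simp: space_restrict_space bidisc_def disc_weight_def)
  qed
  then show ?thesis by (simp add: bergman2_def mu_weight_def)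
qed

lemma borel_measurable_bergman2:
  fixes f :: "complex \<times> complex \<Rightarrow> 'a::topological_space"
  assumes "continuous_on bidisc f"
  shows "f \<in> borel_measurable (meas (bergman2 \<alpha> \<beta>))"
proof -
  have "sets (restrict_space lborel bidisc) = sets (restrict_space borel bidisc)"
    by (rule sets_restrict_space_cong) simp
  then have "f \<in> borel_measurable (meas (bergman2 \<alpha> \<beta>)) \<longleftrightarrow> f \<in> borel_measurable (restrict_space borel bidisc)"
    by (intro arg_cong[where f = "\<lambda>A. f \<in> A"] measurable_cong_sets) (simp_all add: meas_bergman2)
  then show ?thesis using borel_measurable_continuous_on_restrict[OF assms] by (simp only:)
qed

lemma integral_lborel_product:
  fixes f g :: "complex \<Rightarrow> complex"
  assumes f: "integrable lborel f" and g: "integrable lborel g"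
  shows "integrable lborel (\<lambda>p. f (fst p) * g (snd p))"
    and "(LINT p|lborel. f (fst p) * g (snd p)) = (LINT x|lborel. f x) * (LINT y|lborel. g y)"
proof -
  note [measurable] = borel_measurable_integrable[OF f] borel_measurable_integrable[OF g]
  have int: "integrable (lborel \<Otimes>\<^sub>M lborel) (\<lambda>p. f (fst p) * g (snd p))"
  proof (rule lborel_pair.Fubini_integrable)
    show "(\<lambda>p. f (fst p) * g (snd p)) \<in> borel_measurable (lborel \<Otimes>\<^sub>M lborel)" by measurable
    have "integrable lborel (\<lambda>x. norm (f x) * (LINT y|lborel. norm (g y)))"
      using f by (intro integrable_mult_left integrable_norm)
    then show "integrable lborel (\<lambda>x. LINT y|lborel. norm (f (fst (x, y)) * g (snd (x, y))))"
      by (simp add: norm_mult)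
    show "AE x in lborel. integrable lborel (\<lambda>y. f (fst (x, y)) * g (snd (x, y)))"
      using g by (intro AE_I2) simp
  qed
  then show "integrable lborel (\<lambda>p. f (fst p) * g (snd p))" by (simp add: lborel_prod)
  have "(LINT p|lborel. f (fst p) * g (snd p)) = (LINT p|(lborel \<Otimes>\<^sub>M lborel). f (fst p) * g (snd p))"
    by (simp add: lborel_prod)
  also have "\<dots> = (LINT x|lborel. LINT y|lborel. f x * g y)"
    using lborel_pair.integral_fst'[OF int] by simp
  finally show "(LINT p|lborel. f (fst p) * g (snd p)) = (LINT x|lborel. f x) * (LINT y|lborel. g y)" by simp
qed

definition monomial :: "nat \<times> nat \<Rightarrow> complex \<times> complex \<Rightarrow> complex" where
  "monomial = (\<lambda>(m, n) (u, v). u ^ m * v ^ n)"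

lemma continuous_on_monomial: "continuous_on S (monomial i)"
proof -
  have "monomial i = (\<lambda>p. fst p ^ fst i * snd p ^ snd i)" by (simp add: monomial_def fun_eq_iff split: prod.split)
  then show ?thesis by (simp only:) (intro continuous_intros)
qed

lemma integral_bergman2:
  fixes f :: "complex \<times> complex \<Rightarrow> complex"
  assumes "\<alpha> > 0" "\<beta> > 0" and f: "f \<in> borel_measurable (meas (bergman2 \<alpha> \<beta>))"
    and eq: "\<And>p. of_real (disc_weight \<alpha> (fst p) * disc_weight \<beta> (snd p)) * f p = g p"
  shows "integrable (meas (bergman2 \<alpha> \<beta>)) f \<longleftrightarrow> integrable lborel g"
    and "(LINT p|meas (bergman2 \<alpha> \<beta>). f p) = (LINT p|lborel. g p)"
proof -
  let ?R = "restrict_space lborel bidisc"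
  let ?w = "\<lambda>p. disc_weight \<alpha> (fst p) * disc_weight \<beta> (snd p)"
  have [measurable]: "(\<lambda>p. p) \<in> measurable ?R (borel \<Otimes>\<^sub>M borel)"
    by (rule measurable_restrict_space1) (simp add: borel_prod)
  have w: "?w \<in> borel_measurable ?R" by measurable
  have f': "f \<in> borel_measurable ?R" using f by (simp add: meas_bergman2)
  have w0: "AE p in ?R. 0 \<le> ?w p" by (rule AE_I2) (simp add: disc_weight_bounds assms)
  have B: "bidisc \<inter> space lborel \<in> sets lborel" using open_bidisc by simp
  have out: "indicator bidisc p *\<^sub>R (?w p *\<^sub>R f p) = g p" for p
    unfolding eq[symmetric]
    by (cases p) (auto simp: bidisc_def disc_weight_def scaleR_conv_of_real split: split_indicator)
  have "integrable (meas (bergman2 \<alpha> \<beta>)) f \<longleftrightarrow> integrable ?R (\<lambda>p. ?w p *\<^sub>R f p)"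
    unfolding meas_bergman2 by (rule integrable_density[OF f' w w0])
  also have "\<dots> \<longleftrightarrow> integrable lborel (\<lambda>p. indicator bidisc p *\<^sub>R (?w p *\<^sub>R f p))"
    by (rule integrable_restrict_space[OF B])
  finally show "integrable (meas (bergman2 \<alpha> \<beta>)) f \<longleftrightarrow> integrable lborel g" by (simp only: out)
  have "(LINT p|meas (bergman2 \<alpha> \<beta>). f p) = (LINT p|?R. ?w p *\<^sub>R f p)"
    unfolding meas_bergman2 by (rule integral_density[OF f' w w0])
  also have "\<dots> = (LINT p|lborel. indicator bidisc p *\<^sub>R (?w p *\<^sub>R f p))"
    by (rule integral_restrict_space[OF B])
  finally show "(LINT p|meas (bergman2 \<alpha> \<beta>). f p) = (LINT p|lborel. g p)" by (simp only: out)
qed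

lemma inner_prod_monomial:
  assumes \<alpha>: "\<alpha> > 0" and \<beta>: "\<beta> > 0"
  shows "integrable (meas (bergman2 \<alpha> \<beta>)) (\<lambda>p. monomial (m, n) p * cnj (monomial (k, l) p))"
    and "inner_prod (bergman2 \<alpha> \<beta>) (monomial (m, n)) (monomial (k, l)) =
      (if m = k \<and> n = l then of_real (pi\<^sup>2 * (Beta (real m + 1) (\<alpha> + 1) * Beta (real n + 1) (\<beta> + 1))) else 0)"
proof -
  let ?F = "\<lambda>z. of_real (disc_weight \<alpha> z) * (z ^ m * cnj z ^ k)"
  let ?G = "\<lambda>z. of_real (disc_weight \<beta> z) * (z ^ n * cnj z ^ l)"
  have meas: "(\<lambda>p. monomial (m, n) p * cnj (monomial (k, l) p)) \<in> borel_measurable (meas (bergman2 \<alpha> \<beta>))"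
    by (intro borel_measurable_bergman2 continuous_intros continuous_on_monomial)
  have eq: "of_real (disc_weight \<alpha> (fst p) * disc_weight \<beta> (snd p)) * (monomial (m, n) p * cnj (monomial (k, l) p)) = ?F (fst p) * ?G (snd p)" for p
    by (cases p) (simp add: monomial_def)
  note int = integral_bergman2[OF \<alpha> \<beta> meas eq]
  note prod = integral_lborel_product[OF integrable_disc_monomial[OF \<alpha>] integrable_disc_monomial[OF \<beta>]]
  show "integrable (meas (bergman2 \<alpha> \<beta>)) (\<lambda>p. monomial (m, n) p * cnj (monomial (k, l) p))"
    unfolding int(1) by (rule prod(1))
  show "inner_prod (bergman2 \<alpha> \<beta>) (monomial (m, n)) (monomial (k, l)) =
      (if m = k \<and> n = l then of_real (pi\<^sup>2 * (Beta (real m + 1) (\<alpha> + 1) * Beta (real n + 1) (\<beta> + 1))) else 0)"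
    unfolding inner_prod_def int(2) prod(2) integral_disc_monomial[OF \<alpha>] integral_disc_monomial[OF \<beta>]
    by (simp add: power2_eq_square)
qed

lemma monomial_square_integrable:
  assumes "\<alpha> > 0" "\<beta> > 0"
  shows "monomial i \<in> square_integrable (meas (bergman2 \<alpha> \<beta>))"
proof (cases i)
  case (Pair m n)
  have "(\<lambda>p. complex_of_real ((cmod (monomial i p))\<^sup>2)) = (\<lambda>p. monomial i p * cnj (monomial i p))"
    by (simp only: complex_norm_square)
  then have "integrable (meas (bergman2 \<alpha> \<beta>)) (\<lambda>p. complex_of_real ((cmod (monomial i p))\<^sup>2))"
    using inner_prod_monomial(1)[OF assms, of m n m n] by (simp only: Pair)
  then have "integrable (meas (bergman2 \<alpha> \<beta>)) (\<lambda>p. (cmod (monomial i p))\<^sup>2)"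
    by (simp only: complex_of_real_integrable_eq)
  then show ?thesis
    unfolding square_integrable_def
    by (simp add: borel_measurable_bergman2 continuous_on_monomial)
qed

section \<open>The transform on the Hermite basis\<close>

lemma one_minus_mult_disc:
  fixes u v :: complex
  assumes "cmod u < 1" "cmod v < 1"
  shows "1 - u * v \<noteq> 0" "Re (1 / (1 - u * v)) > 1 / 2"
proof -
  have uv: "cmod (u * v) < 1"
    unfolding norm_mult using mult_strict_mono'[OF assms] by simp
  then show nz: "1 - u * v \<noteq> 0" by auto
  define q where "q = u * v"
  have "(cmod (1 - q))\<^sup>2 = 1 - 2 * Re q + (cmod q)\<^sup>2"
    unfolding cmod_power2 by (simp add: power2_eq_square algebra_simps)
  moreover have "(cmod q)\<^sup>2 < 1" using uv by (simp add: q_def abs_square_less_1)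
  ultimately have "(cmod (1 - q))\<^sup>2 < 2 * (1 - Re q)" by simp
  moreover have "(cmod (1 - q))\<^sup>2 > 0" using nz by (simp add: q_def)
  ultimately have "1 / 2 < (1 - Re q) / (cmod (1 - q))\<^sup>2" by (simp add: field_simps)
  also have "(1 - Re q) / (cmod (1 - q))\<^sup>2 = Re (1 / (1 - q))"
    by (simp add: Re_divide cmod_power2)
  finally show "Re (1 / (1 - u * v)) > 1 / 2" by (simp add: q_def)
qed

context
  fixes \<nu> :: real and u v w :: complex
  assumes \<nu>: "\<nu> > 0" and uv: "cmod u < 1" "cmod v < 1"
begin

text \<open>As a function of \<open>z\<close>, the kernel is a constant \<open>kernel_factor\<close> times the exponential of a linear
  form in \<open>z\<close> and its conjugate times a Gaussian of complex rate \<open>kernel_rate\<close>.\<close>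

definition "kernel_rate = of_real \<nu> * (u * v) / (1 - u * v)"
definition "kernel_holo = of_real \<nu> * v * cnj w / (1 - u * v)"
definition "kernel_anti = of_real \<nu> * u * w / (1 - u * v)"
definition "kernel_factor = of_real \<nu> / (of_real pi * (1 - u * v)) * exp (- kernel_rate * of_real ((cmod w)\<^sup>2))"

lemma kernel_K_eq:
  "kernel_K \<nu> u v z w = kernel_factor * exp (kernel_holo * z + kernel_anti * cnj z) * gaussian kernel_rate z"
proof -
  have "of_real \<nu> / (1 - u * v) * (- (u * v) * of_real ((cmod z)\<^sup>2 + (cmod w)\<^sup>2) + u * cnj z * w + v * z * cnj w) =
      - kernel_rate * of_real ((cmod w)\<^sup>2) + (kernel_holo * z + kernel_anti * cnj z) + - kernel_rate * of_real ((cmod z)\<^sup>2)"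
    unfolding kernel_rate_def kernel_holo_def kernel_anti_def
    by (simp add: divide_inverse algebra_simps)
  then show ?thesis
    unfolding kernel_K_def kernel_factor_def gaussian_def by (simp only: exp_add mult.assoc)
qed

lemma kernel_rate_plus: "kernel_rate + of_real \<nu> = of_real \<nu> * (1 / (1 - u * v))"
  using one_minus_mult_disc(1)[OF uv] by (simp add: kernel_rate_def field_simps)

text \<open>The image of the unit disc under \<open>q \<mapsto> 1 / (1 - q)\<close> is the half plane of real part above \<open>1/2\<close>. This is
  just enough for the kernel to be square integrable.\<close>

lemma Re_kernel_rate: "Re (kernel_rate + of_real \<nu>) > \<nu> / 2"
proof -
  have "Re (of_real \<nu> * x) = \<nu> * Re x" for x by simp
  then show ?thesis
    unfolding kernel_rate_plus using mult_strict_left_mono[OF one_minus_mult_disc(2)[OF uv] \<nu>] by (simp only:)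
qed

lemma kernel_continuous: "continuous_on UNIV (\<lambda>z. kernel_K \<nu> u v z w)"
  unfolding kernel_K_eq by (intro continuous_intros)

lemma kernel_measurable: "(\<lambda>z. kernel_K \<nu> u v z w) \<in> borel_measurable borel"
  by (rule borel_measurable_continuous_onI[OF kernel_continuous])

lemma kernel_square_integrable: "(\<lambda>z. cnj (kernel_K \<nu> u v z w)) \<in> square_integrable (meas (L2_gauss \<nu>))"
proof -
  let ?E = "\<lambda>z. kernel_factor * exp (kernel_holo * z + kernel_anti * cnj z)"
  have "exp_growth (\<lambda>z. ?E z * ?E z)" by (intro exp_growth_intros)
  moreover have "2 * Re kernel_rate + \<nu> > 0" using Re_kernel_rate by simp
  ultimately have "integrable lborel (\<lambda>z. cmod (?E z * ?E z) * exp (- (2 * Re kernel_rate + \<nu>) * (cmod z)\<^sup>2))"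
    by (rule integrable_exp_growth_real)
  moreover have "cmod (?E z * ?E z) * exp (- (2 * Re kernel_rate + \<nu>) * (cmod z)\<^sup>2) =
      exp (- \<nu> * (cmod z)\<^sup>2) *\<^sub>R (cmod (cnj (kernel_K \<nu> u v z w)))\<^sup>2" for z
  proof -
    have "exp (- (2 * Re kernel_rate + \<nu>) * (cmod z)\<^sup>2) = exp (- \<nu> * (cmod z)\<^sup>2) * (exp (- Re kernel_rate * (cmod z)\<^sup>2))\<^sup>2"
      unfolding exp_double[symmetric] exp_add[symmetric] by (rule arg_cong[where f = exp]) (simp add: algebra_simps)
    then show ?thesis
      unfolding complex_mod_cnj kernel_K_eq by (simp add: norm_mult cmod_gaussian power_mult_distrib power2_eq_square mult_ac)
  qed
  ultimately have "integrable (meas (L2_gauss \<nu>)) (\<lambda>z. (cmod (cnj (kernel_K \<nu> u v z w)))\<^sup>2)"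
    by (subst integrable_L2_gauss_iff) (use kernel_measurable in simp_all)
  then show ?thesis
    unfolding square_integrable_def using kernel_measurable by (simp add: borel_measurable_cnj)
qed

lemma transform_R_eq_inner_prod:
  assumes "f \<in> square_integrable (meas (L2_gauss \<nu>))"
  shows "transform_R \<nu> w f (u, v) = inner_prod (L2_gauss \<nu>) f (\<lambda>z. cnj (kernel_K \<nu> u v z w))"
proof -
  have [measurable]: "f \<in> borel_measurable borel" using square_integrable_measurable[OF assms] by simp
  note [measurable] = kernel_measurable
  show ?thesis
    by (subst inner_prod_L2_gauss) (simp_all add: transform_R_def gauss_int_def gaussian_of_real)
qed

text \<open>Here the Hermite polynomials become eigenfunctions: integration by parts against the kernel
  gives recursions in \<open>m\<close> and \<open>n\<close> for the integrals \<open>F m n\<close>, and these are the recursions of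
  the right hand side.\<close>

lemma inner_prod_hermite_kernel:
  "inner_prod (L2_gauss \<nu>) (hermite \<nu> m n) (\<lambda>z. cnj (kernel_K \<nu> u v z w)) = u ^ m * v ^ n * hermite \<nu> m n w"
proof -
  define \<gamma> where "\<gamma> = kernel_rate + of_real \<nu>"
  define E where "E z = exp (kernel_holo * z + kernel_anti * cnj z)" for z
  define F where "F m n = gauss_int \<gamma> (\<lambda>z. hermite \<nu> m n z * E z)" for m n
  have q: "1 - u * v \<noteq> 0" by (rule one_minus_mult_disc(1)[OF uv])
  have \<gamma>: "Re \<gamma> > 0" unfolding \<gamma>_def using Re_kernel_rate \<nu> by linarith
  have \<gamma>_eq: "\<gamma> = of_real \<nu> / (1 - u * v)" unfolding \<gamma>_def kernel_rate_plus by simp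
  \<comment> \<open>Multiplication by \<open>1 - u v\<close> turns the rate \<open>\<gamma>\<close> of the combined Gaussian into \<open>\<nu>\<close>, and
    the linear coefficients of the kernel into multiples of \<open>u\<close> and \<open>v\<close>.\<close>
  have \<nu>_eq: "of_real \<nu> = (1 - u * v) * \<gamma>" using q by (simp add: \<gamma>_eq)
  have \<nu>_anti: "(1 - u * v) * kernel_anti = of_real \<nu> * u * w" and \<nu>_holo: "(1 - u * v) * kernel_holo = of_real \<nu> * v * cnj w"
    using q by (simp_all add: kernel_anti_def kernel_holo_def)
  have gE: "exp_growth E" unfolding E_def[abs_def] by (rule exp_growth_exp_linear)
  note g = exp_growth_intros exp_growth_hermite gE
  have DE: "has_wirtinger E (kernel_holo * E z) (kernel_anti * E z) z" for z
    unfolding E_def[abs_def] by (rule has_wirtinger_exp_linear)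
  note parts = gauss_int_by_parts[OF \<gamma> has_wirtinger_mult[OF has_wirtinger_hermite DE]]
  have z: "of_real \<nu> * gauss_int \<gamma> (\<lambda>z. z * (hermite \<nu> m n z * E z)) =
      (1 - u * v) * (of_real \<nu> * of_nat n) * F m (n - 1) + of_real \<nu> * u * w * F m n" for m n
  proof -
    have "\<gamma> * gauss_int \<gamma> (\<lambda>z. z * (hermite \<nu> m n z * E z)) =
        gauss_int \<gamma> (\<lambda>z. of_real \<nu> * of_nat n * hermite \<nu> m (n - 1) z * E z + hermite \<nu> m n z * (kernel_anti * E z))"
      by (rule parts(1)) (intro g)+
    also have "\<dots> = gauss_int \<gamma> (\<lambda>z. (of_real \<nu> * of_nat n) * (hermite \<nu> m (n - 1) z * E z) + kernel_anti * (hermite \<nu> m n z * E z))"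
      by (simp only: mult_ac)
    also have "\<dots> = (of_real \<nu> * of_nat n) * F m (n - 1) + kernel_anti * F m n"
      unfolding F_def by (subst gauss_int_add, (intro g \<gamma>)+) (simp only: gauss_int_scale)
    finally have "(1 - u * v) * \<gamma> * gauss_int \<gamma> (\<lambda>z. z * (hermite \<nu> m n z * E z)) =
        (1 - u * v) * (of_real \<nu> * of_nat n) * F m (n - 1) + ((1 - u * v) * kernel_anti) * F m n"
      by (simp only: distrib_left mult.assoc)
    then show ?thesis unfolding \<nu>_anti \<nu>_eq[symmetric] .
  qed
  have zbar: "of_real \<nu> * gauss_int \<gamma> (\<lambda>z. cnj z * (hermite \<nu> m n z * E z)) =
      (1 - u * v) * (of_real \<nu> * of_nat m) * F (m - 1) n + of_real \<nu> * v * cnj w * F m n" for m n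
  proof -
    have "\<gamma> * gauss_int \<gamma> (\<lambda>z. cnj z * (hermite \<nu> m n z * E z)) =
        gauss_int \<gamma> (\<lambda>z. of_real \<nu> * of_nat m * hermite \<nu> (m - 1) n z * E z + hermite \<nu> m n z * (kernel_holo * E z))"
      by (rule parts(2)) (intro g)+
    also have "\<dots> = gauss_int \<gamma> (\<lambda>z. (of_real \<nu> * of_nat m) * (hermite \<nu> (m - 1) n z * E z) + kernel_holo * (hermite \<nu> m n z * E z))"
      by (simp only: mult_ac)
    also have "\<dots> = (of_real \<nu> * of_nat m) * F (m - 1) n + kernel_holo * F m n"
      unfolding F_def by (subst gauss_int_add, (intro g \<gamma>)+) (simp only: gauss_int_scale)
    finally have "(1 - u * v) * \<gamma> * gauss_int \<gamma> (\<lambda>z. cnj z * (hermite \<nu> m n z * E z)) =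
        (1 - u * v) * (of_real \<nu> * of_nat m) * F (m - 1) n + ((1 - u * v) * kernel_holo) * F m n"
      by (simp only: distrib_left mult.assoc)
    then show ?thesis unfolding \<nu>_holo \<nu>_eq[symmetric] .
  qed
  have Suc_left: "F (Suc m) n = u * (of_real \<nu> * w * F m n - of_real \<nu> * of_nat n * v * F m (n - 1))" for m n
  proof -
    have "F (Suc m) n = gauss_int \<gamma> (\<lambda>z. of_real \<nu> * (z * (hermite \<nu> m n z * E z)) - (of_real \<nu> * of_nat n) * (hermite \<nu> m (n - 1) z * E z))"
      unfolding F_def by (simp only: hermite.simps left_diff_distrib mult.assoc)
    also have "\<dots> = of_real \<nu> * gauss_int \<gamma> (\<lambda>z. z * (hermite \<nu> m n z * E z)) - (of_real \<nu> * of_nat n) * F m (n - 1)"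
      unfolding F_def by (subst gauss_int_diff, (intro g \<gamma>)+) (simp only: gauss_int_scale)
    finally show ?thesis unfolding z by (simp add: algebra_simps)
  qed
  have Suc_right: "F 0 (Suc n) = v * (of_real \<nu> * cnj w * F 0 n)" for n
  proof -
    have "F 0 (Suc n) = gauss_int \<gamma> (\<lambda>z. of_real \<nu> * (cnj z * (hermite \<nu> 0 n z * E z)))"
      unfolding F_def hermite_Suc_right by (simp add: mult.assoc)
    also have "\<dots> = of_real \<nu> * gauss_int \<gamma> (\<lambda>z. cnj z * (hermite \<nu> 0 n z * E z))" by (rule gauss_int_scale)
    finally show ?thesis unfolding zbar by simp
  qed
  have F00: "kernel_factor * F 0 0 = 1"
  proof -
    have ne: "of_real \<nu> \<noteq> (0::complex)" using \<nu> by simp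
    have "kernel_holo * kernel_anti / \<gamma> = kernel_rate * of_real ((cmod w)\<^sup>2)"
      unfolding \<gamma>_eq kernel_holo_def kernel_anti_def kernel_rate_def complex_norm_square using q ne
      by (simp add: divide_simps)
    then have F: "F 0 0 = of_real pi / \<gamma> * exp (kernel_rate * of_real ((cmod w)\<^sup>2))"
      using gauss_int_exp_linear[OF \<gamma>, of kernel_holo kernel_anti] by (simp add: F_def E_def)
    have e: "exp (- kernel_rate * of_real ((cmod w)\<^sup>2)) * exp (kernel_rate * of_real ((cmod w)\<^sup>2)) = 1"
      unfolding exp_add[symmetric] by simp
    have "kernel_factor * F 0 0 = of_real \<nu> / (of_real pi * (1 - u * v)) * (of_real pi / \<gamma>) *
        (exp (- kernel_rate * of_real ((cmod w)\<^sup>2)) * exp (kernel_rate * of_real ((cmod w)\<^sup>2)))"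
      unfolding kernel_factor_def F by (simp only: mult_ac)
    then show ?thesis unfolding e \<gamma>_eq using q ne by (simp add: divide_simps)
  qed
  have base: "kernel_factor * F 0 n = v ^ n * hermite \<nu> 0 n w" for n
  proof (induction n)
    case (Suc n)
    have "kernel_factor * F 0 (Suc n) = v * of_real \<nu> * cnj w * (kernel_factor * F 0 n)"
      unfolding Suc_right by (simp only: mult_ac)
    then show ?case unfolding Suc by (simp add: mult_ac)
  qed (simp add: F00)
  have main: "kernel_factor * F m n = u ^ m * v ^ n * hermite \<nu> m n w" for m n
  proof (induction m arbitrary: n)
    case (Suc m)
    have v: "of_nat n * v * v ^ (n - 1) = of_nat n * v ^ n" by (cases n) auto
    have "kernel_factor * F (Suc m) n =
        u * (of_real \<nu> * w * (kernel_factor * F m n) - of_real \<nu> * of_nat n * v * (kernel_factor * F m (n - 1)))"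
      unfolding Suc_left by (simp add: algebra_simps)
    also have "\<dots> = u * u ^ m * (of_real \<nu> * w * v ^ n * hermite \<nu> m n w - of_real \<nu> * (of_nat n * v * v ^ (n - 1)) * hermite \<nu> m (n - 1) w)"
      unfolding Suc by (simp add: algebra_simps)
    also have "\<dots> = u ^ Suc m * v ^ n * hermite \<nu> (Suc m) n w"
      unfolding v by (simp add: algebra_simps)
    finally show ?case .
  qed (use base in simp)
  have "inner_prod (L2_gauss \<nu>) (hermite \<nu> m n) (\<lambda>z. cnj (kernel_K \<nu> u v z w)) =
      gauss_int (of_real \<nu>) (\<lambda>z. hermite \<nu> m n z * kernel_K \<nu> u v z w)"
    by (subst inner_prod_L2_gauss)
       (simp_all add: exp_growth_measurable exp_growth_hermite kernel_measurable borel_measurable_cnj)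
  also have "\<dots> = gauss_int \<gamma> (\<lambda>z. kernel_factor * (hermite \<nu> m n z * E z))"
    unfolding gauss_int_def
  proof (rule Bochner_Integration.integral_cong[OF refl])
    fix z
    have prod: "gaussian kernel_rate z * gaussian (of_real \<nu>) z = gaussian \<gamma> z"
      unfolding gaussian_def exp_add[symmetric] \<gamma>_def by (simp add: algebra_simps)
    show "hermite \<nu> m n z * kernel_K \<nu> u v z w * gaussian (of_real \<nu>) z = kernel_factor * (hermite \<nu> m n z * E z) * gaussian \<gamma> z"
      unfolding prod[symmetric] kernel_K_eq E_def by (simp only: mult_ac)
  qed
  also have "\<dots> = kernel_factor * F m n" unfolding F_def by (rule gauss_int_scale)
  finally show ?thesis by (simp only: main)
qed

lemma inner_prod_basis_kernel:
  "inner_prod (L2_gauss \<nu>) (hermite_basis \<nu> i) (\<lambda>z. cnj (kernel_K \<nu> u v z w)) = monomial i (u, v) * hermite_basis \<nu> i w"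
proof (cases i)
  case (Pair m n)
  have "hermite_basis \<nu> i = (\<lambda>z. (1 / of_real (hermite_norm \<nu> m n)) * hermite \<nu> m n z)"
    by (simp add: Pair hermite_basis_def)
  then have "inner_prod (L2_gauss \<nu>) (hermite_basis \<nu> i) (\<lambda>z. cnj (kernel_K \<nu> u v z w)) =
      (1 / of_real (hermite_norm \<nu> m n)) * (u ^ m * v ^ n * hermite \<nu> m n w)"
    by (simp only: inner_prod_scale_left inner_prod_hermite_kernel)
  then show ?thesis by (simp add: Pair hermite_basis_def monomial_def)
qed

lemma monomial_summable:
  "(\<lambda>i. cmod (monomial i (u, v))) summable_on UNIV" "(\<lambda>i. (cmod (monomial i (u, v)))\<^sup>2) summable_on UNIV"
proof -
  have "(\<lambda>(m, n). cmod u ^ m * cmod v ^ n) summable_on UNIV"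
    by (rule summable_on_prod_mult) (use uv in \<open>auto intro: summable_geometric\<close>)
  moreover have "(\<lambda>(m, n). cmod u ^ m * cmod v ^ n) = (\<lambda>i. cmod (monomial i (u, v)))"
    by (auto simp: monomial_def fun_eq_iff norm_mult norm_power)
  ultimately show 1: "(\<lambda>i. cmod (monomial i (u, v))) summable_on UNIV" by simp
  have "cmod (monomial i (u, v)) \<le> 1" for i
    using uv by (cases i) (auto simp: monomial_def norm_mult norm_power intro!: mult_le_one power_le_one)
  then show "(\<lambda>i. (cmod (monomial i (u, v)))\<^sup>2) summable_on UNIV"
    by (intro summable_on_comparison_test[OF 1]) (auto simp: power2_eq_square intro: mult_left_le)
qed

text \<open>The kernel is square integrable and its Hermite coefficients are known, hence by completeness it
  agrees almost everywhere with its Hermite series, and the transform of \<open>f\<close> is the termwise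
  pairing with \<open>f\<close>. The pointwise (Mehler) expansion of the kernel is thereby avoided.\<close>

lemma transform_R_series:
  assumes f: "f \<in> square_integrable (meas (L2_gauss \<nu>))"
  shows "transform_R \<nu> w f (u, v) =
    (\<Sum>\<^sub>\<infinity>i. hermite_basis \<nu> i w * inner_prod (L2_gauss \<nu>) f (hermite_basis \<nu> i) * monomial i (u, v))"
proof -
  let ?X = "L2_gauss \<nu>" and ?e = "hermite_basis \<nu>" and ?k = "\<lambda>z. cnj (kernel_K \<nu> u v z w)"
  define b where "b i = cnj (monomial i (u, v) * ?e i w)" for i
  have e_le: "cmod (?e i z) \<le> sqrt (\<nu> / pi * exp (\<nu> * (cmod z)\<^sup>2))" for i z
    by (rule real_le_rsqrt[OF hermite_basis_bound[OF \<nu>]])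
  have b2: "(\<lambda>i. (cmod (b i))\<^sup>2) summable_on UNIV"
  proof (rule summable_on_comparison_test[OF summable_on_cmult_left[OF monomial_summable(2), of "\<nu> / pi * exp (\<nu> * (cmod w)\<^sup>2)"]])
    show "(cmod (b i))\<^sup>2 \<le> (cmod (monomial i (u, v)))\<^sup>2 * (\<nu> / pi * exp (\<nu> * (cmod w)\<^sup>2))" for i
      unfolding b_def complex_mod_cnj norm_mult power_mult_distrib
      by (rule mult_left_mono[OF hermite_basis_bound[OF \<nu>]]) simp
  qed simp
  have b_pt: "(\<lambda>i. cmod (b i * ?e i z)) summable_on UNIV" for z
  proof (rule summable_on_comparison_test[OF summable_on_cmult_left[OF monomial_summable(1),
          of "sqrt (\<nu> / pi * exp (\<nu> * (cmod w)\<^sup>2)) * sqrt (\<nu> / pi * exp (\<nu> * (cmod z)\<^sup>2))"]])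
    show "cmod (b i * ?e i z) \<le> cmod (monomial i (u, v)) * (sqrt (\<nu> / pi * exp (\<nu> * (cmod w)\<^sup>2)) * sqrt (\<nu> / pi * exp (\<nu> * (cmod z)\<^sup>2)))" for i
      unfolding b_def norm_mult complex_mod_cnj mult.assoc
      by (intro mult_left_mono mult_mono e_le) (use \<nu> in auto)
  qed simp
  note series = orthogonal_series[OF orthonormal_hermite_basis[OF \<nu>] b2 b_pt]
  define g where "g z = (\<Sum>\<^sub>\<infinity>i. b i * ?e i z)" for z
  have g: "g \<in> square_integrable (meas ?X)" unfolding g_def[abs_def] by (rule series(1))
  have ke: "inner_prod ?X ?k (?e i) = b i" for i
    unfolding b_def by (subst inner_prod_commute) (simp only: inner_prod_basis_kernel)
  have ge: "inner_prod ?X g (?e i) = b i" for i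
    unfolding g_def[abs_def] by (rule series(4))
  have "eq_in ?X (\<lambda>z. ?k z - g z) (\<lambda>_. 0)"
  proof (rule hermite_basis_complete[OF \<nu> square_integrable_diff[OF kernel_square_integrable g]])
    show "inner_prod ?X (\<lambda>z. ?k z - g z) (?e i) = 0" for i
      by (simp only: inner_prod_diff_left[OF kernel_square_integrable g orthonormal_square_integrable[OF orthonormal_hermite_basis[OF \<nu>]]] ke ge diff_self)
  qed
  then have "eq_in ?X ?k g" by (simp add: eq_in_def)
  then have "inner_prod ?X ?k f = inner_prod ?X g f"
    by (rule inner_prod_cong_AE[rotated 3]) (use square_integrable_measurable kernel_square_integrable g f in blast)+
  then have "transform_R \<nu> w f (u, v) = cnj (inner_prod ?X g f)"
    unfolding transform_R_eq_inner_prod[OF f] by (subst inner_prod_commute) simp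
  also have "\<dots> = (\<Sum>\<^sub>\<infinity>i. cnj (b i * inner_prod ?X (?e i) f))"
    unfolding g_def[abs_def] series(3)[OF f] by (rule infsum_cnj[symmetric])
  also have "\<dots> = (\<Sum>\<^sub>\<infinity>i. ?e i w * inner_prod ?X f (?e i) * monomial i (u, v))"
    by (rule infsum_cong) (simp add: b_def inner_prod_commute[of ?X f "?e _"])
  finally show ?thesis .
qed

end

section \<open>Decay of the Beta integrals\<close>

lemma Beta_fact_eq:
  fixes \<alpha> :: real
  assumes "\<alpha> > 0"
  shows "Beta (real n + 1) (\<alpha> + 1) = fact n * Gamma (\<alpha> + 1) / Gamma (\<alpha> + real n + 2)"
  using Gamma_fact[of n, where 'a = real] by (simp add: Beta_def add_ac)

lemma Beta_pos:
  fixes \<alpha> :: real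
  assumes "\<alpha> > 0"
  shows "Beta (real n + 1) (\<alpha> + 1) > 0"
  unfolding Beta_fact_eq[OF assms] using assms by (intro divide_pos_pos mult_pos_pos Gamma_real_pos) auto

text \<open>Euler's limit formula for the Gamma function: the Beta integral times \<open>n powr (\<alpha> + 1)\<close> is the
  \<open>n\<close>-th member of the sequence that converges to \<open>Gamma (\<alpha> + 1)\<close>.\<close>

lemma Beta_le_powr:
  fixes \<alpha> :: real
  assumes \<alpha>: "\<alpha> > 0"
  obtains C where "C > 0" "\<And>n. n \<ge> 1 \<Longrightarrow> Beta (real n + 1) (\<alpha> + 1) \<le> C * real n powr - (\<alpha> + 1)"
proof -
  have "convergent (Gamma_series (\<alpha> + 1))"
    using Gamma_series_LIMSEQ[of "\<alpha> + 1"] by (auto simp: convergent_def)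
  then obtain C where C: "C > 0" "\<And>n. norm (Gamma_series (\<alpha> + 1) n) \<le> C"
    using convergent_imp_Bseq Bseq_def by metis
  have "Beta (real n + 1) (\<alpha> + 1) \<le> C * real n powr - (\<alpha> + 1)" if n: "n \<ge> 1" for n
  proof -
    have "pochhammer (\<alpha> + 1) (n + 1) = Gamma (\<alpha> + 1 + of_nat (n + 1)) / Gamma (\<alpha> + 1)"
      by (rule pochhammer_Gamma) (use \<alpha> in \<open>auto elim!: nonpos_Ints_cases\<close>)
    then have poch: "pochhammer (\<alpha> + 1) (n + 1) = Gamma (\<alpha> + real n + 2) / Gamma (\<alpha> + 1)"
      by (simp add: add_ac)
    have "Gamma_series (\<alpha> + 1) n = fact n * real n powr (\<alpha> + 1) / pochhammer (\<alpha> + 1) (n + 1)"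
      using n by (simp add: Gamma_series_def powr_def)
    also have "\<dots> = Beta (real n + 1) (\<alpha> + 1) * real n powr (\<alpha> + 1)"
      unfolding poch Beta_fact_eq[OF \<alpha>] by simp
    finally have "Beta (real n + 1) (\<alpha> + 1) * real n powr (\<alpha> + 1) \<le> C"
      using C(2)[of n] by simp
    then have "Beta (real n + 1) (\<alpha> + 1) * real n powr (\<alpha> + 1) * real n powr - (\<alpha> + 1) \<le> C * real n powr - (\<alpha> + 1)"
      by (rule mult_right_mono) simp
    then show ?thesis using n by (simp add: powr_add[symmetric] mult.assoc)
  qed
  then show ?thesis using C that by blast
qed

lemma summable_Beta_powr:
  fixes \<alpha> q :: real
  assumes \<alpha>: "\<alpha> > 0" and q: "q > 0" "(\<alpha> + 1) * q > 1"
  shows "summable (\<lambda>n. Beta (real n + 1) (\<alpha> + 1) powr q)"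
proof -
  obtain C where C: "C > 0" "\<And>n. n \<ge> 1 \<Longrightarrow> Beta (real n + 1) (\<alpha> + 1) \<le> C * real n powr - (\<alpha> + 1)"
    by (rule Beta_le_powr[OF \<alpha>]) blast
  have "summable (\<lambda>n. C powr q * real n powr (- (\<alpha> + 1) * q))"
    by (intro summable_mult) (use q in \<open>simp add: summable_real_powr_iff algebra_simps\<close>)
  then show ?thesis
  proof (rule summable_comparison_test'[where N = 1])
    fix n :: nat assume n: "n \<ge> 1"
    have "Beta (real n + 1) (\<alpha> + 1) powr q \<le> (C * real n powr - (\<alpha> + 1)) powr q"
      using C(2)[OF n] Beta_pos[OF \<alpha>, of n] q by (intro powr_mono2) auto
    also have "\<dots> = C powr q * real n powr (- (\<alpha> + 1) * q)"
      using C(1) by (simp add: powr_mult powr_powr)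
    finally show "norm (Beta (real n + 1) (\<alpha> + 1) powr q) \<le> C powr q * real n powr (- (\<alpha> + 1) * q)"
      by simp
  qed
qed

section \<open>The transform as a diagonal operator\<close>

lemma bergman2_funs_cong:
  assumes g: "g \<in> funs (bergman2 \<alpha> \<beta>)" and eq: "\<And>p. p \<in> bidisc \<Longrightarrow> f p = g p"
  shows "f \<in> funs (bergman2 \<alpha> \<beta>)"
proof -
  let ?M = "meas (bergman2 \<alpha> \<beta>)"
  have funs: "funs (bergman2 \<alpha> \<beta>) = {f \<in> square_integrable ?M. analytic2_on f bidisc}"
    by (simp add: bergman2_def)
  have "f \<in> borel_measurable ?M \<longleftrightarrow> g \<in> borel_measurable ?M"
    by (rule measurable_cong) (simp add: eq)
  moreover have "integrable ?M (\<lambda>p. (cmod (f p))\<^sup>2) \<longleftrightarrow> integrable ?M (\<lambda>p. (cmod (g p))\<^sup>2)"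
    by (rule Bochner_Integration.integrable_cong) (simp_all add: eq)
  moreover have "analytic2_on f bidisc"
    unfolding analytic2_on_def
  proof (intro conjI open_bidisc ballI)
    fix p assume p: "p \<in> bidisc"
    then obtain a b where "(g has_derivative (\<lambda>(h, k). a * h + b * k)) (at p)"
      using g unfolding funs analytic2_on_def by blast
    then have "(f has_derivative (\<lambda>(h, k). a * h + b * k)) (at p)"
      by (rule has_derivative_transform_within_open[OF _ open_bidisc p]) (simp add: eq)
    then show "\<exists>a b. (f has_derivative (\<lambda>(h, k). a * h + b * k)) (at p)" by blast
  qed
  ultimately show ?thesis using g unfolding funs by (auto simp: square_integrable_def)
qed

lemma bergman2_funs_lincomb:
  assumes "f \<in> funs (bergman2 \<alpha> \<beta>)" "g \<in> funs (bergman2 \<alpha> \<beta>)"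
  shows "(\<lambda>p. a * f p + b * g p) \<in> funs (bergman2 \<alpha> \<beta>)"
proof -
  have "analytic2_on (\<lambda>p. a * f p + b * g p) bidisc"
    unfolding analytic2_on_def
  proof (intro conjI open_bidisc ballI)
    fix p assume p: "p \<in> bidisc"
    then obtain c d c' d' where f': "(f has_derivative (\<lambda>(h, k). c * h + d * k)) (at p)"
      and g': "(g has_derivative (\<lambda>(h, k). c' * h + d' * k)) (at p)"
      using assms unfolding bergman2_def analytic2_on_def by (simp, blast)
    have "((\<lambda>p. a * f p + b * g p) has_derivative
        (\<lambda>x. a * (case x of (h, k) \<Rightarrow> c * h + d * k) + b * (case x of (h, k) \<Rightarrow> c' * h + d' * k))) (at p)"
      by (intro has_derivative_add has_derivative_mult_right f' g')
    also have "(\<lambda>x. a * (case x of (h, k) \<Rightarrow> c * h + d * k) + b * (case x of (h, k) \<Rightarrow> c' * h + d' * k)) =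
        (\<lambda>(h, k). (a * c + b * c') * h + (a * d + b * d') * k)"
      by (auto simp: fun_eq_iff algebra_simps)
    finally show "\<exists>A B. ((\<lambda>p. a * f p + b * g p) has_derivative (\<lambda>(h, k). A * h + B * k)) (at p)" by blast
  qed
  then show ?thesis using assms by (simp add: bergman2_def square_integrable_lincomb)
qed

context
  fixes \<nu> \<alpha> \<beta> :: real and w :: complex
  assumes \<nu>: "\<nu> > 0" and \<alpha>: "\<alpha> > 0" and \<beta>: "\<beta> > 0"
begin

definition bergman_norm :: "nat \<times> nat \<Rightarrow> real" where
  "bergman_norm = (\<lambda>(m, n). pi * sqrt (Beta (real m + 1) (\<alpha> + 1) * Beta (real n + 1) (\<beta> + 1)))"

lemma bergman_norm_pos: "bergman_norm i > 0"
  by (cases i) (simp add: bergman_norm_def Beta_pos \<alpha> \<beta>)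

lemma bergman_norm_square: "(bergman_norm (m, n))\<^sup>2 = pi\<^sup>2 * (Beta (real m + 1) (\<alpha> + 1) * Beta (real n + 1) (\<beta> + 1))"
  using Beta_pos[OF \<alpha>, of m] Beta_pos[OF \<beta>, of n] by (simp add: bergman_norm_def power_mult_distrib)

definition singular_value :: "nat \<times> nat \<Rightarrow> real" where
  "singular_value = (\<lambda>(m, n). sqrt (\<nu> * pi * Gamma (\<alpha> + 1) * Gamma (\<beta> + 1)
      / (\<nu> ^ (m + n) * Gamma (\<alpha> + real m + 2) * Gamma (\<beta> + real n + 2))) * cmod (ito_hermite \<nu> m n w))"

text \<open>The norm of the monomial is \<open>\<pi>\<close> times the square root of two Beta integrals; their factorials cancel
  those in the norm of the Hermite polynomial.\<close>

lemma singular_value_eq: "singular_value i = cmod (hermite_basis \<nu> i w) * bergman_norm i"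
proof (cases i)
  case (Pair m n)
  have G: "Gamma (\<alpha> + 1) > 0" "Gamma (\<beta> + 1) > 0" "Gamma (\<alpha> + real m + 2) > 0" "Gamma (\<beta> + real n + 2) > 0"
    using \<alpha> \<beta> by (auto intro!: Gamma_real_pos)
  have "(bergman_norm (m, n) / hermite_norm \<nu> m n)\<^sup>2 =
      \<nu> * pi * Gamma (\<alpha> + 1) * Gamma (\<beta> + 1) / (\<nu> ^ (m + n) * Gamma (\<alpha> + real m + 2) * Gamma (\<beta> + real n + 2))"
    unfolding power_divide bergman_norm_square hermite_norm_square[OF \<nu>] Beta_fact_eq[OF \<alpha>] Beta_fact_eq[OF \<beta>]
    using \<nu> G by (simp add: divide_simps power2_eq_square)
  then have "sqrt (\<nu> * pi * Gamma (\<alpha> + 1) * Gamma (\<beta> + 1) / (\<nu> ^ (m + n) * Gamma (\<alpha> + real m + 2) * Gamma (\<beta> + real n + 2))) =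
      bergman_norm (m, n) / hermite_norm \<nu> m n"
    using bergman_norm_pos[of "(m, n)"] hermite_norm_pos[OF \<nu>, of m n] by (metis abs_of_pos divide_pos_pos real_sqrt_abs)
  then show ?thesis
    using hermite_norm_pos[OF \<nu>, of m n]
    by (simp add: Pair singular_value_def hermite_basis_def norm_divide ito_hermite_eq mult.commute)
qed

lemma singular_value_nonneg: "0 \<le> singular_value i"
  unfolding singular_value_eq using bergman_norm_pos[of i] by simp

text \<open>The factor coming from the Hermite polynomials is bounded uniformly in \<open>(m, n)\<close>, so the squares
  of the singular values are dominated by products of two Beta integrals.\<close>

lemma summable_singular_value_powr:
  assumes q: "q > 0" "(\<alpha> + 1) * q > 1" "(\<beta> + 1) * q > 1"
  shows "(\<lambda>i. ((singular_value i)\<^sup>2) powr q) summable_on UNIV"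
proof -
  define C where "C = \<nu> / pi * exp (\<nu> * (cmod w)\<^sup>2) * pi\<^sup>2"
  have C: "C > 0" using \<nu> by (simp add: C_def)
  let ?B = "\<lambda>(m, n). Beta (real m + 1) (\<alpha> + 1) powr q * Beta (real n + 1) (\<beta> + 1) powr q"
  have "?B summable_on UNIV"
    by (intro summable_on_prod_mult summable_Beta_powr \<alpha> \<beta> q) auto
  then have "(\<lambda>i. C powr q * ?B i) summable_on UNIV" by (rule summable_on_cmult_right)
  then show ?thesis
  proof (rule summable_on_comparison_test)
    fix i :: "nat \<times> nat"
    obtain m n where i: "i = (m, n)" by (cases i)
    have "(singular_value i)\<^sup>2 \<le> (\<nu> / pi * exp (\<nu> * (cmod w)\<^sup>2)) * (bergman_norm i)\<^sup>2"
      unfolding singular_value_eq power_mult_distrib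
      by (rule mult_right_mono[OF hermite_basis_bound[OF \<nu>]]) simp
    also have "\<dots> = C * (Beta (real m + 1) (\<alpha> + 1) * Beta (real n + 1) (\<beta> + 1))"
      unfolding i bergman_norm_square C_def by (simp only: mult_ac)
    finally have "((singular_value i)\<^sup>2) powr q \<le> (C * (Beta (real m + 1) (\<alpha> + 1) * Beta (real n + 1) (\<beta> + 1))) powr q"
      by (rule powr_mono2[rotated 2]) (use q in auto)
    also have "\<dots> = C powr q * ?B i"
      unfolding i prod.case by (simp only: powr_mult)
    finally show "((singular_value i)\<^sup>2) powr q \<le> C powr q * ?B i" .
  qed simp
qed

lemma summable_singular_value_square: "(\<lambda>i. (singular_value i)\<^sup>2) summable_on UNIV"
  using summable_singular_value_powr[of 1] \<alpha> \<beta> by simp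

text \<open>Normalized monomials, multiplied by the phase of the Hermite polynomial at \<open>w\<close>, so that the
  remaining factor is nonnegative. Where the polynomial vanishes any phase will do; it is set to \<open>1\<close>,
  to keep the system orthonormal.\<close>

definition bergman_basis :: "nat \<times> nat \<Rightarrow> complex \<times> complex \<Rightarrow> complex" where
  "bergman_basis i p = (if hermite_basis \<nu> i w = 0 then 1 else sgn (hermite_basis \<nu> i w)) / of_real (bergman_norm i) * monomial i p"

lemma singular_value_times_bergman_basis:
  "of_real (singular_value i) * bergman_basis i p = hermite_basis \<nu> i w * monomial i p"
  using bergman_norm_pos[of i] by (simp add: singular_value_eq bergman_basis_def sgn_eq)

lemma orthonormal_bergman_basis: "orthonormal (bergman2 \<alpha> \<beta>) bergman_basis"
  unfolding orthonormal_def
proof (intro conjI allI)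
  show "bergman_basis i \<in> square_integrable (meas (bergman2 \<alpha> \<beta>))" for i
    unfolding bergman_basis_def[abs_def] by (intro square_integrable_scale monomial_square_integrable \<alpha> \<beta>)
  fix i j :: "nat \<times> nat"
  define c where "c i = (if hermite_basis \<nu> i w = 0 then 1 else sgn (hermite_basis \<nu> i w)) / of_real (bergman_norm i)" for i
  have c: "c i * cnj (c i) = 1 / of_real ((bergman_norm i)\<^sup>2)" for i
  proof -
    have "cmod (c i) = 1 / bergman_norm i"
      using bergman_norm_pos[of i] by (simp add: c_def norm_divide norm_sgn)
    then show ?thesis by (simp add: complex_norm_square[symmetric] power_divide)
  qed
  have "inner_prod (bergman2 \<alpha> \<beta>) (bergman_basis i) (bergman_basis j) = c i * cnj (c j) * inner_prod (bergman2 \<alpha> \<beta>) (monomial i) (monomial j)"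
    unfolding bergman_basis_def[abs_def] c_def[symmetric] inner_prod_scale_left
    by (subst inner_prod_commute, subst inner_prod_scale_left, subst inner_prod_commute) simp
  also have "\<dots> = (if i = j then 1 else 0)"
  proof (cases "i = j")
    case True
    obtain m n where i: "i = (m, n)" by (cases i)
    have "inner_prod (bergman2 \<alpha> \<beta>) (monomial i) (monomial i) = of_real ((bergman_norm i)\<^sup>2)"
      unfolding i bergman_norm_square inner_prod_monomial(2)[OF \<alpha> \<beta>] by simp
    then show ?thesis using True c[of j] bergman_norm_pos[of j] by (simp del: of_real_power)
  next
    case False
    obtain m n k l where ij: "i = (m, n)" "j = (k, l)" by (metis surj_pair)
    then have "\<not> (m = k \<and> n = l)" using False by simp
    then show ?thesis using False unfolding ij inner_prod_monomial(2)[OF \<alpha> \<beta>] by (simp only: if_False mult_zero_right)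
  qed
  finally show "inner_prod (bergman2 \<alpha> \<beta>) (bergman_basis i) (bergman_basis j) = (if i = j then 1 else 0)" .
qed

lemma weighted_orthonormal_hermite: "weighted_orthonormal (L2_gauss \<nu>) (hermite_basis \<nu>) singular_value"
proof
  show "orthonormal (L2_gauss \<nu>) (hermite_basis \<nu>)" by (rule orthonormal_hermite_basis[OF \<nu>])
  show "0 \<le> singular_value i" for i by (rule singular_value_nonneg)
  show "(\<lambda>i. (singular_value i)\<^sup>2) summable_on UNIV" by (rule summable_singular_value_square)
  show "(\<lambda>i. (singular_value i * cmod (hermite_basis \<nu> i x))\<^sup>2) summable_on UNIV" for x
  proof (rule summable_on_comparison_test[OF summable_on_cmult_left[OF summable_singular_value_square, of "\<nu> / pi * exp (\<nu> * (cmod x)\<^sup>2)"]])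
    show "(singular_value i * cmod (hermite_basis \<nu> i x))\<^sup>2 \<le> (singular_value i)\<^sup>2 * (\<nu> / pi * exp (\<nu> * (cmod x)\<^sup>2))" for i
      unfolding power_mult_distrib by (rule mult_left_mono[OF hermite_basis_bound[OF \<nu>]]) simp
  qed simp
qed

lemma weighted_orthonormal_bergman: "weighted_orthonormal (bergman2 \<alpha> \<beta>) bergman_basis singular_value"
proof
  show "orthonormal (bergman2 \<alpha> \<beta>) bergman_basis" by (rule orthonormal_bergman_basis)
  show "0 \<le> singular_value i" for i by (rule singular_value_nonneg)
  show "(\<lambda>i. (singular_value i)\<^sup>2) summable_on UNIV" by (rule summable_singular_value_square)
  fix p :: "complex \<times> complex" assume "p \<in> space (meas (bergman2 \<alpha> \<beta>))"
  then obtain u v where p: "p = (u, v)" "cmod u < 1" "cmod v < 1" by (auto simp: bidisc_def)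
  show "(\<lambda>i. (singular_value i * cmod (bergman_basis i p))\<^sup>2) summable_on UNIV"
  proof (rule summable_on_comparison_test[OF summable_on_cmult_right[OF monomial_summable(2)[OF \<nu> p(2,3)], of "\<nu> / pi * exp (\<nu> * (cmod w)\<^sup>2)"]])
    fix i :: "nat \<times> nat"
    have "singular_value i * cmod (bergman_basis i p) = cmod (of_real (singular_value i) * bergman_basis i p)"
      using singular_value_nonneg[of i] by (simp add: norm_mult)
    also have "\<dots> = cmod (hermite_basis \<nu> i w) * cmod (monomial i (u, v))"
      unfolding singular_value_times_bergman_basis p(1) by (rule norm_mult)
    finally show "(singular_value i * cmod (bergman_basis i p))\<^sup>2 \<le> (\<nu> / pi * exp (\<nu> * (cmod w)\<^sup>2)) * (cmod (monomial i (u, v)))\<^sup>2"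
      by (simp only: power_mult_distrib) (rule mult_right_mono[OF hermite_basis_bound[OF \<nu>]], simp)
  qed simp
qed

lemma weighted_series_bergman_basis:
  "weighted_series singular_value bergman_basis a = (\<lambda>(u, v). \<Sum>\<^sub>\<infinity>(m, n). (hermite_basis \<nu> (m, n) w * a (m, n)) * (u ^ m * v ^ n))"
proof
  fix p :: "complex \<times> complex"
  obtain u v where p: "p = (u, v)" by (cases p)
  have "of_real (singular_value i) * a i * bergman_basis i p = (case i of (m, n) \<Rightarrow> (hermite_basis \<nu> (m, n) w * a (m, n)) * (u ^ m * v ^ n))" for i
  proof -
    have "of_real (singular_value i) * a i * bergman_basis i p = a i * (hermite_basis \<nu> i w * monomial i p)"
      unfolding singular_value_times_bergman_basis[symmetric] by (simp only: mult_ac)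
    then show ?thesis by (cases i) (simp add: p monomial_def mult_ac)
  qed
  then show "weighted_series singular_value bergman_basis a p = (case p of (u, v) \<Rightarrow> \<Sum>\<^sub>\<infinity>(m, n). (hermite_basis \<nu> (m, n) w * a (m, n)) * (u ^ m * v ^ n))"
    by (simp only: weighted_series_def p prod.case)
qed

lemma weighted_series_in_bergman2:
  assumes a: "(\<lambda>i. (cmod (a i))\<^sup>2) summable_on UNIV"
  shows "weighted_series singular_value bergman_basis a \<in> funs (bergman2 \<alpha> \<beta>)"
proof -
  interpret weighted_orthonormal "bergman2 \<alpha> \<beta>" bergman_basis singular_value by (rule weighted_orthonormal_bergman)
  have "weighted_series singular_value bergman_basis a \<in> square_integrable (meas (bergman2 \<alpha> \<beta>))"
    by (rule weighted_series_square_integrable[OF a])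
  moreover have "analytic2_on (weighted_series singular_value bergman_basis a) bidisc"
    unfolding weighted_series_bergman_basis
  proof (rule analytic2_on_power_series)
    fix i
    have "cmod (hermite_basis \<nu> i w) \<le> sqrt (\<nu> / pi * exp (\<nu> * (cmod w)\<^sup>2))"
      by (rule real_le_rsqrt[OF hermite_basis_bound[OF \<nu>]])
    moreover have "cmod (a i) \<le> sqrt (\<Sum>\<^sub>\<infinity>i. (cmod (a i))\<^sup>2)"
      using finite_sum_le_infsum[OF a, of "{i}"] by (intro real_le_rsqrt) simp
    ultimately show "cmod (hermite_basis \<nu> i w * a i) \<le> sqrt (\<nu> / pi * exp (\<nu> * (cmod w)\<^sup>2)) * sqrt (\<Sum>\<^sub>\<infinity>i. (cmod (a i))\<^sup>2)"
      unfolding norm_mult by (rule mult_mono) (use \<nu> in auto)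
  qed
  ultimately show ?thesis by (simp add: bergman2_def)
qed

lemma transform_R_weighted_series:
  assumes f: "f \<in> square_integrable (meas (L2_gauss \<nu>))" and p: "p \<in> bidisc"
  shows "transform_R \<nu> w f p = weighted_series singular_value bergman_basis (\<lambda>i. inner_prod (L2_gauss \<nu>) f (hermite_basis \<nu> i)) p"
proof -
  obtain u v where uv: "p = (u, v)" "cmod u < 1" "cmod v < 1" using p by (auto simp: bidisc_def)
  show ?thesis
    unfolding uv(1) transform_R_series[OF \<nu> uv(2,3) f] weighted_series_def
  proof (rule infsum_cong)
    fix i :: "nat \<times> nat"
    show "hermite_basis \<nu> i w * inner_prod (L2_gauss \<nu>) f (hermite_basis \<nu> i) * monomial i (u, v) =
        of_real (singular_value i) * inner_prod (L2_gauss \<nu>) f (hermite_basis \<nu> i) * bergman_basis i (u, v)"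
      using singular_value_times_bergman_basis[of i "(u, v)"] by (metis (no_types, lifting) mult.assoc mult.commute)
  qed
qed

lemma diagonal_operator_transform_R:
  "diagonal_operator (L2_gauss \<nu>) (hermite_basis \<nu>) singular_value (bergman2 \<alpha> \<beta>) bergman_basis (transform_R \<nu> w)"
proof (rule diagonal_operator.intro[OF weighted_orthonormal_hermite weighted_orthonormal_bergman], unfold_locales)
  show "funs (L2_gauss \<nu>) = square_integrable (meas (L2_gauss \<nu>))" by (rule L2_gauss_simps(2))
  show "eq_in (L2_gauss \<nu>) f (\<lambda>_. 0)"
    if "f \<in> funs (L2_gauss \<nu>)" "\<And>i. inner_prod (L2_gauss \<nu>) f (hermite_basis \<nu> i) = 0" for f
    using that by (intro hermite_basis_complete[OF \<nu>]) (simp_all add: L2_gauss_simps(2))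
  show "funs (bergman2 \<alpha> \<beta>) \<subseteq> square_integrable (meas (bergman2 \<alpha> \<beta>))"
    by (auto simp: bergman2_def)
  show "(\<lambda>y. a * f y + b * g y) \<in> funs (bergman2 \<alpha> \<beta>)"
    if "f \<in> funs (bergman2 \<alpha> \<beta>)" "g \<in> funs (bergman2 \<alpha> \<beta>)" for f g a b
    by (rule bergman2_funs_lincomb[OF that])
  show "weighted_series singular_value bergman_basis a \<in> funs (bergman2 \<alpha> \<beta>)"
    if "(\<lambda>i. (cmod (a i))\<^sup>2) summable_on UNIV" for a
    by (rule weighted_series_in_bergman2[OF that])
  show eq: "transform_R \<nu> w f y = weighted_series singular_value bergman_basis (\<lambda>i. inner_prod (L2_gauss \<nu>) f (hermite_basis \<nu> i)) y"
    if "f \<in> funs (L2_gauss \<nu>)" "y \<in> space (meas (bergman2 \<alpha> \<beta>))" for f y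
    using that by (intro transform_R_weighted_series) (simp_all add: L2_gauss_simps(2))
  show "transform_R \<nu> w f \<in> funs (bergman2 \<alpha> \<beta>)" if f: "f \<in> funs (L2_gauss \<nu>)" for f
  proof (rule bergman2_funs_cong)
    show "weighted_series singular_value bergman_basis (\<lambda>i. inner_prod (L2_gauss \<nu>) f (hermite_basis \<nu> i)) \<in> funs (bergman2 \<alpha> \<beta>)"
      using f by (intro weighted_series_in_bergman2 Bessel_inequality(1)[OF orthonormal_hermite_basis[OF \<nu>]])
        (simp add: L2_gauss_simps(2))
  qed (use eq f in simp)
qed

end

theorem theorem1p2:
  fixes \<nu> \<alpha> \<beta> :: real and w :: complex
  assumes "\<nu> > 0" and "\<alpha> > 0" and "\<beta> > 0"
  shows "compact_op (L2_gauss \<nu>) (bergman2 \<alpha> \<beta>) (transform_R \<nu> w)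
    \<and> singular_values (L2_gauss \<nu>) (bergman2 \<alpha> \<beta>) (transform_R \<nu> w) (UNIV :: (nat \<times> nat) set)
        (\<lambda>(m, n). sqrt (\<nu> * pi * Gamma (\<alpha> + 1) * Gamma (\<beta> + 1)
             / (\<nu> ^ (m + n) * Gamma (\<alpha> + real m + 2) * Gamma (\<beta> + real n + 2)))
           * cmod (ito_hermite \<nu> m n w))
    \<and> (\<forall>p::real. p > max (2 / (\<alpha> + 1)) (2 / (\<beta> + 1)) \<longrightarrow>
         schatten_class p (L2_gauss \<nu>) (bergman2 \<alpha> \<beta>) (transform_R \<nu> w))"
proof -
  interpret diagonal_operator "L2_gauss \<nu>" "hermite_basis \<nu>" "singular_value \<nu> \<alpha> \<beta> w"
    "bergman2 \<alpha> \<beta>" "bergman_basis \<nu> \<alpha> \<beta> w" "transform_R \<nu> w"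
    by (rule diagonal_operator_transform_R[OF assms])
  have "schatten_class p (L2_gauss \<nu>) (bergman2 \<alpha> \<beta>) (transform_R \<nu> w)"
    if p: "p > max (2 / (\<alpha> + 1)) (2 / (\<beta> + 1))" for p
  proof -
    have "0 < 2 / (\<alpha> + 1)" using assms by simp
    then have "p > 0" using p by linarith
    have "p > 2 / (\<alpha> + 1)" "p > 2 / (\<beta> + 1)" using p by auto
    then have "(\<alpha> + 1) * (p / 2) > 1" "(\<beta> + 1) * (p / 2) > 1"
      using assms by (simp_all add: field_simps)
    then have "(\<lambda>i. ((singular_value \<nu> \<alpha> \<beta> w i)\<^sup>2) powr (p / 2)) summable_on UNIV"
      using \<open>p > 0\<close> by (intro summable_singular_value_powr[OF assms]) auto
    moreover have "((singular_value \<nu> \<alpha> \<beta> w i)\<^sup>2) powr (p / 2) = singular_value \<nu> \<alpha> \<beta> w i powr p" for i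
    proof (cases "singular_value \<nu> \<alpha> \<beta> w i = 0")
      case False
      then have "(singular_value \<nu> \<alpha> \<beta> w i)\<^sup>2 = singular_value \<nu> \<alpha> \<beta> w i powr 2"
        using singular_value_nonneg[OF assms, of w i] by simp
      then show ?thesis by (simp only: powr_powr) simp
    qed simp
    ultimately show ?thesis
      unfolding schatten_class_def using compact_T singular_values_T by auto
  qed
  then show ?thesis
    using compact_T singular_values_T unfolding singular_value_def[OF assms] by blast
qed

end
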